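(* Let $J$ be a bounded Jacobi operator on $\ell^2(\mathbb{Z})$ and let $Q$ be the projection-valued measure on $[0,\pi)$ associated with $J$ (defined in the context). Then $Q$ commutes with $J$, and for any $a,b\in(0,\frac{\pi}{2})$ there exists $\gamma>0$ such that for any $\alpha,\beta\in(a,b)$ with $\alpha<\beta$, any $\theta\in[\alpha,\beta)$ and any $\psi\in\mathcal{H}_+$, $$\big\|J_sQ([\alpha,\beta))\psi-J_\theta Q([\alpha,\beta))\psi\big\|<\gamma|\beta-\alpha|\,\big\|Q([\alpha,\beta))\psi\big\|.$$
   Context: A bounded Jacobi operator $J$ on $\ell^2(\mathbb{Z})$ is $(J\psi)(n)=a_{n-1}\psi(n-1)+a_n\psi(n+1)+b_n\psi(n)$, with $(a_n),(b_n)$ bounded real sequences and $a_n>0$ for all $n\in\mathbb{Z}$. $P$ is its spectral measure, $\mu_\psi(B)=\langle P(B)\psi,\psi\rangle$, $\mu_{kj}(B)=\langle P(B)\delta_k,\delta_j\rangle$, $\mu=\mu_{\delta_0}+\mu_{\delta_1}$, and $\mu_s$ is the part of $\mu$ singular with respect to Lebesgue measure. $M_{kj}(z)=\int\frac{d\mu_{kj}(E)}{E-z}$ and $M(z)=\int\frac{d\mu(E)}{E-z}$ for $\operatorname{Im}z>0$. $\mathcal{H}_{\rm s}$ is the closed $J$-invariant subspace of $\psi$ with $\mu_\psi$ singular; $J_s=J|_{\mathcal{H}_{\rm s}}$, extended by $0$ on $\mathcal{H}_{\rm s}^\perp$. $\mathcal{H}_+=\{\psi\in\ell^2(\mathbb{Z}):\sum_nn^2|\psi(n)|^2<\infty\}$.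 With $\mathbb{Z}_+=\{1,2,\dots\}$, $\mathbb{Z}_-=\{0,-1,\dots\}$ and $J_0^\pm$ the compression of $J$ to $\ell^2(\mathbb{Z}_\pm)$, for $\theta\in(0,\pi/2)$, $$J_\theta=\big(J_0^--\cot\theta\,\langle\delta_0,\cdot\rangle\delta_0\big)\oplus\big(J_0^+-\tan\theta\,\langle\delta_1,\cdot\rangle\delta_1\big).$$ Solutions at energy $E$ are functions $u:\mathbb{Z}\to\mathbb{C}$ with $a_{n-1}u(n-1)+a_nu(n+1)+b_nu(n)=Eu(n)$ for all $n$. For $L>1$ let $\|u\|_L=\big[\sum_{n=1}^{\lfloor L\rfloor}|u(n)|^2+(L-\lfloor L\rfloor)|u(\lfloor L\rfloor+1)|^2\big]^{1/2}$ on $\mathbb{Z}_+$, and analogously on $\mathbb{Z}_-$ (starting at $0$, going left). A nonzero solution $u$ is subordinate if for every linearly independent solution $v$ at the same energy $\|u\|_L/\|v\|_L\to0$ as $L\to\infty$, both on $\mathbb{Z}_+$ and on $\mathbb{Z}_-$. $S$ is the set of $E\in\mathbb{R}$ admitting a subordinate solution. For $\theta\in[0,\pi)$, $S_\theta$ is the set of $E\in S$ whose subordinate solution (unique up to scalars) satisfies $u(0)\cos\theta+u(1)\sin\theta=0$; thus $S=\bigcup_\theta S_\theta$. $\widetilde S\subseteq S$ is a fixed Borel set with $\mu_s(\mathbb{R}\setminus\widetilde S)=0$ such that for all $E\in\widetilde S$, $k,j\in\mathbb{Z}$, $\lim_{\epsilon\to0}\frac{\mu_{kj}((E-\epsilon,E+\epsilon))}{\mu((E-\epsilon,E+\epsilon))}=\lim_{\epsilon\to0}\frac{M_{kj}(E+i\epsilon)}{M(E+i\epsilon)}=u_E(k)u_E(j)$,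 where $u_E$ is the real-valued subordinate solution with $|u_E(0)|^2+|u_E(1)|^2=1$ (unique up to sign); such a set exists. For Borel $B\subseteq[0,\pi)$, $S_B=\bigcup_{\theta\in B}S_\theta\cap\widetilde S$ (a Borel set), and $Q(B)=P(S_B)$.
   Formalization: The rank-one terms of J_θ are taken with the factor a_0 (a_0 cot θ and a_0 tan θ), since the printed formula makes the bound false when a_0 ≠ 1; the strict inequality is claimed only when Q([α,β))ψ ≠ 0, with ≤ otherwise, since it would read 0 < 0. *)

theory Defs
  imports "HOL-Analysis.Analysis"
begin

section \<open>The Hilbert space of square-summable functions on the integers\<close>

text \<open>Vectors are functions on the integers subject to membership in the carrier \<open>ell2\<close>;
  operators are functions on vectors and are only meaningful on \<open>ell2\<close>.
  The inner product is linear in its first argument.\<close>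

definition ell2 :: "(int \<Rightarrow> complex) set" where
  "ell2 = {\<psi>. (\<lambda>n. (cmod (\<psi> n))\<^sup>2) summable_on UNIV}"

definition inner2 :: "(int \<Rightarrow> complex) \<Rightarrow> (int \<Rightarrow> complex) \<Rightarrow> complex" where
  "inner2 \<phi> \<psi> = (\<Sum>\<^sub>\<infinity>n\<in>UNIV. \<phi> n * cnj (\<psi> n))"

definition norm2 :: "(int \<Rightarrow> complex) \<Rightarrow> real" where
  "norm2 \<psi> = sqrt (\<Sum>\<^sub>\<infinity>n\<in>UNIV. (cmod (\<psi> n))\<^sup>2)"

definition delta :: "int \<Rightarrow> int \<Rightarrow> complex" where
  "delta k = (\<lambda>n. if n = k then 1 else 0)"

definition ell2_weighted :: "(int \<Rightarrow> complex) set" where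
  "ell2_weighted =
     {\<psi> \<in> ell2. (\<lambda>n. (real_of_int n)\<^sup>2 * (cmod (\<psi> n))\<^sup>2) summable_on UNIV}"

type_synonym operator = "(int \<Rightarrow> complex) \<Rightarrow> (int \<Rightarrow> complex)"

definition orthogonal_projection :: "operator \<Rightarrow> bool" where
  "orthogonal_projection T \<longleftrightarrow>
     (\<forall>\<psi>\<in>ell2. T \<psi> \<in> ell2 \<and> T (T \<psi>) = T \<psi>) \<and>
     (\<forall>\<phi>\<in>ell2. \<forall>\<psi>\<in>ell2. \<forall>c. T (\<lambda>n. c * \<phi> n + \<psi> n) = (\<lambda>n. c * T \<phi> n + T \<psi> n)) \<and>
     (\<forall>\<phi>\<in>ell2. \<forall>\<psi>\<in>ell2. inner2 (T \<phi>) \<psi> = inner2 \<phi> (T \<psi>))"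

definition proj_onto :: "(int \<Rightarrow> complex) set \<Rightarrow> operator" where
  "proj_onto H \<psi> = (THE \<phi>. \<phi> \<in> H \<and> (\<forall>h\<in>H. inner2 (\<lambda>n. \<psi> n - \<phi> n) h = 0))"

section \<open>Jacobi operators\<close>

definition jacobi :: "(int \<Rightarrow> real) \<Rightarrow> (int \<Rightarrow> real) \<Rightarrow> operator" where
  "jacobi a b \<psi> = (\<lambda>n. of_real (a (n - 1)) * \<psi> (n - 1) + of_real (a n) * \<psi> (n + 1)
                         + of_real (b n) * \<psi> n)"

definition bounded_jacobi :: "(int \<Rightarrow> real) \<Rightarrow> (int \<Rightarrow> real) \<Rightarrow> bool" where
  "bounded_jacobi a b \<longleftrightarrow> bounded (range a) \<and> bounded (range b) \<and> (\<forall>n. 0 < a n)"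

definition restrict_vec :: "int set \<Rightarrow> operator" where
  "restrict_vec X \<psi> = (\<lambda>n. if n \<in> X then \<psi> n else 0)"

definition compression :: "int set \<Rightarrow> operator \<Rightarrow> operator" where
  "compression X T \<psi> = restrict_vec X (T (restrict_vec X \<psi>))"

text \<open>The direct sum is realised on functions on all the integers. The rank-one terms carry the
  factor \<open>a 0\<close>, the weight of the bond between 0 and 1: since
  \<open>u 0 * cos \<theta> + u 1 * sin \<theta> = 0\<close> means \<open>u 1 = - cot \<theta> * u 0\<close> and \<open>u 0 = - tan \<theta> * u 1\<close>,
  this is the decoupling for which a solution with that boundary condition still satisfies the
  eigenvalue equation of \<open>J_theta\<close>. When \<open>a 0 = 1\<close> the factor is invisible.\<close>

definition J_theta :: "(int \<Rightarrow> real) \<Rightarrow> (int \<Rightarrow> real) \<Rightarrow> real \<Rightarrow> operator" where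
  "J_theta a b \<theta> \<psi> = (\<lambda>n.
      (compression {..0} (jacobi a b) \<psi> n - of_real (a 0 * cot \<theta>) * \<psi> 0 * delta 0 n)
    + (compression {1..} (jacobi a b) \<psi> n - of_real (a 0 * tan \<theta>) * \<psi> 1 * delta 1 n))"

section \<open>Spectral measures\<close>

definition proj_valued_measure :: "(real set \<Rightarrow> operator) \<Rightarrow> bool" where
  "proj_valued_measure P \<longleftrightarrow>
     (\<forall>B\<in>sets borel. orthogonal_projection (P B)) \<and>
     (\<exists>R. \<forall>\<psi>\<in>ell2. P {-R..R} \<psi> = \<psi>) \<and>
     (\<forall>A\<in>sets borel. \<forall>B\<in>sets borel. \<forall>\<psi>\<in>ell2. P (A \<inter> B) \<psi> = P A (P B \<psi>)) \<and>
     (\<forall>A :: nat \<Rightarrow> real set. range A \<subseteq> sets borel \<longrightarrow> disjoint_family A \<longrightarrow>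
        (\<forall>\<psi>\<in>ell2. (\<lambda>N. norm2 (\<lambda>n. (\<Sum>i<N. P (A i) \<psi> n) - P (\<Union>i. A i) \<psi> n))
                       \<longlonglongrightarrow> 0))"

definition vec_measure :: "(real set \<Rightarrow> operator) \<Rightarrow> (int \<Rightarrow> complex) \<Rightarrow> real measure" where
  "vec_measure P \<psi> = measure_of UNIV (sets borel) (\<lambda>B. ennreal (Re (inner2 (P B \<psi>) \<psi>)))"

definition is_spectral_measure :: "operator \<Rightarrow> (real set \<Rightarrow> operator) \<Rightarrow> bool" where
  "is_spectral_measure T P \<longleftrightarrow> proj_valued_measure P \<and>
     (\<forall>\<psi>\<in>ell2. inner2 (T \<psi>) \<psi> = of_real (\<integral>E. E \<partial>vec_measure P \<psi>))"

definition mu_cross :: "(real set \<Rightarrow> operator) \<Rightarrow> int \<Rightarrow> int \<Rightarrow> real set \<Rightarrow> complex" where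
  "mu_cross P k j B = inner2 (P B (delta k)) (delta j)"

text \<open>Integration against the complex measure \<open>mu_cross P k j\<close>, through its polarisation into
  four finite positive measures.\<close>

definition integral_mu_cross ::
    "(real set \<Rightarrow> operator) \<Rightarrow> int \<Rightarrow> int \<Rightarrow> (real \<Rightarrow> complex) \<Rightarrow> complex" where
  "integral_mu_cross P k j f =
     (\<Sum>m<4. \<i> ^ m * (\<integral>E. f E \<partial>vec_measure P (\<lambda>n. delta k n + \<i> ^ m * delta j n))) / 4"

definition mu :: "(real set \<Rightarrow> operator) \<Rightarrow> real measure" where
  "mu P = measure_of UNIV (sets borel)
     (\<lambda>B. emeasure (vec_measure P (delta 0)) B + emeasure (vec_measure P (delta 1)) B)"

definition M_cross :: "(real set \<Rightarrow> operator) \<Rightarrow> int \<Rightarrow> int \<Rightarrow> complex \<Rightarrow> complex" where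
  "M_cross P k j z = integral_mu_cross P k j (\<lambda>E. 1 / (of_real E - z))"

definition M_fun :: "(real set \<Rightarrow> operator) \<Rightarrow> complex \<Rightarrow> complex" where
  "M_fun P z = (\<integral>E. 1 / (of_real E - z) \<partial>mu P)"

definition lebesgue_singular :: "real measure \<Rightarrow> bool" where
  "lebesgue_singular m \<longleftrightarrow> (\<exists>N\<in>null_sets lborel. emeasure m (UNIV - N) = 0)"

definition lebesgue_decomposition :: "real measure \<Rightarrow> real measure \<Rightarrow> real measure \<Rightarrow> bool" where
  "lebesgue_decomposition m mac ms \<longleftrightarrow>
     sets mac = sets borel \<and> sets ms = sets borel \<and>
     (\<forall>B\<in>sets borel. emeasure m B = emeasure mac B + emeasure ms B) \<and>
     absolutely_continuous lborel mac \<and> lebesgue_singular ms"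

definition singular_part :: "real measure \<Rightarrow> real measure" where
  "singular_part m = (THE ms. \<exists>mac. lebesgue_decomposition m mac ms)"

definition H_s :: "(real set \<Rightarrow> operator) \<Rightarrow> (int \<Rightarrow> complex) set" where
  "H_s P = {\<psi> \<in> ell2. lebesgue_singular (vec_measure P \<psi>)}"

definition J_s :: "(int \<Rightarrow> real) \<Rightarrow> (int \<Rightarrow> real) \<Rightarrow> (real set \<Rightarrow> operator) \<Rightarrow> operator" where
  "J_s a b P \<psi> = jacobi a b (proj_onto (H_s P) \<psi>)"

section \<open>Subordinate solutions\<close>

definition is_solution :: "(int \<Rightarrow> real) \<Rightarrow> (int \<Rightarrow> real) \<Rightarrow> real \<Rightarrow> (int \<Rightarrow> complex) \<Rightarrow> bool" where
  "is_solution a b E u \<longleftrightarrow> (\<forall>n. jacobi a b u n = of_real E * u n)"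

definition norm_right :: "real \<Rightarrow> (int \<Rightarrow> complex) \<Rightarrow> real" where
  "norm_right L u = sqrt ((\<Sum>n=1..\<lfloor>L\<rfloor>. (cmod (u n))\<^sup>2)
                          + (L - of_int \<lfloor>L\<rfloor>) * (cmod (u (\<lfloor>L\<rfloor> + 1)))\<^sup>2)"

definition norm_left :: "real \<Rightarrow> (int \<Rightarrow> complex) \<Rightarrow> real" where
  "norm_left L u = norm_right L (\<lambda>n. u (1 - n))"

definition lin_indep :: "(int \<Rightarrow> complex) \<Rightarrow> (int \<Rightarrow> complex) \<Rightarrow> bool" where
  "lin_indep u v \<longleftrightarrow> (\<forall>c d. (\<forall>n. c * u n + d * v n = 0) \<longrightarrow> c = 0 \<and> d = 0)"

definition subordinate :: "(int \<Rightarrow> real) \<Rightarrow> (int \<Rightarrow> real) \<Rightarrow> real \<Rightarrow> (int \<Rightarrow> complex) \<Rightarrow> bool" where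
  "subordinate a b E u \<longleftrightarrow> is_solution a b E u \<and> (\<exists>n. u n \<noteq> 0) \<and>
     (\<forall>v. is_solution a b E v \<and> lin_indep u v \<longrightarrow>
        ((\<lambda>L. norm_right L u / norm_right L v) \<longlongrightarrow> 0) at_top \<and>
        ((\<lambda>L. norm_left L u / norm_left L v) \<longlongrightarrow> 0) at_top)"

definition S_set :: "(int \<Rightarrow> real) \<Rightarrow> (int \<Rightarrow> real) \<Rightarrow> real set" where
  "S_set a b = {E. \<exists>u. subordinate a b E u}"

text \<open>A subordinate solution is unique up to scalars, so the existential is harmless.\<close>

definition S_theta :: "(int \<Rightarrow> real) \<Rightarrow> (int \<Rightarrow> real) \<Rightarrow> real \<Rightarrow> real set" where
  "S_theta a b \<theta> =
     {E. \<exists>u. subordinate a b E u \<and> u 0 * of_real (cos \<theta>) + u 1 * of_real (sin \<theta>) = 0}"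

section \<open>The projection-valued measure on angles\<close>

definition normalised_subordinate ::
    "(int \<Rightarrow> real) \<Rightarrow> (int \<Rightarrow> real) \<Rightarrow> real \<Rightarrow> (int \<Rightarrow> real) \<Rightarrow> bool" where
  "normalised_subordinate a b E u \<longleftrightarrow>
     subordinate a b E (\<lambda>n. of_real (u n)) \<and> \<bar>u 0\<bar>\<^sup>2 + \<bar>u 1\<bar>\<^sup>2 = 1"

definition is_S_tilde ::
    "(int \<Rightarrow> real) \<Rightarrow> (int \<Rightarrow> real) \<Rightarrow> (real set \<Rightarrow> operator) \<Rightarrow> real set \<Rightarrow> bool" where
  "is_S_tilde a b P St \<longleftrightarrow>
     St \<in> sets borel \<and> St \<subseteq> S_set a b \<and> emeasure (singular_part (mu P)) (UNIV - St) = 0 \<and>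
     (\<forall>E\<in>St. \<exists>u. normalised_subordinate a b E u \<and> (\<forall>k j.
        ((\<lambda>\<epsilon>. mu_cross P k j {E - \<epsilon><..<E + \<epsilon>} / of_real (measure (mu P) {E - \<epsilon><..<E + \<epsilon>}))
            \<longlongrightarrow> of_real (u k * u j)) (at_right 0) \<and>
        ((\<lambda>\<epsilon>. M_cross P k j (of_real E + \<i> * of_real \<epsilon>) / M_fun P (of_real E + \<i> * of_real \<epsilon>))
            \<longlongrightarrow> of_real (u k * u j)) (at_right 0)))"

definition S_angles ::
    "(int \<Rightarrow> real) \<Rightarrow> (int \<Rightarrow> real) \<Rightarrow> real set \<Rightarrow> real set \<Rightarrow> real set" where
  "S_angles a b St B = (\<Union>\<theta>\<in>B. S_theta a b \<theta>) \<inter> St"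

definition Q_measure :: "(int \<Rightarrow> real) \<Rightarrow> (int \<Rightarrow> real) \<Rightarrow> (real set \<Rightarrow> operator) \<Rightarrow> real set
    \<Rightarrow> real set \<Rightarrow> operator" where
  "Q_measure a b P St B = P (S_angles a b St B)"

end

theory Submission
  imports Defs "HOL-Complex_Analysis.Complex_Analysis"
begin

text \<open>
  \<open>J_theta\<close> decouples the bond between the sites \<open>0\<close> and \<open>1\<close> in such a way that
  \<open>J \<phi> - J_theta \<phi>\<close> lives on these two sites, with values that are multiples of the boundary form
  \<open>\<phi> 0 * cos \<theta> + \<phi> 1 * sin \<theta>\<close> (\<open>norm2_jacobi_minus_J_theta\<close>). For \<open>\<phi>\<close> in the range of
  \<open>Q [\<alpha>, \<beta>)\<close> this form is small: \<open>Q [\<alpha>, \<beta>)\<close> is the spectral projection of a set \<open>A\<close> of energies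
  whose subordinate solution \<open>u\<close> has an angle within \<open>\<beta> - \<alpha>\<close> of \<open>\<theta>\<close>, and there the spectral measure
  of the test vector \<open>\<xi> = cos \<theta> \<delta>\<^sub>0 + sin \<theta> \<delta>\<^sub>1\<close> has the density
  \<open>(cos \<theta> * u 0 + sin \<theta> * u 1)\<^sup>2\<close> with respect to \<open>\<mu>\<close>, which is the squared sine of the difference of
  the two angles. Hence \<open>P A \<xi>\<close> has norm \<open>O(\<beta> - \<alpha>)\<close>, and the boundary form
  is the inner product of \<open>\<phi>\<close> with \<open>P A \<xi>\<close> (\<open>boundary_form_le\<close>). The density is only known as a limit
  over centred intervals; a covering argument special to the line (\<open>measure_le_of_centred_intervals\<close>)
  turns it into a bound on \<open>A\<close>, up to a factor two that is absorbed in \<open>\<gamma>\<close>.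

  For this to be a statement about \<open>J_s\<close>, the range of \<open>Q [\<alpha>, \<beta>)\<close> must consist of vectors with singular
  spectral measure. This holds because the set \<open>S\<close> of energies with a subordinate solution is
  Lebesgue null (\<open>AE_not_subordinate\<close>), which is proved here from first principles. Let
  \<open>g = (J - E - i \<epsilon>)\<^bsup>-1\<^esup> \<delta>\<^sub>k\<close> for \<open>k = 0, 1\<close>. The diagonal resolvent entries have positive
  imaginary part, so the square root of their modulus is locally integrable in \<open>E\<close>, uniformly in \<open>\<epsilon>\<close>
  (\<open>herglotz_sqrt_integral_bound\<close>); by Fatou, at almost every \<open>E\<close> the entries at the sites
  \<open>0\<close> and \<open>1\<close> stay bounded along a sequence \<open>\<epsilon> \<rightarrow> 0\<close>, and with them \<open>\<epsilon> \<parallel>g\<parallel>\<^sup>2\<close>. If a solution \<open>u\<close> is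
  subordinate at such an \<open>E\<close>, then on either side \<open>g\<close> becomes proportional to \<open>u\<close> near the origin
  (\<open>subordinate_wronskian_small\<close>): a component along the dominating solution would cost too much norm
  on the length scale where \<open>\<epsilon> \<parallel>u\<parallel> \<parallel>v\<parallel> = 1\<close>, \<open>v\<close> being a second
  solution. But the jump of the Wronskian of \<open>u\<close> and \<open>g\<close> across the
  source tends to \<open>u k\<close>, so \<open>u 0 = u 1 = 0\<close>, which is impossible.

  That \<open>P\<close> commutes with \<open>J\<close> has to be recovered from the quadratic form of \<open>J\<close>
  (\<open>P_commutes_J\<close>), and that \<open>S_angles\<close> yields Borel sets follows from writing the angle of the
  subordinate solution as a function of limits of measures (\<open>S_theta_iff_angle\<close>).
\<close>

section \<open>Square-summable sequences\<close>

lemma ell2_bounded_sums: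
  assumes "\<And>F. finite F \<Longrightarrow> (\<Sum>n\<in>F. (cmod (f n))\<^sup>2) \<le> C"
  shows "f \<in> ell2"
  unfolding ell2_def
proof (simp, rule nonneg_bdd_above_summable_on)
  show "bdd_above (sum (\<lambda>n. (cmod (f n))\<^sup>2) ` {F. F \<subseteq> UNIV \<and> finite F})"
    using assms by (auto intro!: bdd_aboveI)
qed simp

lemma norm2_nonneg [simp]: "0 \<le> norm2 f"
  unfolding norm2_def by (simp add: infsum_nonneg)

lemma norm2_sq: "(norm2 f)\<^sup>2 = (\<Sum>\<^sub>\<infinity>n\<in>UNIV. (cmod (f n))\<^sup>2)"
  unfolding norm2_def by (simp add: infsum_nonneg)

lemma finite_sum_le_norm2:
  assumes "f \<in> ell2" "finite F"
  shows "(\<Sum>n\<in>F. (cmod (f n))\<^sup>2) \<le> (norm2 f)\<^sup>2"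
  unfolding norm2_sq using assms unfolding ell2_def
  by (intro finite_sum_le_infsum) auto

lemma cmod_le_norm2: "f \<in> ell2 \<Longrightarrow> cmod (f n) \<le> norm2 f"
proof (rule power2_le_imp_le)
  assume "f \<in> ell2"
  from finite_sum_le_norm2[OF this, of "{n}"] show "(cmod (f n))\<^sup>2 \<le> (norm2 f)\<^sup>2" by simp
qed simp

lemma L2_set_le_norm2:
  assumes "f \<in> ell2" "finite F"
  shows "L2_set (\<lambda>n. cmod (f n)) F \<le> norm2 f"
  unfolding L2_set_def using finite_sum_le_norm2[OF assms]
  by (simp add: real_le_lsqrt sum_nonneg)

lemma norm2_le_bounded_sums:
  assumes "\<And>F. finite F \<Longrightarrow> (\<Sum>n\<in>F. (cmod (f n))\<^sup>2) \<le> C\<^sup>2" "0 \<le> C"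
  shows "norm2 f \<le> C"
proof -
  have "f \<in> ell2" using assms(1) by (rule ell2_bounded_sums)
  then have "(norm2 f)\<^sup>2 \<le> C\<^sup>2"
    unfolding norm2_sq using assms(1) unfolding ell2_def
    by (intro infsum_le_finite_sums) auto
  then show ?thesis using assms(2) by (rule power2_le_imp_le)
qed

lemma ell2_zero [simp]: "(\<lambda>n. 0) \<in> ell2"
  unfolding ell2_def by simp

lemma norm2_zero [simp]: "norm2 (\<lambda>n. 0) = 0"
  unfolding norm2_def by simp

lemma norm2_eq_0_iff: "f \<in> ell2 \<Longrightarrow> norm2 f = 0 \<longleftrightarrow> f = (\<lambda>n. 0)"
  using cmod_le_norm2[of f] by (metis norm2_zero ext norm_le_zero_iff)

lemma ell2_lincomb:
  assumes "f \<in> ell2" "g \<in> ell2"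
  shows "(\<lambda>n. c * f n + d * g n) \<in> ell2"
proof (rule ell2_bounded_sums)
  fix F :: "int set" assume F: "finite F"
  have *: "(cmod (c * f n + d * g n))\<^sup>2 \<le> 2 * (cmod c)\<^sup>2 * (cmod (f n))\<^sup>2 + 2 * (cmod d)\<^sup>2 * (cmod (g n))\<^sup>2" for n
  proof -
    have "(cmod (c * f n + d * g n))\<^sup>2 \<le> (cmod (c * f n) + cmod (d * g n))\<^sup>2"
      by (intro power_mono norm_triangle_ineq) auto
    also have "\<dots> \<le> 2 * (cmod (c * f n))\<^sup>2 + 2 * (cmod (d * g n))\<^sup>2"
      using sum_squares_bound[of "cmod (c * f n)" "cmod (d * g n)"] by (simp add: power2_sum)
    finally show ?thesis by (simp add: norm_mult power_mult_distrib)
  qed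
  have "(\<Sum>n\<in>F. (cmod (c * f n + d * g n))\<^sup>2)
      \<le> (\<Sum>n\<in>F. 2 * (cmod c)\<^sup>2 * (cmod (f n))\<^sup>2 + 2 * (cmod d)\<^sup>2 * (cmod (g n))\<^sup>2)"
    by (intro sum_mono *)
  also have "\<dots> = 2 * (cmod c)\<^sup>2 * (\<Sum>n\<in>F. (cmod (f n))\<^sup>2) + 2 * (cmod d)\<^sup>2 * (\<Sum>n\<in>F. (cmod (g n))\<^sup>2)"
    by (simp add: sum.distrib sum_distrib_left)
  also have "\<dots> \<le> 2 * (cmod c)\<^sup>2 * (norm2 f)\<^sup>2 + 2 * (cmod d)\<^sup>2 * (norm2 g)\<^sup>2"
    by (intro add_mono mult_left_mono finite_sum_le_norm2 assms F) auto
  finally show "(\<Sum>n\<in>F. (cmod (c * f n + d * g n))\<^sup>2) \<le> 2 * (cmod c)\<^sup>2 * (norm2 f)\<^sup>2 + 2 * (cmod d)\<^sup>2 * (norm2 g)\<^sup>2" .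
qed

lemma ell2_scale: "f \<in> ell2 \<Longrightarrow> (\<lambda>n. c * f n) \<in> ell2"
  using ell2_lincomb[of f "\<lambda>n. 0" c 0] by simp

lemma ell2_add: "f \<in> ell2 \<Longrightarrow> g \<in> ell2 \<Longrightarrow> (\<lambda>n. f n + g n) \<in> ell2"
  using ell2_lincomb[of f g 1 1] by simp

lemma ell2_diff: "f \<in> ell2 \<Longrightarrow> g \<in> ell2 \<Longrightarrow> (\<lambda>n. f n - g n) \<in> ell2"
  using ell2_lincomb[of f g 1 "-1"] by simp

lemma ell2_cnj: "f \<in> ell2 \<Longrightarrow> (\<lambda>n. cnj (f n)) \<in> ell2"
  unfolding ell2_def by simp

lemma norm2_cnj [simp]: "norm2 (\<lambda>n. cnj (f n)) = norm2 f"
  unfolding norm2_def by simp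

lemma ell2_finite_support: "finite {n. f n \<noteq> 0} \<Longrightarrow> f \<in> ell2"
  unfolding ell2_def by (simp add: finite_nonzero_values_imp_summable_on)

lemma delta_ell2 [simp]: "delta k \<in> ell2"
  by (rule ell2_finite_support) (simp add: delta_def)

lemma ell2_abs_prod_summable:
  assumes "f \<in> ell2" "g \<in> ell2"
  shows "(\<lambda>n. cmod (f n * cnj (g n))) summable_on UNIV"
proof -
  have s: "(\<lambda>n. (cmod (f n))\<^sup>2 + (cmod (g n))\<^sup>2) summable_on UNIV"
    using assms unfolding ell2_def by (intro summable_on_add) auto
  show ?thesis
  proof (rule summable_on_comparison_test[OF s])
    fix n
    show "cmod (f n * cnj (g n)) \<le> (cmod (f n))\<^sup>2 + (cmod (g n))\<^sup>2"
      using sum_squares_bound[of "cmod (f n)" "cmod (g n)"]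
        mult_nonneg_nonneg[OF norm_ge_zero[of "f n"] norm_ge_zero[of "g n"]]
      unfolding norm_mult complex_mod_cnj by linarith
  qed auto
qed

lemma ell2_prod_summable:
  assumes "f \<in> ell2" "g \<in> ell2"
  shows "(\<lambda>n. f n * cnj (g n)) summable_on UNIV"
  using ell2_abs_prod_summable[OF assms] summable_on_iff_abs_summable_on_complex by blast

lemma inner2_lincomb_left:
  assumes "f \<in> ell2" "g \<in> ell2" "h \<in> ell2"
  shows "inner2 (\<lambda>n. c * f n + d * g n) h = c * inner2 f h + d * inner2 g h"
proof -
  have "inner2 (\<lambda>n. c * f n + d * g n) h
      = (\<Sum>\<^sub>\<infinity>n. c * (f n * cnj (h n)) + d * (g n * cnj (h n)))"
    unfolding inner2_def by (simp add: algebra_simps)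
  also have "\<dots> = (\<Sum>\<^sub>\<infinity>n. c * (f n * cnj (h n))) + (\<Sum>\<^sub>\<infinity>n. d * (g n * cnj (h n)))"
    by (intro infsum_add summable_on_cmult_right ell2_prod_summable assms)
  finally show ?thesis
    unfolding inner2_def by (simp add: infsum_cmult_right')
qed

lemma inner2_commute: "inner2 f g = cnj (inner2 g f)"
  unfolding inner2_def infsum_cnj[symmetric] by (simp add: mult.commute)

lemma inner2_lincomb_right:
  assumes "f \<in> ell2" "g \<in> ell2" "h \<in> ell2"
  shows "inner2 h (\<lambda>n. c * f n + d * g n) = cnj c * inner2 h f + cnj d * inner2 h g"
  using inner2_lincomb_left[OF assms, of c d] inner2_commute[of h f] inner2_commute[of h g]
    inner2_commute[of h "\<lambda>n. c * f n + d * g n"] by simp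

lemma inner2_zero_left [simp]: "inner2 (\<lambda>n. 0) h = 0"
  unfolding inner2_def by simp

lemma inner2_zero_right [simp]: "inner2 h (\<lambda>n. 0) = 0"
  unfolding inner2_def by simp

lemma inner2_diff_left:
  "f \<in> ell2 \<Longrightarrow> g \<in> ell2 \<Longrightarrow> h \<in> ell2 \<Longrightarrow> inner2 (\<lambda>n. f n - g n) h = inner2 f h - inner2 g h"
  using inner2_lincomb_left[of f g h 1 "-1"] by simp

lemma inner2_diff_right:
  "f \<in> ell2 \<Longrightarrow> g \<in> ell2 \<Longrightarrow> h \<in> ell2 \<Longrightarrow> inner2 h (\<lambda>n. f n - g n) = inner2 h f - inner2 h g"
  using inner2_lincomb_right[of f g h 1 "-1"] by simp

lemma inner2_self:
  assumes "f \<in> ell2"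
  shows "inner2 f f = of_real ((norm2 f)\<^sup>2)"
proof -
  have s: "(\<lambda>n. (cmod (f n))\<^sup>2) summable_on UNIV" using assms by (simp add: ell2_def)
  have "inner2 f f = (\<Sum>\<^sub>\<infinity>n. complex_of_real ((cmod (f n))\<^sup>2))"
    unfolding inner2_def complex_norm_square ..
  also have "\<dots> = of_real (\<Sum>\<^sub>\<infinity>n. (cmod (f n))\<^sup>2)"
    using infsumI[OF has_sum_of_real[OF has_sum_infsum[OF s]], where 'a1 = complex] by simp
  finally show ?thesis by (simp add: norm2_sq)
qed

lemma inner2_Cauchy_Schwarz:
  assumes "f \<in> ell2" "g \<in> ell2"
  shows "cmod (inner2 f g) \<le> norm2 f * norm2 g"
proof -
  have "cmod (inner2 f g) \<le> (\<Sum>\<^sub>\<infinity>n. cmod (f n * cnj (g n)))"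
    unfolding inner2_def using ell2_abs_prod_summable[OF assms] by (rule norm_infsum_bound)
  also have "\<dots> \<le> norm2 f * norm2 g"
  proof (rule infsum_le_finite_sums[OF ell2_abs_prod_summable[OF assms]])
    fix F :: "int set" assume F: "finite F"
    have "(\<Sum>n\<in>F. cmod (f n * cnj (g n))) = (\<Sum>n\<in>F. \<bar>cmod (f n)\<bar> * \<bar>cmod (g n)\<bar>)"
      by (simp add: norm_mult)
    also have "\<dots> \<le> L2_set (\<lambda>n. cmod (f n)) F * L2_set (\<lambda>n. cmod (g n)) F"
      by (rule L2_set_mult_ineq)
    also have "\<dots> \<le> norm2 f * norm2 g"
      by (intro mult_mono L2_set_le_norm2 assms F) auto
    finally show "(\<Sum>n\<in>F. cmod (f n * cnj (g n))) \<le> norm2 f * norm2 g" .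
  qed
  finally show ?thesis .
qed

lemma norm2_scale: "norm2 (\<lambda>n. c * f n) = cmod c * norm2 f"
  unfolding norm2_def
  by (simp add: norm_mult power_mult_distrib infsum_cmult_right' real_sqrt_mult)

lemma inner2_delta_right: "inner2 f (delta k) = f k"
proof -
  have "inner2 f (delta k) = (\<Sum>\<^sub>\<infinity>n\<in>{k}. f n * cnj (delta k n))"
    unfolding inner2_def by (intro infsum_cong_neutral) (auto simp: delta_def)
  then show ?thesis by (simp add: delta_def)
qed

lemma inner2_delta_self [simp]: "inner2 (delta k) (delta k) = 1"
  by (simp add: inner2_delta_right) (simp add: delta_def)

lemma norm2_delta [simp]: "norm2 (delta k) = 1"
proof -
  have "(norm2 (delta k))\<^sup>2 = 1"
    using inner2_self[of "delta k"] by (metis delta_ell2 inner2_delta_self of_real_eq_1_iff)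
  then show ?thesis
    using norm2_nonneg[of "delta k"] by (simp add: power2_eq_1_iff)
qed

lemma ell2_shift: "f \<in> ell2 \<Longrightarrow> (\<lambda>n. f (n + k)) \<in> ell2"
  unfolding ell2_def
  using summable_on_reindex_bij_betw[of "\<lambda>n. n + k" UNIV UNIV "\<lambda>n. (cmod (f n))\<^sup>2"]
  by (simp add: bij_plus_right)

lemma infsum_shift: "(\<Sum>\<^sub>\<infinity>n\<in>UNIV. F (n + k)) = (\<Sum>\<^sub>\<infinity>n\<in>UNIV. F (n::int))"
  using infsum_reindex_bij_betw[of "\<lambda>n. n + k" UNIV UNIV F] by (simp add: bij_plus_right)

lemma norm2_shift: "norm2 (\<lambda>n. f (n + k)) = norm2 f"
  unfolding norm2_def using infsum_shift[of "\<lambda>n. (cmod (f n))\<^sup>2" k] by simp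

lemma ell2_mult_bounded:
  assumes "f \<in> ell2" "\<And>n. \<bar>c n\<bar> \<le> K"
  shows "(\<lambda>n. of_real (c n) * f n) \<in> ell2" "norm2 (\<lambda>n. of_real (c n) * f n) \<le> K * norm2 f"
proof -
  have K: "0 \<le> K" using assms(2)[of 0] by linarith
  have *: "(\<Sum>n\<in>F. (cmod (of_real (c n) * f n))\<^sup>2) \<le> (K * norm2 f)\<^sup>2" if F: "finite F" for F
  proof -
    have "(\<Sum>n\<in>F. (cmod (of_real (c n) * f n))\<^sup>2) \<le> (\<Sum>n\<in>F. K\<^sup>2 * (cmod (f n))\<^sup>2)"
    proof (intro sum_mono)
      fix n
      have "(c n)\<^sup>2 \<le> K\<^sup>2" using assms(2)[of n] K by (simp add: abs_le_square_iff[symmetric])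
      then show "(cmod (of_real (c n) * f n))\<^sup>2 \<le> K\<^sup>2 * (cmod (f n))\<^sup>2"
        by (simp add: norm_mult power_mult_distrib mult_right_mono)
    qed
    also have "\<dots> = K\<^sup>2 * (\<Sum>n\<in>F. (cmod (f n))\<^sup>2)" by (simp add: sum_distrib_left)
    also have "\<dots> \<le> K\<^sup>2 * (norm2 f)\<^sup>2"
      by (intro mult_left_mono finite_sum_le_norm2 assms F) auto
    finally show ?thesis by (simp add: power_mult_distrib)
  qed
  show "(\<lambda>n. of_real (c n) * f n) \<in> ell2" using * by (rule ell2_bounded_sums)
  show "norm2 (\<lambda>n. of_real (c n) * f n) \<le> K * norm2 f"
    using * K by (intro norm2_le_bounded_sums) auto
qed

lemma norm2_add_sq:
  assumes "f \<in> ell2" "g \<in> ell2"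
  shows "(norm2 (\<lambda>n. f n + g n))\<^sup>2 = (norm2 f)\<^sup>2 + 2 * Re (inner2 f g) + (norm2 g)\<^sup>2"
proof -
  have "inner2 (\<lambda>n. f n + g n) (\<lambda>n. f n + g n)
      = inner2 f f + inner2 f g + (inner2 g f + inner2 g g)"
    using assms inner2_lincomb_left[of f g _ 1 1] inner2_lincomb_right[of f g _ 1 1] ell2_add[of f g]
    by simp
  then have "Re (inner2 (\<lambda>n. f n + g n) (\<lambda>n. f n + g n))
      = Re (inner2 f f) + Re (inner2 f g) + (Re (inner2 g f) + Re (inner2 g g))"
    by simp
  moreover have "Re (inner2 g f) = Re (inner2 f g)"
    using inner2_commute[of g f] by simp
  ultimately show ?thesis
    using assms ell2_add[OF assms] by (simp add: inner2_self)
qed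

lemma norm2_triangle:
  assumes "f \<in> ell2" "g \<in> ell2"
  shows "norm2 (\<lambda>n. f n + g n) \<le> norm2 f + norm2 g"
proof (rule power2_le_imp_le)
  have "Re (inner2 f g) \<le> norm2 f * norm2 g"
    using complex_Re_le_cmod inner2_Cauchy_Schwarz[OF assms] by (rule order_trans)
  then show "(norm2 (\<lambda>n. f n + g n))\<^sup>2 \<le> (norm2 f + norm2 g)\<^sup>2"
    unfolding norm2_add_sq[OF assms] by (simp add: power2_sum)
qed simp

lemma jacobi_lincomb:
  "jacobi a b (\<lambda>n. c * f n + d * g n) = (\<lambda>n. c * jacobi a b f n + d * jacobi a b g n)"
  unfolding jacobi_def by (simp add: fun_eq_iff algebra_simps)

lemma jacobi_diff: "jacobi a b (\<lambda>n. f n - g n) = (\<lambda>n. jacobi a b f n - jacobi a b g n)"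
  unfolding jacobi_def by (simp add: fun_eq_iff algebra_simps)

lemma jacobi_add: "jacobi a b (\<lambda>n. f n + g n) = (\<lambda>n. jacobi a b f n + jacobi a b g n)"
  unfolding jacobi_def by (simp add: fun_eq_iff algebra_simps)

lemma jacobi_cnj: "jacobi a b (\<lambda>n. cnj (f n)) = (\<lambda>n. cnj (jacobi a b f n))"
  unfolding jacobi_def by (simp add: fun_eq_iff)

section \<open>Jacobi operators and their resolvents\<close>

locale jacobi_op =
  fixes a b :: "int \<Rightarrow> real" and K :: real
  assumes a_pos: "\<And>n. 0 < a n"
    and a_le: "\<And>n. a n \<le> K"
    and b_le: "\<And>n. \<bar>b n\<bar> \<le> K"
begin

abbreviation "J \<equiv> jacobi a b"

lemma K_nonneg: "0 \<le> K"
  using b_le[of 0] by linarith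

lemma abs_a_le: "\<bar>a n\<bar> \<le> K"
  using a_le[of n] a_pos[of n] by linarith

lemma J_parts:
  assumes "f \<in> ell2"
  shows "(\<lambda>n. of_real (a (n - 1)) * f (n - 1)) \<in> ell2"
    "(\<lambda>n. of_real (a n) * f (n + 1)) \<in> ell2"
    "(\<lambda>n. of_real (b n) * f n) \<in> ell2"
    "norm2 (\<lambda>n. of_real (a (n - 1)) * f (n - 1)) \<le> K * norm2 f"
    "norm2 (\<lambda>n. of_real (a n) * f (n + 1)) \<le> K * norm2 f"
    "norm2 (\<lambda>n. of_real (b n) * f n) \<le> K * norm2 f"
proof -
  have l: "(\<lambda>n. f (n - 1)) \<in> ell2" "norm2 (\<lambda>n. f (n - 1)) = norm2 f"
    using ell2_shift[OF assms, of "-1"] norm2_shift[of f "-1"] by auto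
  have r: "(\<lambda>n. f (n + 1)) \<in> ell2" "norm2 (\<lambda>n. f (n + 1)) = norm2 f"
    using ell2_shift[OF assms, of 1] norm2_shift[of f 1] by auto
  show "(\<lambda>n. of_real (a (n - 1)) * f (n - 1)) \<in> ell2"
    by (rule ell2_mult_bounded(1)[OF l(1)]) (rule abs_a_le)
  show "(\<lambda>n. of_real (a n) * f (n + 1)) \<in> ell2"
    by (rule ell2_mult_bounded(1)[OF r(1)]) (rule abs_a_le)
  show "(\<lambda>n. of_real (b n) * f n) \<in> ell2"
    by (rule ell2_mult_bounded(1)[OF assms]) (rule b_le)
  show "norm2 (\<lambda>n. of_real (a (n - 1)) * f (n - 1)) \<le> K * norm2 f"
    using ell2_mult_bounded(2)[OF l(1), of "\<lambda>n. a (n - 1)" K] abs_a_le l(2) by simp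
  show "norm2 (\<lambda>n. of_real (a n) * f (n + 1)) \<le> K * norm2 f"
    using ell2_mult_bounded(2)[OF r(1), of a K] abs_a_le r(2) by simp
  show "norm2 (\<lambda>n. of_real (b n) * f n) \<le> K * norm2 f"
    by (rule ell2_mult_bounded(2)[OF assms]) (rule b_le)
qed

lemma J_ell2: "f \<in> ell2 \<Longrightarrow> J f \<in> ell2"
  unfolding jacobi_def by (intro ell2_add J_parts)

lemma J_norm:
  assumes "f \<in> ell2"
  shows "norm2 (J f) \<le> 3 * K * norm2 f"
proof -
  note p = J_parts[OF assms]
  have "norm2 (J f) \<le> norm2 (\<lambda>n. of_real (a (n - 1)) * f (n - 1) + of_real (a n) * f (n + 1))
      + norm2 (\<lambda>n. of_real (b n) * f n)"
    unfolding jacobi_def by (intro norm2_triangle ell2_add p)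
  also have "norm2 (\<lambda>n. of_real (a (n - 1)) * f (n - 1) + of_real (a n) * f (n + 1))
     \<le> norm2 (\<lambda>n. of_real (a (n - 1)) * f (n - 1)) + norm2 (\<lambda>n. of_real (a n) * f (n + 1))"
    by (intro norm2_triangle p)
  finally show ?thesis using p(4,5,6) by linarith
qed

lemma J_symmetric:
  assumes f: "f \<in> ell2" and g: "g \<in> ell2"
  shows "inner2 (J f) g = inner2 f (J g)"
proof -
  note p = J_parts[OF f] and q = J_parts[OF g]
  have 1: "inner2 (\<lambda>n. of_real (a (n - 1)) * f (n - 1)) g = inner2 f (\<lambda>n. of_real (a n) * g (n + 1))"
    unfolding inner2_def
    using infsum_shift[of "\<lambda>n. of_real (a (n - 1)) * f (n - 1) * cnj (g n)" 1]
    by (simp add: mult_ac)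
  have 2: "inner2 (\<lambda>n. of_real (a n) * f (n + 1)) g = inner2 f (\<lambda>n. of_real (a (n - 1)) * g (n - 1))"
    unfolding inner2_def
    using infsum_shift[of "\<lambda>n. of_real (a (n - 1)) * f n * cnj (g (n - 1))" 1]
    by (simp add: mult_ac)
  have 3: "inner2 (\<lambda>n. of_real (b n) * f n) g = inner2 f (\<lambda>n. of_real (b n) * g n)"
    unfolding inner2_def by (simp add: mult_ac)
  have L: "inner2 (J f) g = inner2 (\<lambda>n. of_real (a (n - 1)) * f (n - 1)) g
      + inner2 (\<lambda>n. of_real (a n) * f (n + 1)) g + inner2 (\<lambda>n. of_real (b n) * f n) g"
    unfolding jacobi_def
    using inner2_lincomb_left[OF ell2_add[OF p(1,2)] p(3) g, of 1 1]
      inner2_lincomb_left[OF p(1,2) g, of 1 1] by simp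
  have R: "inner2 f (J g) = inner2 f (\<lambda>n. of_real (a (n - 1)) * g (n - 1))
      + inner2 f (\<lambda>n. of_real (a n) * g (n + 1)) + inner2 f (\<lambda>n. of_real (b n) * g n)"
    unfolding jacobi_def
    using inner2_lincomb_right[OF ell2_add[OF q(1,2)] q(3) f, of 1 1]
      inner2_lincomb_right[OF q(1,2) f, of 1 1] by simp
  show ?thesis unfolding L R 1 2 3 by simp
qed

lemma J_quadratic_real:
  assumes "f \<in> ell2"
  shows "Im (inner2 (J f) f) = 0"
proof -
  have "inner2 (J f) f = cnj (inner2 (J f) f)"
    using J_symmetric[OF assms assms] inner2_commute[of f "J f"] by simp
  from arg_cong[OF this, of Im] show ?thesis by simp
qed

text \<open>\<open>T = 1 - i \<sigma> (J - z)\<close> contracts because the cross term between the real number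
  \<open>1 - \<sigma> Im z\<close> and the anti-self-adjoint \<open>- i \<sigma> (J - Re z)\<close> vanishes.\<close>

lemma contraction_bound:
  assumes f: "f \<in> ell2"
  shows "(norm2 (\<lambda>n. f n - \<i> * of_real \<sigma> * (J f n - z * f n)))\<^sup>2
    \<le> ((1 - \<sigma> * Im z)\<^sup>2 + \<sigma>\<^sup>2 * (3 * K + \<bar>Re z\<bar>)\<^sup>2) * (norm2 f)\<^sup>2"
proof -
  define h where "h = (\<lambda>n. J f n - of_real (Re z) * f n)"
  have hJ: "h = (\<lambda>n. 1 * J f n + of_real (- Re z) * f n)" by (simp add: h_def)
  have h: "h \<in> ell2" unfolding hJ by (intro ell2_lincomb J_ell2 f)
  have "norm2 h \<le> norm2 (J f) + norm2 (\<lambda>n. of_real (- Re z) * f n)"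
    using norm2_triangle[OF J_ell2[OF f] ell2_scale[OF f], of "of_real (- Re z)"] by (simp add: hJ)
  then have nh: "norm2 h \<le> (3 * K + \<bar>Re z\<bar>) * norm2 f"
    using J_norm[OF f] unfolding norm2_scale by (simp add: algebra_simps)
  have "inner2 h f = inner2 (J f) f + of_real (- Re z) * inner2 f f"
    unfolding hJ by (subst inner2_lincomb_left) (use f J_ell2 in auto)
  then have imh: "Im (inner2 h f) = 0"
    using J_quadratic_real[OF f] f by (simp add: inner2_self)
  have eq: "(\<lambda>n. f n - \<i> * of_real \<sigma> * (J f n - z * f n))
      = (\<lambda>n. of_real (1 - \<sigma> * Im z) * f n + (- \<i> * of_real \<sigma>) * h n)"
    by (subst (1) complex_eq[of z]) (simp add: h_def fun_eq_iff algebra_simps)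
  have "inner2 (\<lambda>n. of_real (1 - \<sigma> * Im z) * f n) (\<lambda>n. (- \<i> * of_real \<sigma>) * h n)
      = of_real (1 - \<sigma> * Im z) * (\<i> * of_real \<sigma>) * inner2 f h"
    using inner2_lincomb_left[OF f f ell2_scale[OF h], of "of_real (1 - \<sigma> * Im z)" 0 "- \<i> * of_real \<sigma>"]
      inner2_lincomb_right[OF h h f, of "- \<i> * of_real \<sigma>" 0] by (simp add: mult_ac)
  moreover have "Im (inner2 f h) = 0"
    using imh inner2_commute[of f h] by simp
  ultimately have "Re (inner2 (\<lambda>n. of_real (1 - \<sigma> * Im z) * f n) (\<lambda>n. (- \<i> * of_real \<sigma>) * h n)) = 0"
    by simp
  then have "(norm2 (\<lambda>n. f n - \<i> * of_real \<sigma> * (J f n - z * f n)))\<^sup>2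
      = (1 - \<sigma> * Im z)\<^sup>2 * (norm2 f)\<^sup>2 + \<sigma>\<^sup>2 * (norm2 h)\<^sup>2"
    unfolding eq norm2_add_sq[OF ell2_scale[OF f] ell2_scale[OF h]]
    unfolding norm2_scale by (simp add: power_mult_distrib norm_mult del: of_real_diff of_real_mult)
  also have "\<dots> \<le> (1 - \<sigma> * Im z)\<^sup>2 * (norm2 f)\<^sup>2 + \<sigma>\<^sup>2 * ((3 * K + \<bar>Re z\<bar>) * norm2 f)\<^sup>2"
    using nh by (intro add_left_mono mult_left_mono power_mono) auto
  finally show ?thesis unfolding power_mult_distrib by (simp only: distrib_right mult.assoc)
qed

text \<open>Since \<open>T\<close> only involves neighbouring sites, its Neumann series can be summed pointwise.\<close>

lemma resolvent_exists:
  assumes s: "s \<in> ell2" and z: "0 < Im z"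
  shows "\<exists>g\<in>ell2. \<forall>n. J g n - z * g n = s n"
proof -
  define C where "C = 3 * K + \<bar>Re z\<bar>"
  \<comment> \<open>\<open>\<sigma>\<close> minimises the contraction factor of \<open>contraction_bound\<close>.\<close>
  define D where "D = (Im z)\<^sup>2 + C\<^sup>2"
  define \<sigma> where "\<sigma> = Im z / D"
  define T where "T = (\<lambda>f n. f n - \<i> * of_real \<sigma> * (J f n - z * f n))"
  define q where "q = sqrt (1 - (Im z)\<^sup>2 / D)"
  have D: "0 < D" "(Im z)\<^sup>2 \<le> D" using z by (auto simp: D_def intro: add_pos_nonneg)
  have \<sigma>: "0 < \<sigma>" using D z by (simp add: \<sigma>_def)
  have q: "0 \<le> q" "q < 1" "q\<^sup>2 = 1 - (Im z)\<^sup>2 / D"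
    using D z by (auto simp: q_def)
  have "(1 - \<sigma> * Im z)\<^sup>2 + \<sigma>\<^sup>2 * C\<^sup>2 = 1 - 2 * \<sigma> * Im z + \<sigma>\<^sup>2 * D"
    by (simp add: D_def power2_eq_square algebra_simps)
  also have "\<dots> = 1 - (Im z)\<^sup>2 / D"
    using D by (simp add: \<sigma>_def power2_eq_square field_simps)
  finally have qq: "(1 - \<sigma> * Im z)\<^sup>2 + \<sigma>\<^sup>2 * C\<^sup>2 = q\<^sup>2" using q by simp
  have T_norm: "norm2 (T f) \<le> q * norm2 f" if "f \<in> ell2" for f
  proof (rule power2_le_imp_le)
    show "(norm2 (T f))\<^sup>2 \<le> (q * norm2 f)\<^sup>2"
      using contraction_bound[OF that, of \<sigma> z] qq
      unfolding T_def C_def[symmetric] by (simp add: power_mult_distrib)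
  qed (use q in auto)
  have T_ell2: "T f \<in> ell2" if "f \<in> ell2" for f
    using ell2_diff[OF that ell2_scale[OF ell2_diff[OF J_ell2[OF that] ell2_scale[OF that]]]]
    unfolding T_def by blast
  define X where "X = (\<lambda>k. (T ^^ k) (\<lambda>n. \<i> * of_real \<sigma> * s n))"
  have X_Suc: "X (Suc k) = T (X k)" for k by (simp add: X_def)
  have X_ell2: "X k \<in> ell2" for k
    by (induction k) (auto simp: X_Suc intro: T_ell2, simp add: X_def ell2_scale[OF s])
  define c where "c = norm2 (X 0)"
  have X_norm: "norm2 (X k) \<le> q ^ k * c" for k
  proof (induction k)
    case (Suc k)
    have "norm2 (X (Suc k)) \<le> q * norm2 (X k)" unfolding X_Suc by (rule T_norm[OF X_ell2])
    also have "\<dots> \<le> q * (q ^ k * c)" using Suc q by (intro mult_left_mono) auto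
    finally show ?case by (simp add: mult_ac)
  qed (simp add: c_def)
  have geo: "summable (\<lambda>k. q ^ k * c)" using q by (intro summable_mult2 summable_geometric) auto
  have sm: "summable (\<lambda>k. X k n)" for n
  proof (rule summable_comparison_test[OF _ geo])
    show "\<exists>N. \<forall>k\<ge>N. norm (X k n) \<le> q ^ k * c"
      using cmod_le_norm2[OF X_ell2] X_norm by (meson order_trans)
  qed
  define g where "g = (\<lambda>n. \<Sum>k. X k n)"
  have lim: "(\<lambda>m. \<Sum>k<m. X k n) \<longlonglongrightarrow> g n" for n
    unfolding g_def using sm by (rule summable_LIMSEQ)
  have partial: "(\<lambda>n. \<Sum>k<m. X k n) \<in> ell2 \<and> norm2 (\<lambda>n. \<Sum>k<m. X k n) \<le> (\<Sum>k<m. q ^ k * c)" for m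
  proof (induction m)
    case (Suc m)
    have "norm2 (\<lambda>n. (\<Sum>k<m. X k n) + X m n) \<le> norm2 (\<lambda>n. \<Sum>k<m. X k n) + norm2 (X m)"
      using Suc X_ell2 by (intro norm2_triangle) auto
    also have "\<dots> \<le> (\<Sum>k<m. q ^ k * c) + q ^ m * c" using Suc X_norm by (intro add_mono) auto
    finally show ?case using Suc X_ell2 by (auto intro: ell2_add)
  qed simp
  define M where "M = (\<Sum>k. q ^ k * c)"
  have pM: "(\<Sum>k<m. q ^ k * c) \<le> M" for m
    unfolding M_def using q by (intro sum_le_suminf geo) (auto simp: c_def)
  have g: "g \<in> ell2"
  proof (rule ell2_bounded_sums)
    fix F :: "int set" assume F: "finite F"
    have "(\<lambda>m. \<Sum>n\<in>F. (cmod (\<Sum>k<m. X k n))\<^sup>2) \<longlonglongrightarrow> (\<Sum>n\<in>F. (cmod (g n))\<^sup>2)"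
      by (intro tendsto_intros lim)
    moreover have "(\<Sum>n\<in>F. (cmod (\<Sum>k<m. X k n))\<^sup>2) \<le> M\<^sup>2" for m
    proof -
      have "(\<Sum>n\<in>F. (cmod (\<Sum>k<m. X k n))\<^sup>2) \<le> (norm2 (\<lambda>n. \<Sum>k<m. X k n))\<^sup>2"
        using partial[of m] F by (intro finite_sum_le_norm2) auto
      also have "\<dots> \<le> M\<^sup>2" using partial[of m] pM[of m] by (intro power_mono) auto
      finally show ?thesis .
    qed
    ultimately show "(\<Sum>n\<in>F. (cmod (g n))\<^sup>2) \<le> M\<^sup>2" by (intro LIMSEQ_le_const2) auto
  qed
  have Tg: "T g n + \<i> * of_real \<sigma> * s n = g n" for n
  proof -
    have "(\<lambda>k. T (X k) n) sums T g n"
      unfolding T_def jacobi_def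
      by (intro sums_diff sums_mult sums_add) (auto simp: g_def intro: summable_sums sm)
    then have "(\<lambda>k. X (Suc k) n) sums T g n" by (simp add: X_Suc)
    then have "(\<lambda>k. X k n) sums (T g n + X 0 n)" by (rule sums_Suc)
    then show ?thesis unfolding g_def X_def by (simp add: sums_iff)
  qed
  have "\<i> * of_real \<sigma> * (J g n - z * g n) = \<i> * of_real \<sigma> * s n" for n
    using Tg[of n] unfolding T_def by (simp add: algebra_simps)
  then have "J g n - z * g n = s n" for n using \<sigma> by simp
  then show ?thesis using g by blast
qed

text \<open>A column of the resolvent: for \<open>Im z > 0\<close> a solution exists by \<open>resolvent_exists\<close>, and it is unique
  by \<open>resolvent_pairing\<close> below.\<close>

definition green :: "complex \<Rightarrow> (int \<Rightarrow> complex) \<Rightarrow> int \<Rightarrow> complex" where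
  "green z s = (SOME g. g \<in> ell2 \<and> (\<forall>n. J g n - z * g n = s n))"

lemma green:
  assumes "s \<in> ell2" "0 < Im z"
  shows "green z s \<in> ell2" "J (green z s) n = s n + z * green z s n"
proof -
  have "\<exists>g. g \<in> ell2 \<and> (\<forall>n. J g n - z * g n = s n)"
    using resolvent_exists[OF assms] by blast
  from someI_ex[OF this] have *: "green z s \<in> ell2" "\<forall>n. J (green z s) n - z * green z s n = s n"
    unfolding green_def by auto
  then show "green z s \<in> ell2" "J (green z s) n = s n + z * green z s n"
    by (simp_all add: diff_eq_eq)
qed

text \<open>Everything about the resolvent follows from pairing the equation with its solution.\<close>

lemma resolvent_pairing:
  assumes g: "g \<in> ell2" and s: "s \<in> ell2" and eq: "\<And>n. J g n = s n + z * g n"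
  shows "Im (inner2 g s) = Im z * (norm2 g)\<^sup>2"
    and "(cmod z - 3 * K) * norm2 g \<le> norm2 s"
    and "Im z * norm2 g \<le> norm2 s"
proof -
  have Jg: "J g = (\<lambda>n. 1 * s n + z * g n)" using eq by auto
  have 1: "inner2 g (J g) = inner2 g s + cnj z * of_real ((norm2 g)\<^sup>2)"
    unfolding Jg inner2_self[OF g, symmetric] by (subst inner2_lincomb_right[OF s g g]) simp
  have "Im (inner2 g (J g)) = 0"
    using J_quadratic_real[OF g] J_symmetric[OF g g] by simp
  then show im: "Im (inner2 g s) = Im z * (norm2 g)\<^sup>2"
    unfolding 1 by simp
  have cs: "cmod (inner2 g s) \<le> norm2 g * norm2 s" using inner2_Cauchy_Schwarz[OF g s] .
  have cs': "cmod (inner2 g (J g)) \<le> norm2 g * (3 * K * norm2 g)"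
    using inner2_Cauchy_Schwarz[OF g J_ell2[OF g]] mult_left_mono[OF J_norm[OF g] norm2_nonneg]
    by (rule order_trans)
  have "cmod z * (norm2 g)\<^sup>2 = cmod (inner2 g (J g) - inner2 g s)"
    unfolding 1 by (simp add: norm_mult norm_power)
  also have "\<dots> \<le> norm2 g * (3 * K * norm2 g) + norm2 g * norm2 s"
    using norm_triangle_ineq4[of "inner2 g (J g)" "inner2 g s"] cs cs' by linarith
  finally have "norm2 g * ((cmod z - 3 * K) * norm2 g) \<le> norm2 g * norm2 s"
    by (simp add: power2_eq_square algebra_simps)
  then show "(cmod z - 3 * K) * norm2 g \<le> norm2 s"
    by (cases "norm2 g = 0") (auto simp: mult_le_cancel_left order.strict_iff_order)
  have "norm2 g * (Im z * norm2 g) \<le> norm2 g * norm2 s"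
    using im abs_Im_le_cmod[of "inner2 g s"] cs by (simp add: power2_eq_square mult_ac)
  then show "Im z * norm2 g \<le> norm2 s"
    by (cases "norm2 g = 0") (auto simp: mult_le_cancel_left order.strict_iff_order)
qed

lemma green_pairing:
  assumes "s \<in> ell2" "0 < Im z"
  shows "Im (inner2 (green z s) s) = Im z * (norm2 (green z s))\<^sup>2"
    and "(cmod z - 3 * K) * norm2 (green z s) \<le> norm2 s"
    and "Im z * norm2 (green z s) \<le> norm2 s"
  using resolvent_pairing[OF green(1)[OF assms] assms(1) green(2)[OF assms]] .

end

section \<open>Resolvent entries near the real axis\<close>

text \<open>Fatou, for sequences that need not converge: the limit inferior is almost everywhere finite, so the
  sequence returns infinitely often to a bounded set.\<close>

lemma AE_liminf_finite:
  fixes f :: "nat \<Rightarrow> 'a \<Rightarrow> ennreal"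
  assumes [measurable]: "\<And>n. f n \<in> borel_measurable M"
    and bound: "\<And>n. (\<integral>\<^sup>+x. f n x \<partial>M) \<le> ennreal C"
  shows "AE x in M. \<exists>c::real. \<exists>\<^sub>F n in sequentially. f n x \<le> ennreal c"
proof -
  have "(\<integral>\<^sup>+x. liminf (\<lambda>n. f n x) \<partial>M) \<le> liminf (\<lambda>n. \<integral>\<^sup>+x. f n x \<partial>M)"
    by (rule nn_integral_liminf) measurable
  also have "\<dots> \<le> liminf (\<lambda>n. ennreal C)"
    using bound by (intro Liminf_mono) auto
  also have "\<dots> < \<infinity>" by (simp add: Liminf_const)
  finally have "AE x in M. liminf (\<lambda>n. f n x) \<noteq> \<infinity>"
    by (intro nn_integral_PInf_AE) auto
  then show ?thesis
  proof eventually_elim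
    case (elim x)
    then obtain r where r: "liminf (\<lambda>n. f n x) = ennreal r" "0 \<le> r"
      by (cases "liminf (\<lambda>n. f n x)") auto
    have "\<exists>\<^sub>F n in sequentially. f n x \<le> ennreal (r + 1)"
    proof (rule ccontr)
      assume "\<not> ?thesis"
      then have "\<forall>\<^sub>F n in sequentially. ennreal (r + 1) \<le> f n x"
        by (auto simp: frequently_def elim: eventually_mono)
      then have "ennreal (r + 1) \<le> liminf (\<lambda>n. f n x)" by (rule Liminf_bounded)
      then show False using r by simp
    qed
    then show ?case by blast
  qed
qed

lemma csqrt_upper_half_plane:
  assumes "0 < Im w"
  shows "0 \<le> Re (csqrt w)" "0 \<le> Im (csqrt w)"
    "sqrt (cmod w) \<le> Re (csqrt w) + Im (csqrt w)" "cmod (csqrt w) = sqrt (cmod w)"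
proof -
  show re: "0 \<le> Re (csqrt w)" by (rule Re_csqrt)
  show im: "0 \<le> Im (csqrt w)"
    using assms complex_Re_le_cmod[of w] by simp
  have "(cmod (csqrt w))\<^sup>2 = cmod w" by (metis norm_power power2_csqrt)
  then show eq: "cmod (csqrt w) = sqrt (cmod w)" by (metis norm_ge_zero real_sqrt_unique)
  show "sqrt (cmod w) \<le> Re (csqrt w) + Im (csqrt w)"
    using cmod_le[of "csqrt w"] re im unfolding eq by (simp del: csqrt.simps)
qed

text \<open>The square root of a function with positive imaginary part takes values in the first
  quadrant, where the modulus is at most the sum of the real and imaginary parts. Its integral
  along a horizontal segment near the real axis therefore controls the integral of its modulus,
  and it can be moved to a contour on which the function is bounded.\<close>

lemma herglotz_sqrt_integral_bound:
  assumes holo: "G holomorphic_on {z. 0 < Im z}"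
    and pos: "\<And>z. 0 < Im z \<Longrightarrow> 0 < Im (G z)"
    and bound: "\<And>z. 0 < Im z \<Longrightarrow> 1 \<le> Im z \<or> \<bar>Re z\<bar> = R \<Longrightarrow> cmod (G z) \<le> C\<^sup>2"
    and R: "0 \<le> R" and C: "0 \<le> C" and \<epsilon>: "0 < \<epsilon>" "\<epsilon> \<le> 1"
  shows "(\<integral>\<^sup>+E. ennreal (sqrt (cmod (G (of_real E + \<i> * of_real \<epsilon>)))) * indicator {-R..R} E \<partial>lborel)
    \<le> ennreal (4 * C * (R + 1))"
proof -
  define U where "U = {z. 0 < Im z}"
  have U: "convex U" "open U" unfolding U_def by (auto simp: convex_halfspace_Im_gt open_halfspace_Im_gt)
  have "(\<lambda>z. csqrt (G z)) holomorphic_on U"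
    unfolding U_def
    by (intro holomorphic_on_csqrt' holo) (use pos in \<open>force simp: complex_nonpos_Reals_iff\<close>)
  then obtain F where F: "\<And>z. z \<in> U \<Longrightarrow> (F has_field_derivative csqrt (G z)) (at z within U)"
    using holomorphic_convex_primitive' U by blast
  have F': "(F has_field_derivative csqrt (G z)) (at z within S)" if "z \<in> U" for z S
    using F[OF that] U(2) that by (metis at_within_open has_field_derivative_at_within)
  have B: "cmod (csqrt (G z)) \<le> C" if "0 < Im z" "1 \<le> Im z \<or> \<bar>Re z\<bar> = R" for z
    using bound[OF that] C csqrt_upper_half_plane(4)[OF pos[OF that(1)]]
    by (simp add: real_le_lsqrt)
  have side: "cmod (F (Complex x \<epsilon>) - F (Complex x 1)) \<le> C" if x: "\<bar>x\<bar> = R" for x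
  proof -
    have "cmod (F (Complex x \<epsilon>) - F (Complex x 1)) \<le> C * cmod (Complex x \<epsilon> - Complex x 1)"
    proof (rule field_differentiable_bound[where f' = "\<lambda>z. csqrt (G z)" and S = "{z. Re z = x} \<inter> {z. Im z \<ge> \<epsilon>}"])
      show "convex ({z. Re z = x} \<inter> {z. Im z \<ge> \<epsilon>})"
        using convex_hyperplane[of "1::complex" x]
        by (intro convex_Int convex_halfspace_Im_ge) (simp add: inner_complex_def)
    qed (use \<epsilon> x B F' in \<open>auto simp: U_def\<close>)
    also have "\<dots> = C * (1 - \<epsilon>)" using \<epsilon> by (simp add: cmod_def)
    finally show ?thesis using C \<epsilon> mult_left_le[of "1 - \<epsilon>" C] by linarith
  qed
  have top: "cmod (F (Complex R 1) - F (Complex (-R) 1)) \<le> C * cmod (Complex R 1 - Complex (-R) 1)"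
    by (rule field_differentiable_bound[where f' = "\<lambda>z. csqrt (G z)" and S = "{z. Im z \<ge> 1}"])
       (use B F' in \<open>auto simp: U_def convex_halfspace_Im_ge\<close>)
  also have "\<dots> = 2 * R * C"
    using R by (simp add: cmod_def real_sqrt_mult[of 4 "R\<^sup>2", simplified])
  finally have total: "cmod (F (Complex R \<epsilon>) - F (Complex (-R) \<epsilon>)) \<le> 2 * C * (R + 1)"
  proof -
    assume t: "cmod (F (Complex R 1) - F (Complex (-R) 1)) \<le> 2 * R * C"
    have "F (Complex R \<epsilon>) - F (Complex (-R) \<epsilon>) = (F (Complex R \<epsilon>) - F (Complex R 1))
        + (F (Complex R 1) - F (Complex (-R) 1)) - (F (Complex (-R) \<epsilon>) - F (Complex (-R) 1))" by simp
    also have "cmod \<dots> \<le> C + 2 * R * C + C"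
      by (intro order_trans[OF norm_triangle_ineq4] order_trans[OF norm_triangle_ineq] add_mono side t)
         (use R in auto)
    finally show ?thesis by (simp add: algebra_simps)
  qed
  define h where "h = (\<lambda>E. csqrt (G (Complex E \<epsilon>)))"
  have hpos: "0 \<le> Re (h E)" "0 \<le> Im (h E)" "sqrt (cmod (G (Complex E \<epsilon>))) \<le> Re (h E) + Im (h E)" for E
    unfolding h_def using csqrt_upper_half_plane[OF pos[of "Complex E \<epsilon>"]] \<epsilon> by auto
  have dF: "((\<lambda>E. F (Complex E \<epsilon>)) has_vector_derivative h E) (at E)" for E
  proof -
    have "((\<lambda>E. of_real E + \<i> * of_real \<epsilon>) has_vector_derivative 1) (at E)"
      by (auto intro!: derivative_eq_intros simp: has_vector_derivative_def scaleR_conv_of_real[abs_def])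
    from field_vector_diff_chain_at[OF this, of F "h E"] F'[of "Complex E \<epsilon>" UNIV] \<epsilon>
    show ?thesis by (simp add: U_def o_def h_def Complex_eq)
  qed
  define \<Phi> where "\<Phi> = (\<lambda>E. Re (F (Complex E \<epsilon>)) + Im (F (Complex E \<epsilon>)))"
  have d\<Phi>: "(\<Phi> has_real_derivative (Re (h E) + Im (h E))) (at E)" for E
  proof -
    have "((\<lambda>E. Re (F (Complex E \<epsilon>)) + Im (F (Complex E \<epsilon>))) has_derivative
        (\<lambda>t. Re (t *\<^sub>R h E) + Im (t *\<^sub>R h E))) (at E)"
      by (intro has_derivative_add has_derivative_Re has_derivative_Im
            dF[unfolded has_vector_derivative_def])
    then show ?thesis unfolding \<Phi>_def has_field_derivative_def
      by (simp add: distrib_left[symmetric] mult_commute_abs)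
  qed
  have conth: "continuous_on UNIV h"
  proof -
    have "continuous_on U (\<lambda>z. csqrt (G z))"
      using \<open>(\<lambda>z. csqrt (G z)) holomorphic_on U\<close> by (rule holomorphic_on_imp_continuous_on)
    then have "continuous_on UNIV ((\<lambda>z. csqrt (G z)) \<circ> (\<lambda>E. of_real E + \<i> * of_real \<epsilon>))"
      by (intro continuous_on_compose continuous_intros) (use \<epsilon> in \<open>auto simp: U_def elim!: continuous_on_subset\<close>)
    then show ?thesis by (simp add: o_def h_def Complex_eq)
  qed
  have meas: "(\<lambda>E. Re (h E) + Im (h E)) \<in> borel_measurable borel"
    by (intro borel_measurable_continuous_onI continuous_intros conth)
  have "(\<integral>\<^sup>+E. ennreal (sqrt (cmod (G (of_real E + \<i> * of_real \<epsilon>)))) * indicator {-R..R} E \<partial>lborel)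
      \<le> (\<integral>\<^sup>+E. ennreal (Re (h E) + Im (h E)) * indicator {-R..R} E \<partial>lborel)"
    using hpos(3) by (intro nn_integral_mono mult_right_mono ennreal_leI) (auto simp: Complex_eq)
  also have "\<dots> = ennreal (\<Phi> R - \<Phi> (-R))"
    by (rule nn_integral_FTC_Icc[OF meas]) (use d\<Phi> hpos R in auto)
  also have "\<dots> \<le> ennreal (4 * C * (R + 1))"
  proof (rule ennreal_leI)
    have "\<Phi> R - \<Phi> (-R) = Re (F (Complex R \<epsilon>) - F (Complex (-R) \<epsilon>)) + Im (F (Complex R \<epsilon>) - F (Complex (-R) \<epsilon>))"
      by (simp add: \<Phi>_def)
    also have "\<dots> \<le> 2 * C * (R + 1) + 2 * C * (R + 1)"
      using total abs_Re_le_cmod[of "F (Complex R \<epsilon>) - F (Complex (-R) \<epsilon>)"]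
        abs_Im_le_cmod[of "F (Complex R \<epsilon>) - F (Complex (-R) \<epsilon>)"] by linarith
    finally show "\<Phi> R - \<Phi> (-R) \<le> 4 * C * (R + 1)" by simp
  qed
  finally show ?thesis .
qed

context jacobi_op
begin

text \<open>Both \<open>z\<close> and \<open>w\<close> are kept: equal energies give the symmetry of the resolvent matrix, equal
  sources its complex differentiability.\<close>

lemma green_identity:
  assumes s: "s \<in> ell2" "\<And>n. cnj (s n) = s n" and t: "t \<in> ell2" "\<And>n. cnj (t n) = t n"
    and z: "0 < Im z" and w: "0 < Im w"
  shows "inner2 (green z s) t - inner2 (green w t) s
    = (z - w) * inner2 (green z s) (\<lambda>n. cnj (green w t n))"
proof -
  define g where "g = green z s"
  define h where "h = (\<lambda>n. cnj (green w t n))"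
  have g: "g \<in> ell2" "J g = (\<lambda>n. 1 * s n + z * g n)"
    using green[OF s(1) z] by (auto simp: g_def)
  have h: "h \<in> ell2" "J h = (\<lambda>n. 1 * t n + cnj w * h n)"
    using green[OF t(1) w] ell2_cnj t(2) by (auto simp: h_def jacobi_cnj)
  have "inner2 s h = inner2 (green w t) s"
    unfolding inner2_def h_def using s(2) by (simp add: mult.commute)
  then have "inner2 (J g) h = inner2 (green w t) s + z * inner2 g h"
    unfolding g(2) by (subst inner2_lincomb_left[OF s(1) g(1) h(1)]) simp
  moreover have "inner2 g (J h) = inner2 g t + w * inner2 g h"
    unfolding h(2) by (subst inner2_lincomb_right[OF t(1) h(1) g(1)]) simp
  ultimately show ?thesis
    using J_symmetric[OF g(1) h(1)] by (simp add: g_def h_def algebra_simps)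
qed

lemma green_deriv:
  assumes s: "s \<in> ell2" "\<And>n. cnj (s n) = s n" and w: "0 < Im w"
  shows "((\<lambda>z. inner2 (green z s) s) has_field_derivative
    inner2 (green w s) (\<lambda>n. cnj (green w s n))) (at w)"
proof -
  define h where "h = (\<lambda>n. cnj (green w s n))"
  define N where "N = norm2 (green w s)"
  have h: "h \<in> ell2" "norm2 h = N"
    using green(1)[OF s(1) w] by (auto simp: h_def N_def ell2_cnj)
  have near: "\<forall>\<^sub>F z in at w. 0 < Im z"
    using w open_halfspace_Im_gt[of 0] by (intro eventually_at_topological[THEN iffD2]) auto
  have lip: "cmod (inner2 (green z s) h - inner2 (green w s) h) \<le> cmod (z - w) * N / Im z * N"
    if z: "0 < Im z" for z
  proof -
    define f where "f = (\<lambda>n. green z s n - green w s n)"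
    note gz = green[OF s(1) z] and gw = green[OF s(1) w]
    have f: "f \<in> ell2" unfolding f_def by (intro ell2_diff gz gw)
    have "Im z * norm2 f \<le> norm2 (\<lambda>n. (z - w) * green w s n)"
      by (rule resolvent_pairing(3)[OF f ell2_scale[OF gw(1)]])
         (auto simp: f_def jacobi_diff gz(2) gw(2) algebra_simps)
    then have "norm2 f * Im z \<le> cmod (z - w) * N"
      unfolding norm2_scale N_def by (simp only: mult.commute)
    then have nf: "norm2 f \<le> cmod (z - w) * N / Im z"
      using z by (simp add: pos_le_divide_eq)
    have "inner2 (green z s) h - inner2 (green w s) h = inner2 f h"
      unfolding f_def by (rule inner2_diff_left[symmetric]) (use gz gw h in auto)
    also have "cmod \<dots> \<le> norm2 f * N" using inner2_Cauchy_Schwarz[OF f h(1)] h(2) by simp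
    also have "\<dots> \<le> cmod (z - w) * N / Im z * N"
      using nf by (intro mult_right_mono) (auto simp: N_def)
    finally show ?thesis .
  qed
  have "((\<lambda>z. cmod (z - w) * N / Im z * N) \<longlongrightarrow> 0) (at w)"
    using w by (auto intro!: tendsto_eq_intros)
  moreover have "\<forall>\<^sub>F z in at w. cmod (inner2 (green z s) h - inner2 (green w s) h) \<le> cmod (z - w) * N / Im z * N"
    using near by eventually_elim (rule lip)
  ultimately have "((\<lambda>z. inner2 (green z s) h - inner2 (green w s) h) \<longlongrightarrow> 0) (at w)"
    by (rule Lim_null_comparison[rotated])
  then have "((\<lambda>z. inner2 (green z s) h) \<longlongrightarrow> inner2 (green w s) h) (at w)"
    by (rule LIM_zero_cancel)
  moreover have "\<forall>\<^sub>F z in at w. inner2 (green z s) h = (inner2 (green z s) s - inner2 (green w s) s) / (z - w)"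
    using near eventually_neq_at_within[of w w UNIV]
  proof eventually_elim
    case (elim z)
    then show ?case using green_identity[OF s s elim(1) w] by (simp add: h_def)
  qed
  ultimately show ?thesis
    unfolding has_field_derivative_iff h_def[symmetric] by (rule Lim_transform_eventually)
qed

lemma green_herglotz:
  assumes s: "s \<in> ell2" "\<And>n. cnj (s n) = s n" and nz: "s \<noteq> (\<lambda>n. 0)"
  shows "(\<lambda>z. inner2 (green z s) s) holomorphic_on {z. 0 < Im z}"
    and "0 < Im z \<Longrightarrow> 0 < Im (inner2 (green z s) s)"
    and "0 < Im z \<Longrightarrow> 1 \<le> Im z \<or> 3 * K + 1 \<le> \<bar>Re z\<bar> \<Longrightarrow> cmod (inner2 (green z s) s) \<le> (norm2 s)\<^sup>2"
proof -
  show "(\<lambda>z. inner2 (green z s) s) holomorphic_on {z. 0 < Im z}"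
    unfolding holomorphic_on_def field_differentiable_def
    using green_deriv[OF s] has_field_derivative_at_within by blast
  assume z: "0 < Im z"
  note g = green[OF s(1) z] and p = green_pairing[OF s(1) z]
  have "green z s \<noteq> (\<lambda>n. 0)"
  proof
    assume "green z s = (\<lambda>n. 0)"
    then have "s n = 0" for n using g(2)[of n] by (simp add: jacobi_def)
    then show False using nz by auto
  qed
  then have "norm2 (green z s) \<noteq> 0" using norm2_eq_0_iff[OF g(1)] by simp
  then show "0 < Im (inner2 (green z s) s)" unfolding p(1) using z by simp
  assume far: "1 \<le> Im z \<or> 3 * K + 1 \<le> \<bar>Re z\<bar>"
  have "norm2 (green z s) \<le> norm2 s"
  proof (cases "1 \<le> Im z")
    case True
    then have "1 * norm2 (green z s) \<le> Im z * norm2 (green z s)" by (intro mult_right_mono) auto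
    then show ?thesis using p(3) by simp
  next
    case False
    then have "1 \<le> cmod z - 3 * K" using far abs_Re_le_cmod[of z] by linarith
    then have "1 * norm2 (green z s) \<le> (cmod z - 3 * K) * norm2 (green z s)"
      by (intro mult_right_mono) auto
    then show ?thesis using p(2) by simp
  qed
  then have "norm2 (green z s) * norm2 s \<le> norm2 s * norm2 s" by (intro mult_right_mono) auto
  then show "cmod (inner2 (green z s) s) \<le> (norm2 s)\<^sup>2"
    using inner2_Cauchy_Schwarz[OF g(1) s(1)] by (simp add: power2_eq_square)
qed

lemma green_add:
  assumes s: "s \<in> ell2" and t: "t \<in> ell2" and z: "0 < Im z"
  shows "green z (\<lambda>n. s n + t n) = (\<lambda>n. green z s n + green z t n)"
proof -
  define f where "f = (\<lambda>n. green z (\<lambda>n. s n + t n) n - (green z s n + green z t n))"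
  note gs = green[OF s z] and gt = green[OF t z] and g = green[OF ell2_add[OF s t] z]
  have "J f n = 0 + z * f n" for n
    unfolding f_def jacobi_diff jacobi_add g(2) gs(2) gt(2) by (simp add: algebra_simps)
  moreover have f: "f \<in> ell2" unfolding f_def by (intro ell2_diff ell2_add g gs gt)
  ultimately have "Im z * norm2 f \<le> norm2 (\<lambda>n. 0)"
    using resolvent_pairing(3)[of f "\<lambda>n. 0" z] by simp
  then have "norm2 f = 0" using z norm2_nonneg[of f] by (simp add: mult_le_0_iff)
  then have "f = (\<lambda>n. 0)" using norm2_eq_0_iff[OF f] by simp
  then show ?thesis unfolding f_def by (metis eq_iff_diff_eq_0)
qed

text \<open>Only the diagonal forms of the resolvent have positive imaginary part; the off-diagonal entry is
  reached from them by polarisation. Three real vectors suffice because the resolvent matrix is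
  symmetric.\<close>

lemma green_matrix_from_quadratic:
  assumes z: "0 < Im z"
  shows "green z (delta 0) 1 = green z (delta 1) 0"
    and "2 * green z (delta 0) 1 = inner2 (green z (\<lambda>n. delta 0 n + delta 1 n)) (\<lambda>n. delta 0 n + delta 1 n)
      - green z (delta 0) 0 - green z (delta 1) 1"
proof -
  have r: "cnj (delta k n) = delta k n" for k n by (simp add: delta_def)
  show sym: "green z (delta 0) 1 = green z (delta 1) 0"
    using green_identity[OF delta_ell2 r delta_ell2 r z z, of 0 1] by (simp add: inner2_delta_right)
  define g where "g = green z (\<lambda>n. delta 0 n + delta 1 n)"
  have g: "g \<in> ell2" unfolding g_def by (intro green(1) ell2_add delta_ell2 z)
  have "inner2 g (\<lambda>n. delta 0 n + delta 1 n) = g 0 + g 1"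
    using inner2_lincomb_right[OF delta_ell2 delta_ell2 g, of 1 0 1 1] by (simp add: inner2_delta_right)
  then show "2 * green z (delta 0) 1 = inner2 (green z (\<lambda>n. delta 0 n + delta 1 n)) (\<lambda>n. delta 0 n + delta 1 n)
      - green z (delta 0) 0 - green z (delta 1) 1"
    unfolding g_def green_add[OF delta_ell2 delta_ell2 z] using sym by simp
qed

lemma green_bounded_frequently_quadratic:
  assumes s: "finite (A :: (int \<Rightarrow> complex) set)" "\<And>s. s \<in> A \<Longrightarrow> s \<in> ell2"
    "\<And>s n. s \<in> A \<Longrightarrow> cnj (s n) = s n" "\<And>s. s \<in> A \<Longrightarrow> s \<noteq> (\<lambda>n. 0)"
  shows "AE E in lborel. \<exists>c. \<exists>\<^sub>F m in sequentially. \<forall>s\<in>A.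
    cmod (inner2 (green (of_real E + \<i> * of_real (1 / real (Suc m))) s) s) \<le> c"
proof -
  define z where "z = (\<lambda>m E. of_real E + \<i> * complex_of_real (1 / real (Suc m)))"
  have Imz: "0 < Im (z m E)" for m E by (simp add: z_def)
  define q where "q = (\<lambda>m s E. sqrt (cmod (inner2 (green (z m E) s) s)))"
  define R where "R = (\<lambda>j::nat. 3 * K + 1 + real j)"
  have R: "0 \<le> R j" for j using K_nonneg by (simp add: R_def)
  have meas [measurable]: "(\<lambda>E. q m s E) \<in> borel_measurable borel" if "s \<in> A" for m s
  proof (rule borel_measurable_continuous_onI)
    have "continuous_on {z. 0 < Im z} (\<lambda>z. inner2 (green z s) s)"
      using green_herglotz(1)[OF s(2)[OF that] s(3)[OF that] s(4)[OF that]]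
      by (rule holomorphic_on_imp_continuous_on)
    then have "continuous_on UNIV ((\<lambda>z. inner2 (green z s) s) \<circ> z m)"
      unfolding z_def
      by (intro continuous_on_compose continuous_intros) (auto elim!: continuous_on_subset)
    then show "continuous_on UNIV (q m s)"
      unfolding q_def o_def by (intro continuous_intros)
  qed
  have "AE E in lborel. \<exists>c::real. \<exists>\<^sub>F m in sequentially.
      (\<Sum>s\<in>A. ennreal (q m s E) * indicator {- R j .. R j} E) \<le> ennreal c" for j
  proof (rule AE_liminf_finite)
    fix m
    show "(\<lambda>E. \<Sum>s\<in>A. ennreal (q m s E) * indicator {- R j .. R j} E) \<in> borel_measurable lborel"
      by (intro borel_measurable_sum) (use meas in measurable)
    have "(\<integral>\<^sup>+E. (\<Sum>s\<in>A. ennreal (q m s E) * indicator {- R j .. R j} E) \<partial>lborel)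
        = (\<Sum>s\<in>A. \<integral>\<^sup>+E. ennreal (q m s E) * indicator {- R j .. R j} E \<partial>lborel)"
      by (intro nn_integral_sum) (use meas in measurable)
    also have "\<dots> \<le> (\<Sum>s\<in>A. ennreal (4 * norm2 s * (R j + 1)))"
    proof (rule sum_mono)
      fix t assume t: "t \<in> A"
      note h = green_herglotz[OF s(2)[OF t] s(3)[OF t] s(4)[OF t]]
      show "(\<integral>\<^sup>+E. ennreal (q m t E) * indicator {- R j .. R j} E \<partial>lborel) \<le> ennreal (4 * norm2 t * (R j + 1))"
        unfolding q_def z_def
        by (rule herglotz_sqrt_integral_bound[OF h(1)])
           (use h(2,3) R in \<open>auto simp: R_def field_simps\<close>)
    qed
    also have "\<dots> = ennreal (\<Sum>s\<in>A. 4 * norm2 s * (R j + 1))"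
      using R by (intro sum_ennreal) simp
    finally show "(\<integral>\<^sup>+E. (\<Sum>s\<in>A. ennreal (q m s E) * indicator {- R j .. R j} E) \<partial>lborel)
      \<le> ennreal (\<Sum>s\<in>A. 4 * norm2 s * (R j + 1))" .
  qed
  then have "AE E in lborel. \<forall>j. \<exists>c::real. \<exists>\<^sub>F m in sequentially.
      (\<Sum>s\<in>A. ennreal (q m s E) * indicator {- R j .. R j} E) \<le> ennreal c"
    by (simp add: AE_all_countable)
  then show ?thesis
  proof eventually_elim
    case (elim E)
    obtain j :: nat where "\<bar>E\<bar> \<le> real j" using real_arch_simple by blast
    then have j: "E \<in> {- R j .. R j}" using K_nonneg by (auto simp: R_def abs_le_iff)
    obtain c :: real where c: "\<exists>\<^sub>F m in sequentially.
      (\<Sum>s\<in>A. ennreal (q m s E) * indicator {- R j .. R j} E) \<le> ennreal c" using elim by blast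
    have "\<exists>\<^sub>F m in sequentially. \<forall>s\<in>A. cmod (inner2 (green (z m E) s) s) \<le> (max c 0)\<^sup>2"
      using c
    proof (rule frequently_mono[rotated], intro allI impI ballI)
      fix m t assume m: "(\<Sum>s\<in>A. ennreal (q m s E) * indicator {- R j .. R j} E) \<le> ennreal c" and t: "t \<in> A"
      have "ennreal (q m t E) \<le> (\<Sum>s\<in>A. ennreal (q m s E) * indicator {- R j .. R j} E)"
        using member_le_sum[of t A "\<lambda>s. ennreal (q m s E) * indicator {- R j .. R j} E"] s(1) t j by simp
      then have "ennreal (q m t E) \<le> ennreal c" using m by (rule order_trans)
      then have "q m t E \<le> max c 0"
        by (metis ennreal_le_iff2 linorder_le_cases max.absorb1 max.coboundedI1 max.coboundedI2)
      then show "cmod (inner2 (green (z m E) t) t) \<le> (max c 0)\<^sup>2"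
        unfolding q_def by (simp add: sqrt_le_D)
    qed
    then show ?case unfolding z_def by blast
  qed
qed

lemma green_bounded_frequently:
  "AE E in lborel. \<exists>c. \<exists>\<^sub>F m in sequentially. \<forall>k\<in>{0,1}. \<forall>j\<in>{0,1}.
    cmod (green (of_real E + \<i> * of_real (1 / real (Suc m))) (delta k) j) \<le> c"
proof -
  define p where "p = (\<lambda>n. delta 0 n + delta 1 n)"
  have p: "p \<noteq> (\<lambda>n. 0)" "\<And>k. delta k \<noteq> (\<lambda>n. 0)"
    by (auto simp: p_def delta_def fun_eq_iff intro: exI[of _ 0])
  have A: "finite {delta 0, delta 1, p}" "\<And>s. s \<in> {delta 0, delta 1, p} \<Longrightarrow> s \<in> ell2"
    "\<And>s n. s \<in> {delta 0, delta 1, p} \<Longrightarrow> cnj (s n) = s n"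
    "\<And>s. s \<in> {delta 0, delta 1, p} \<Longrightarrow> s \<noteq> (\<lambda>n. 0)"
    using p by (auto simp: p_def intro!: ell2_add delta_ell2) (auto simp: delta_def)
  have "AE E in lborel. \<exists>c. \<exists>\<^sub>F m in sequentially. \<forall>s\<in>{delta 0, delta 1, p}.
      cmod (inner2 (green (of_real E + \<i> * of_real (1 / real (Suc m))) s) s) \<le> c"
    by (rule green_bounded_frequently_quadratic) (fact A)+
  then show ?thesis
  proof eventually_elim
    case (elim E)
    define z where "z = (\<lambda>m. of_real E + \<i> * complex_of_real (1 / real (Suc m)))"
    have Imz: "0 < Im (z m)" for m by (simp add: z_def)
    from elim obtain c where c: "\<exists>\<^sub>F m in sequentially. \<forall>s\<in>{delta 0, delta 1, p}. cmod (inner2 (green (z m) s) s) \<le> c"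
      unfolding z_def by blast
    have "\<exists>\<^sub>F m in sequentially. \<forall>k\<in>{0,1}. \<forall>j\<in>{0,1}. cmod (green (z m) (delta k) j) \<le> 2 * c"
      using c
    proof (rule frequently_mono[rotated], intro allI impI)
      fix m assume m: "\<forall>s\<in>{delta 0, delta 1, p}. cmod (inner2 (green (z m) s) s) \<le> c"
      then have c0: "cmod (green (z m) (delta 0) 0) \<le> c" and c1: "cmod (green (z m) (delta 1) 1) \<le> c"
        and cp: "cmod (inner2 (green (z m) p) p) \<le> c" by (auto simp: inner2_delta_right)
      have nn: "0 \<le> c" using c0 norm_ge_zero order_trans by blast
      note q = green_matrix_from_quadratic[OF Imz[of m], folded p_def]
      have "cmod (2 * green (z m) (delta 0) 1) \<le> c + c + c"
        unfolding q(2)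
        by (intro order_trans[OF norm_triangle_ineq4] add_mono c0 c1 cp)
      then have "cmod (green (z m) (delta 0) 1) \<le> 2 * c" using nn by (simp add: norm_mult)
      then show "\<forall>k\<in>{0,1}. \<forall>j\<in>{0,1}. cmod (green (z m) (delta k) j) \<le> 2 * c"
        using c0 c1 nn q(1) by auto
    qed
    then show ?case unfolding z_def by blast
  qed
qed

end

section \<open>Solutions, Wronskians and subordinacy\<close>

definition wronskian :: "(int \<Rightarrow> real) \<Rightarrow> (int \<Rightarrow> complex) \<Rightarrow> (int \<Rightarrow> complex) \<Rightarrow> int \<Rightarrow> complex" where
  "wronskian a f g n = of_real (a n) * (f n * g (n + 1) - f (n + 1) * g n)"

lemma wronskian_step:
  "wronskian a f g n = wronskian a f g (n - 1) + (f n * jacobi a b g n - g n * jacobi a b f n)"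
  unfolding wronskian_def jacobi_def by (simp add: algebra_simps)

lemma wronskian_telescope:
  assumes "k \<le> n"
  shows "wronskian a f g n = wronskian a f g k
    + (\<Sum>m=k+1..n. f m * jacobi a b g m - g m * jacobi a b f m)"
  using assms
proof (induction n rule: int_ge_induct)
  case (step i)
  have "{k+1..i+1} = insert (i+1) {k+1..i}" using step.hyps by auto
  then show ?case
    using step wronskian_step[of a f g "i + 1" b] by simp
qed simp

lemma wronskian_expansion:
  "wronskian a u v n * g (n + 1) = wronskian a g v n * u (n + 1) + wronskian a u g n * v (n + 1)"
  "wronskian a u v n * g n = wronskian a g v n * u n + wronskian a u g n * v n"
  unfolding wronskian_def by (simp_all add: algebra_simps)

text \<open>The recursion runs to the right from the sites \<open>0, 1\<close> and, through the reflection
  \<open>n \<mapsto> 1 - n\<close>, which exchanges these two sites, also to the left.\<close>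

lemma solution_exists:
  assumes a: "\<And>n. a n \<noteq> 0"
  shows "\<exists>v. is_solution a b E v \<and> v 0 = x \<and> v 1 = y"
proof -
  have half: "\<exists>f::nat \<Rightarrow> complex. f 0 = x \<and> f 1 = y \<and>
      (\<forall>n. of_real (a (int n)) * f n + of_real (a (int n + 1)) * f (n + 2) + of_real (b (int n + 1)) * f (n + 1)
        = of_real E * f (n + 1))" if a: "\<And>n. a n \<noteq> (0::real)" for a b :: "int \<Rightarrow> real" and x y
  proof -
    define s where "s = rec_nat (x, y) (\<lambda>n (p, q).
      (q, (of_real E * q - of_real (b (int n + 1)) * q - of_real (a (int n)) * p) / of_real (a (int n + 1))))"
    define f where "f = (\<lambda>n. fst (s n))"
    have s: "s n = (f n, f (n + 1))" for n
      by (cases "s n") (simp add: f_def s_def)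
    have "f (n + 2) = (of_real E * f (n + 1) - of_real (b (int n + 1)) * f (n + 1) - of_real (a (int n)) * f n)
        / of_real (a (int n + 1))" for n
    proof -
      have "f (n + 2) = snd (s (Suc n))" by (simp add: s)
      also have "s (Suc n) = (case s n of (p, q) \<Rightarrow>
        (q, (of_real E * q - of_real (b (int n + 1)) * q - of_real (a (int n)) * p) / of_real (a (int n + 1))))"
        by (simp add: s_def)
      finally show ?thesis by (simp add: s)
    qed
    moreover have "f 0 = x" "f 1 = y" by (simp_all add: f_def s_def)
    ultimately show ?thesis using a by (intro exI[of _ f]) auto
  qed
  obtain f :: "nat \<Rightarrow> complex" where f: "f 0 = x" "f 1 = y"
    "\<And>n. of_real (a (int n)) * f n + of_real (a (int n + 1)) * f (n + 2) + of_real (b (int n + 1)) * f (n + 1)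
        = of_real E * f (n + 1)"
    using half[of a x y b] a by blast
  obtain h :: "nat \<Rightarrow> complex" where h: "h 0 = y" "h 1 = x"
    "\<And>n. of_real (a (- int n)) * h n + of_real (a (- (int n + 1))) * h (n + 2) + of_real (b (1 - (int n + 1))) * h (n + 1)
        = of_real E * h (n + 1)"
    using half[of "\<lambda>n. a (- n)" y x "\<lambda>n. b (1 - n)"] a by blast
  define v where "v = (\<lambda>n. if 0 \<le> n then f (nat n) else h (nat (1 - n)))"
  have vf: "v (int n) = f n" for n by (simp add: v_def)
  have vh: "v (1 - int n) = h n" for n
  proof -
    consider "n = 0" | "n = 1" | "1 < n" by linarith
    then show ?thesis using f h by cases (auto simp: v_def)
  qed
  have "jacobi a b v n = of_real E * v n" for n
  proof (cases "1 \<le> n")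
    case True
    define m where "m = nat (n - 1)"
    have e: "v (n - 1) = f m" "v n = f (m + 1)" "v (n + 1) = f (m + 2)" "n = int m + 1"
      using vf[of m] vf[of "m + 1"] vf[of "m + 2"] True by (auto simp: m_def add.commute)
    show ?thesis using f(3)[of m] unfolding jacobi_def e(1,2,3) by (simp add: e(4))
  next
    case False
    define m where "m = nat (- n)"
    have nm: "n = - int m" using False by (simp add: m_def)
    have n: "n + 1 = 1 - int m" "n = 1 - int (m + 1)" "n - 1 = 1 - int (m + 2)" by (auto simp: nm)
    have e: "v (n + 1) = h m" "v n = h (m + 1)" "v (n - 1) = h (m + 2)"
      using vh[of m] vh[of "m + 1"] vh[of "m + 2"] by (simp_all only: n(1) n(3) n(2)[symmetric])
    have i: "n - 1 = - (int m + 1)" "1 - (int m + 1) = n" "- int m = n" using nm by auto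
    show ?thesis using h(3)[of m] unfolding jacobi_def e i(2,3) i(1)[symmetric] by (simp add: add_ac)
  qed
  then show ?thesis using vf[of 0] vf[of 1] f by (auto simp: is_solution_def)
qed

lemma solution_unique_zero:
  assumes a: "\<And>n. a n \<noteq> 0" and u: "is_solution a b E u" and 0: "u 0 = 0" "u 1 = 0"
  shows "u n = 0"
proof -
  have eq: "of_real (a (n - 1)) * u (n - 1) + of_real (a n) * u (n + 1) = of_real (E - b n) * u n" for n
    using u unfolding is_solution_def jacobi_def by (metis (no_types) add_diff_cancel_right' left_diff_distrib of_real_diff)
  have "u n = 0 \<and> u (n + 1) = 0"
  proof (cases "0 \<le> n")
    case True
    then show ?thesis
    proof (induction n rule: int_ge_induct)
      case (step i)
      then show ?case using eq[of "i + 1"] a[of "i + 1"] by (simp add: add.assoc)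
    qed (use 0 in simp)
  next
    case False
    then have "n \<le> 0" by simp
    then show ?thesis
    proof (induction n rule: int_le_induct)
      case (step i)
      then show ?case using eq[of i] a[of "i - 1"] by simp
    qed (use 0 in simp)
  qed
  then show ?thesis by simp
qed

lemma subordinate_nonzero_data:
  assumes "\<And>n. a n \<noteq> 0" "subordinate a b E u"
  shows "u 0 \<noteq> 0 \<or> u 1 \<noteq> 0"
  using assms solution_unique_zero[of a b E u] unfolding subordinate_def by blast

lemma wronskian_solutions_const:
  assumes "is_solution a b E u" "is_solution a b E v" "k \<le> n"
  shows "wronskian a u v n = wronskian a u v k"
  using wronskian_telescope[OF assms(3), of a u v b] assms(1,2) by (simp add: is_solution_def mult_ac)

text \<open>The boundary values of the second solution are dictated by the Wronskian.\<close>

lemma second_solution: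
  assumes a: "\<And>n. a n \<noteq> 0" and u: "is_solution a b E u" and nz: "u 0 \<noteq> 0 \<or> u 1 \<noteq> 0"
  obtains v where "is_solution a b E v" "lin_indep u v" "\<And>n. 0 \<le> n \<Longrightarrow> wronskian a u v n = 1"
proof -
  obtain x y where xy: "of_real (a 0) * (u 0 * y - u 1 * x) = 1"
  proof (cases "u 0 = 0")
    case True
    then show ?thesis using that[of 0 "- 1 / (of_real (a 0) * u 1)"] nz a[of 0] by simp
  next
    case False
    then show ?thesis using that[of "1 / (of_real (a 0) * u 0)" 0] a[of 0] by simp
  qed
  obtain v where v: "is_solution a b E v" "v 0 = x" "v 1 = y"
    using solution_exists[of a b E x y] a by blast
  have w: "wronskian a u v n = 1" if "0 \<le> n" for n
    using wronskian_solutions_const[OF u v(1) that] xy v by (simp add: wronskian_def)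
  have "lin_indep u v"
    unfolding lin_indep_def
  proof (intro allI impI)
    fix c d assume cd: "\<forall>n. c * u n + d * v n = 0"
    have "c * (u 0 * v 1 - u 1 * v 0) = (c * u 0 + d * v 0) * v 1 - (c * u 1 + d * v 1) * v 0"
      "d * (u 0 * v 1 - u 1 * v 0) = (c * u 1 + d * v 1) * u 0 - (c * u 0 + d * v 0) * u 1"
      by (simp_all add: algebra_simps)
    moreover have "u 0 * v 1 - u 1 * v 0 \<noteq> 0" using xy v by auto
    ultimately show "c = 0 \<and> d = 0" using cd by simp
  qed
  with v(1) w show ?thesis using that by blast
qed

text \<open>At non-integer length the last site enters \<open>norm_right\<close> with a weight, so Minkowski and
  Cauchy-Schwarz remain available.\<close>

lemma norm_right_eq_L2_set:
  assumes "0 \<le> N" "0 \<le> t" "t < 1"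
  shows "norm_right (of_int N + t) f
    = L2_set (\<lambda>n. (if n \<le> N then 1 else sqrt t) * cmod (f n)) {1..N+1}"
proof -
  have fl: "\<lfloor>of_int N + t\<rfloor> = N" using assms by (simp add: floor_eq_iff)
  have "{1..N+1} = insert (N + 1) {1..N}" using assms by auto
  then have "(\<Sum>n=1..N+1. ((if n \<le> N then 1 else sqrt t) * cmod (f n))\<^sup>2)
      = (\<Sum>n=1..N. (cmod (f n))\<^sup>2) + t * (cmod (f (N + 1)))\<^sup>2"
    using assms by (simp add: power_mult_distrib)
  then show ?thesis unfolding norm_right_def fl L2_set_def by simp
qed

lemma norm_right_nonneg [simp]: "0 \<le> norm_right L f"
  unfolding norm_right_def by (intro real_sqrt_ge_zero add_nonneg_nonneg sum_nonneg mult_nonneg_nonneg) auto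

lemma norm_right_le_norm2:
  assumes "f \<in> ell2" "0 \<le> N" "0 \<le> t" "t < 1"
  shows "norm_right (of_int N + t) f \<le> norm2 f"
proof -
  have "L2_set (\<lambda>n. (if n \<le> N then 1 else sqrt t) * cmod (f n)) {1..N+1} \<le> L2_set (\<lambda>n. cmod (f n)) {1..N+1}"
    using assms by (intro L2_set_mono) (auto simp: mult_left_le_one_le)
  also have "\<dots> \<le> norm2 f" by (rule L2_set_le_norm2[OF assms(1)]) simp
  finally show ?thesis unfolding norm_right_eq_L2_set[OF assms(2-4)] .
qed

lemma norm_right_int: "norm_right (of_int N) f = sqrt (\<Sum>n=1..N. (cmod (f n))\<^sup>2)"
  unfolding norm_right_def by simp

lemma norm_right_int_mono:
  "M \<le> N \<Longrightarrow> norm_right (of_int M) f \<le> norm_right (of_int N) f"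
  unfolding norm_right_int by (intro real_sqrt_le_mono sum_mono2) auto

lemma norm_right_int_pos:
  assumes "f 1 \<noteq> 0 \<or> f 2 \<noteq> 0" "2 \<le> N"
  shows "0 < norm_right (of_int N) f"
proof -
  have "{1..2::int} = {1, 2}" by auto
  then have "norm_right (of_int 2) f = sqrt ((cmod (f 1))\<^sup>2 + (cmod (f 2))\<^sup>2)"
    unfolding norm_right_int by simp
  also have "\<dots> > 0" using assms by (auto intro: add_pos_nonneg add_nonneg_pos)
  finally show ?thesis using norm_right_int_mono[OF assms(2), of f] by linarith
qed

text \<open>The coefficients of \<open>g\<close> in the frame of two solutions at a nearby energy vary slowly.
  At site \<open>n\<close> the frame is taken on the bond to its left, so the drift involves only sites
  that carry full weight in \<open>norm_right\<close>.\<close>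

lemma solution_frame_estimate:
  assumes u: "is_solution a b E u" and v: "is_solution a b E v"
    and w: "\<And>n. 0 \<le> n \<Longrightarrow> wronskian a u v n = 1"
    and g: "\<And>n. 2 \<le> n \<Longrightarrow> jacobi a b g n = z * g n"
    and N: "1 \<le> N" and t: "0 \<le> t" "t < 1" and L: "L = of_int N + t"
  shows "cmod (wronskian a u g 1) * norm_right L v \<le> norm_right L g
    + cmod (wronskian a g v 1) * norm_right L u
    + 2 * cmod (z - E) * norm_right L u * norm_right L v * norm_right L g"
proof -
  define A B where "A = wronskian a g v 1" and "B = wronskian a u g 1"
  define \<kappa> where "\<kappa> = cmod (z - E)"
  define wt where "wt = (\<lambda>n. if n \<le> N then 1 else sqrt t)"
  define nr where "nr = (\<lambda>f. L2_set (\<lambda>n. wt n * cmod (f n)) {1..N+1})"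
  have nr: "norm_right L f = nr f" for f
    unfolding nr_def wt_def L by (rule norm_right_eq_L2_set) (use N t in auto)
  have nr0: "0 \<le> nr f" for f by (simp add: nr_def L2_set_nonneg)
  have wt: "0 \<le> wt n" for n using t by (simp add: wt_def)
  have drift: "cmod (\<Sum>m=2..n. f m * g m) \<le> nr f * nr g" if n: "n \<le> N" for n f
  proof -
    have "cmod (\<Sum>m=2..n. f m * g m) \<le> (\<Sum>m=2..n. \<bar>wt m * cmod (f m)\<bar> * \<bar>wt m * cmod (g m)\<bar>)"
      using n by (intro order_trans[OF norm_sum] sum_mono) (auto simp: wt_def norm_mult)
    also have "\<dots> \<le> (\<Sum>m=1..N+1. \<bar>wt m * cmod (f m)\<bar> * \<bar>wt m * cmod (g m)\<bar>)"
      using n by (intro sum_mono2) auto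
    also have "\<dots> \<le> nr f * nr g" unfolding nr_def by (rule L2_set_mult_ineq)
    finally show ?thesis .
  qed
  have pt: "cmod (B * v n) \<le> cmod (g n) + (cmod A + \<kappa> * nr v * nr g) * cmod (u n) + \<kappa> * nr u * nr g * cmod (v n)"
    if n: "1 \<le> n" "n \<le> N + 1" for n
  proof -
    define k where "k = max 1 (n - 1)"
    have k: "1 \<le> k" "k \<le> N" "n = k \<or> n = k + 1" using n N by (auto simp: k_def)
    have \<beta>: "wronskian a u g k = B + (z - E) * (\<Sum>m=2..k. u m * g m)"
    proof -
      have "(\<Sum>m=2..k. u m * jacobi a b g m - g m * jacobi a b u m) = (\<Sum>m=2..k. (z - E) * (u m * g m))"
        using g u by (intro sum.cong) (auto simp: is_solution_def algebra_simps)
      then show ?thesis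
        using wronskian_telescope[OF k(1), of a u g b] by (simp add: B_def sum_distrib_left)
    qed
    have \<alpha>: "wronskian a g v k = A - (z - E) * (\<Sum>m=2..k. v m * g m)"
    proof -
      have "(\<Sum>m=2..k. g m * jacobi a b v m - v m * jacobi a b g m) = (\<Sum>m=2..k. - ((z - E) * (v m * g m)))"
        using g v by (intro sum.cong) (auto simp: is_solution_def algebra_simps)
      then show ?thesis
        using wronskian_telescope[OF k(1), of a g v b] by (simp add: A_def sum_distrib_left sum_negf)
    qed
    have "g n = wronskian a g v k * u n + wronskian a u g k * v n"
      using wronskian_expansion[of a u v k g] w[of k] k by auto
    then have "B * v n = g n - (A - (z - E) * (\<Sum>m=2..k. v m * g m)) * u n - (z - E) * (\<Sum>m=2..k. u m * g m) * v n"
      unfolding \<alpha> \<beta> by (simp add: algebra_simps)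
    also have "cmod \<dots> \<le> cmod (g n) + cmod ((A - (z - E) * (\<Sum>m=2..k. v m * g m)) * u n)
        + cmod ((z - E) * (\<Sum>m=2..k. u m * g m) * v n)"
      by (intro order_trans[OF norm_triangle_ineq4] add_right_mono norm_triangle_ineq4)
    also have "\<dots> \<le> cmod (g n) + (cmod A + \<kappa> * (nr v * nr g)) * cmod (u n) + \<kappa> * (nr u * nr g) * cmod (v n)"
    proof -
      have "cmod (A - (z - E) * (\<Sum>m=2..k. v m * g m)) \<le> cmod A + \<kappa> * (nr v * nr g)"
        unfolding \<kappa>_def
        by (intro order_trans[OF norm_triangle_ineq4] add_left_mono)
           (auto simp: norm_mult intro!: mult_left_mono drift k)
      moreover have "cmod ((z - E) * (\<Sum>m=2..k. u m * g m)) \<le> \<kappa> * (nr u * nr g)"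
        unfolding \<kappa>_def by (auto simp: norm_mult intro!: mult_left_mono drift k)
      ultimately show ?thesis
        unfolding norm_mult[of _ "u n"] norm_mult[of _ "v n"]
        by (intro add_mono order_refl mult_right_mono) auto
    qed
    finally show ?thesis by (simp add: mult.assoc)
  qed
  define P Q where "P = cmod A + \<kappa> * nr v * nr g" and "Q = \<kappa> * nr u * nr g"
  have PQ: "0 \<le> P" "0 \<le> Q" unfolding P_def Q_def \<kappa>_def using nr0 by auto
  have "cmod B * nr v = L2_set (\<lambda>n. cmod B * (wt n * cmod (v n))) {1..N+1}"
    unfolding nr_def by (rule L2_set_right_distrib) simp
  also have "\<dots> \<le> L2_set (\<lambda>n. wt n * cmod (g n) + P * (wt n * cmod (u n)) + Q * (wt n * cmod (v n))) {1..N+1}"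
  proof (rule L2_set_mono)
    fix n assume "n \<in> {1..N+1}"
    then have "wt n * cmod (B * v n) \<le> wt n * (cmod (g n) + P * cmod (u n) + Q * cmod (v n))"
      using pt[of n] wt by (intro mult_left_mono) (auto simp: P_def Q_def)
    then show "cmod B * (wt n * cmod (v n)) \<le> wt n * cmod (g n) + P * (wt n * cmod (u n)) + Q * (wt n * cmod (v n))"
      by (simp add: norm_mult algebra_simps)
  qed (use wt in auto)
  also have "\<dots> \<le> nr g + L2_set (\<lambda>n. P * (wt n * cmod (u n))) {1..N+1} + L2_set (\<lambda>n. Q * (wt n * cmod (v n))) {1..N+1}"
    unfolding nr_def by (intro order_trans[OF L2_set_triangle_ineq] add_right_mono L2_set_triangle_ineq)
  also have "\<dots> = nr g + P * nr u + Q * nr v"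
    unfolding nr_def using PQ by (simp add: L2_set_right_distrib)
  finally show ?thesis
    unfolding nr A_def[symmetric] B_def[symmetric] \<kappa>_def[symmetric] P_def Q_def
    by (simp add: algebra_simps)
qed

text \<open>Since \<open>a\<close> need not be bounded below, consecutive values of \<open>\<parallel>u\<parallel> \<parallel>v\<parallel>\<close> at integer lengths may differ by
  large factors. The fractional lengths make the product continuous, so the balance is attained exactly.\<close>

lemma balanced_length_exists:
  assumes N0: "2 \<le> N0" and \<epsilon>: "0 < \<epsilon>"
    and small: "\<epsilon> * (norm_right (of_int N0) u * norm_right (of_int N0) v) \<le> 1"
    and unb: "\<And>X. \<exists>N\<ge>N0. X < norm_right (of_int N) u * norm_right (of_int N) v"
  obtains N t where "N0 \<le> N" "0 \<le> t" "t < 1"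
    "\<epsilon> * (norm_right (of_int N + t) u * norm_right (of_int N + t) v) = 1"
proof -
  define p where "p = (\<lambda>N::int. norm_right (of_int N) u * norm_right (of_int N) v)"
  obtain M where M: "N0 \<le> M" "1 / \<epsilon> < p M" using unb unfolding p_def by blast
  define j where "j = (LEAST j. 1 < \<epsilon> * p (N0 + int j))"
  have "1 < \<epsilon> * p (N0 + int (nat (M - N0)))" using M \<epsilon> by (simp add: field_simps)
  then have j: "1 < \<epsilon> * p (N0 + int j)" unfolding j_def by (rule LeastI)
  have "j \<noteq> 0"
  proof
    assume "j = 0"
    then have "1 < \<epsilon> * p N0" using j by simp
    then show False using small unfolding p_def by linarith
  qed
  then obtain i where i: "j = Suc i" by (cases j) auto
  define N where "N = N0 + int i"
  have lo: "\<epsilon> * p N \<le> 1"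
    using not_less_Least[of i "\<lambda>j. 1 < \<epsilon> * p (N0 + int j)"] i unfolding j_def[symmetric] N_def by simp
  have hi: "1 < \<epsilon> * p (N + 1)" using j by (simp add: i N_def add_ac)
  define S where "S = (\<lambda>f::int \<Rightarrow> complex. \<lambda>t. sqrt ((\<Sum>n=1..N. (cmod (f n))\<^sup>2) + t * (cmod (f (N + 1)))\<^sup>2))"
  have S: "norm_right (of_int N + t) f = S f t" if "0 \<le> t" "t < 1" for t f
  proof -
    have "\<lfloor>of_int N + t\<rfloor> = N" using that by (simp add: floor_eq_iff)
    then show ?thesis unfolding norm_right_def S_def by simp
  qed
  have "{1..N+1} = insert (N + 1) {1..N}" using N0 by (auto simp: N_def)
  then have S1: "norm_right (of_int (N + 1)) f = S f 1" for f
    unfolding norm_right_int S_def by (simp add: add.commute)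
  have "\<exists>t\<ge>0. t \<le> 1 \<and> \<epsilon> * (S u t * S v t) = 1"
  proof (rule IVT')
    show "\<epsilon> * (S u 0 * S v 0) \<le> 1" using lo S[of 0] by (simp add: p_def)
    show "1 \<le> \<epsilon> * (S u 1 * S v 1)" using hi S1 by (simp add: p_def)
    show "continuous_on {0..1} (\<lambda>t. \<epsilon> * (S u t * S v t))"
      unfolding S_def by (intro continuous_intros)
  qed simp
  then obtain t where t: "0 \<le> t" "t \<le> 1" "\<epsilon> * (S u t * S v t) = 1" by blast
  have "t \<noteq> 1" using t(3) hi S1 by (auto simp: p_def)
  then have "t < 1" using t by simp
  then show ?thesis using that[of N t] t S by (simp add: N_def)
qed

text \<open>This is the core of the subordinacy argument. On the length scale where
  \<open>\<epsilon> \<parallel>u\<parallel> \<parallel>v\<parallel> = 1\<close> the frame estimate bounds the component of \<open>g\<close> along the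
  dominating solution \<open>v\<close> by a quantity that vanishes with the ratio \<open>\<parallel>u\<parallel> / \<parallel>v\<parallel>\<close>.\<close>

lemma subordinate_wronskian_small:
  assumes a: "\<And>n. 0 < a n" and sub: "subordinate a b E u" and \<eta>: "0 < \<eta>" and C: "0 \<le> C"
  shows "\<exists>\<epsilon>\<^sub>0>0. \<forall>\<epsilon> g. 0 < \<epsilon> \<longrightarrow> \<epsilon> < \<epsilon>\<^sub>0 \<longrightarrow>
    (\<forall>n\<ge>2. jacobi a b g n = (of_real E + \<i> * of_real \<epsilon>) * g n) \<longrightarrow>
    g \<in> ell2 \<longrightarrow> \<epsilon> * (norm2 g)\<^sup>2 \<le> C \<longrightarrow> cmod (g 1) \<le> C \<longrightarrow> cmod (g 2) \<le> C \<longrightarrow>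
    cmod (wronskian a u g 1) \<le> \<eta>"
proof -
  have a0: "a n \<noteq> 0" for n using a[of n] by simp
  have u: "is_solution a b E u" using sub by (simp add: subordinate_def)
  obtain v where v: "is_solution a b E v" "lin_indep u v" and w: "\<And>n. 0 \<le> n \<Longrightarrow> wronskian a u v n = 1"
    using second_solution[OF a0 u subordinate_nonzero_data[OF a0 sub]] by blast
  define r where "r = (\<lambda>L. norm_right L u / norm_right L v)"
  have r: "(r \<longlongrightarrow> 0) at_top" using sub v unfolding subordinate_def r_def by blast
  have nz: "u 1 \<noteq> 0 \<or> u 2 \<noteq> 0" "v 1 \<noteq> 0 \<or> v 2 \<noteq> 0"
    using w[of 1] by (auto simp: wronskian_def)
  define A\<^sub>0 where "A\<^sub>0 = a 1 * (C * cmod (v 2) + C * cmod (v 1))"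
  have A\<^sub>0: "0 \<le> A\<^sub>0" using a[of 1] C by (simp add: A\<^sub>0_def)
  \<comment> \<open>\<open>A\<^sub>0\<close> bounds the other Wronskian, and \<open>3 * sqrt (C * x) + A\<^sub>0 * x\<close> is the bound
    that the estimate below gives at norm ratio \<open>x\<close>.\<close>
  have "((\<lambda>x. 3 * sqrt (C * x) + A\<^sub>0 * x) \<longlongrightarrow> 3 * sqrt (C * 0) + A\<^sub>0 * 0) (at_right 0)"
    by (intro tendsto_intros)
  then have "\<forall>\<^sub>F x in at_right 0. 3 * sqrt (C * x) + A\<^sub>0 * x < \<eta>"
    using \<eta> by (intro order_tendstoD(2)) auto
  then obtain \<delta> where \<delta>: "0 < \<delta>" "\<And>x. 0 < x \<Longrightarrow> x < \<delta> \<Longrightarrow> 3 * sqrt (C * x) + A\<^sub>0 * x < \<eta>"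
    unfolding eventually_at_right_field by blast
  have "\<forall>\<^sub>F L in at_top. r L < \<delta>" using r \<delta> by (intro order_tendstoD(2)) auto
  then obtain L\<^sub>0 where L\<^sub>0: "\<And>L. L\<^sub>0 \<le> L \<Longrightarrow> r L < \<delta>" unfolding eventually_at_top_linorder by blast
  define N0 where "N0 = max 2 \<lceil>L\<^sub>0\<rceil>"
  have N0: "2 \<le> N0" "L\<^sub>0 \<le> of_int N0" unfolding N0_def using le_of_int_ceiling[of L\<^sub>0] by (auto simp: of_int_max le_max_iff_disj)
  define p where "p = (\<lambda>N::int. norm_right (of_int N) u * norm_right (of_int N) v)"
  have unb: "\<exists>N\<ge>N0. X < p N" for X
  proof -
    define c where "c = (norm_right (of_int 2) u)\<^sup>2"
    have c: "0 < c" using norm_right_int_pos[of u 2] nz by (simp add: c_def)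
    have "\<forall>\<^sub>F L in at_top. r L < c / (\<bar>X\<bar> + 1)" using r c by (intro order_tendstoD(2)) auto
    then obtain L\<^sub>1 where L\<^sub>1: "\<And>L. L\<^sub>1 \<le> L \<Longrightarrow> r L < c / (\<bar>X\<bar> + 1)"
      unfolding eventually_at_top_linorder by blast
    define N where "N = max N0 \<lceil>L\<^sub>1\<rceil>"
    have N: "N0 \<le> N" "L\<^sub>1 \<le> of_int N" "2 \<le> N" using N0 le_of_int_ceiling[of L\<^sub>1] unfolding N_def by (auto simp: of_int_max le_max_iff_disj)
    have up: "0 < norm_right (of_int N) u" and vp: "0 < norm_right (of_int N) v"
      using norm_right_int_pos N(3) nz by auto
    have "norm_right (of_int N) u / norm_right (of_int N) v < c / (\<bar>X\<bar> + 1)"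
      using L\<^sub>1[OF N(2)] by (simp add: r_def)
    then have "norm_right (of_int N) u * (\<bar>X\<bar> + 1) < c * norm_right (of_int N) v"
      using vp by (simp add: field_simps)
    moreover have "c \<le> (norm_right (of_int N) u)\<^sup>2"
      unfolding c_def using norm_right_int_mono[OF N(3), of u] by (intro power_mono) auto
    then have "c * norm_right (of_int N) v \<le> (norm_right (of_int N) u)\<^sup>2 * norm_right (of_int N) v"
      using vp by (intro mult_right_mono) auto
    ultimately have "norm_right (of_int N) u * (\<bar>X\<bar> + 1) < norm_right (of_int N) u * p N"
      by (simp add: p_def power2_eq_square mult_ac)
    then have "\<bar>X\<bar> + 1 < p N" using up by simp
    then show ?thesis using N(1) by (intro exI[of _ N]) linarith
  qed
  define \<epsilon>\<^sub>0 where "\<epsilon>\<^sub>0 = 1 / (p N0 + 1)"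
  have p0: "0 \<le> p N0" by (simp add: p_def)
  have small: "cmod (wronskian a u g 1) \<le> \<eta>"
    if \<epsilon>: "0 < \<epsilon>" "\<epsilon> < \<epsilon>\<^sub>0" and g: "\<And>n. 2 \<le> n \<Longrightarrow> jacobi a b g n = (of_real E + \<i> * of_real \<epsilon>) * g n"
      and ge: "g \<in> ell2" "\<epsilon> * (norm2 g)\<^sup>2 \<le> C" and g12: "cmod (g 1) \<le> C" "cmod (g 2) \<le> C" for \<epsilon> g
  proof -
    have "\<epsilon> * (p N0 + 1) < 1" using \<epsilon> p0 by (simp add: \<epsilon>\<^sub>0_def field_simps)
    then have "\<epsilon> * p N0 \<le> 1" using \<epsilon>(1) by (simp add: algebra_simps)
    then obtain N t where N: "N0 \<le> N" and t: "0 \<le> t" "t < 1"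
      and bal: "\<epsilon> * (norm_right (of_int N + t) u * norm_right (of_int N + t) v) = 1"
      using balanced_length_exists[OF N0(1) \<epsilon>(1), of u v] unb unfolding p_def by blast
    define L where "L = of_int N + t"
    define U V G where "U = norm_right L u" and "V = norm_right L v" and "G = norm_right L g"
    have bal': "\<epsilon> * (U * V) = 1" using bal by (simp add: U_def V_def L_def)
    have UV: "0 \<le> U" "0 \<le> V" "0 \<le> G" by (auto simp: U_def V_def G_def)
    have "U \<noteq> 0" "V \<noteq> 0" using bal' by auto
    with UV have UV: "0 < U" "0 < V" "0 \<le> G" by auto
    have "L\<^sub>0 \<le> L" unfolding L_def using N N0 t by linarith
    from L\<^sub>0[OF this] have rL: "U / V < \<delta>" by (simp add: r_def U_def V_def)
    have GC: "G\<^sup>2 \<le> C * (U * V)"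
    proof -
      have "G\<^sup>2 \<le> (norm2 g)\<^sup>2"
        using norm_right_le_norm2[OF ge(1), of N t] N N0 t UV unfolding G_def L_def by (intro power_mono) auto
      then have "\<epsilon> * G\<^sup>2 \<le> \<epsilon> * (C * (U * V))"
        using ge(2) \<epsilon> bal' mult_left_mono[of "G\<^sup>2" "(norm2 g)\<^sup>2" \<epsilon>]
        by (metis (no_types, opaque_lifting) less_eq_real_def mult.left_commute mult.right_neutral order_trans)
      then show ?thesis using \<epsilon> by simp
    qed
    have A: "cmod (wronskian a g v 1) \<le> A\<^sub>0"
    proof -
      have "cmod (g 1 * v 2 - g 2 * v 1) \<le> C * cmod (v 2) + C * cmod (v 1)"
        by (intro order_trans[OF norm_triangle_ineq4] add_mono) (auto simp: norm_mult intro!: mult_right_mono g12)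
      then show ?thesis unfolding wronskian_def A\<^sub>0_def using a[of 1] by (simp add: norm_mult)
    qed
    have "cmod (wronskian a u g 1) * V \<le> G + cmod (wronskian a g v 1) * U + 2 * \<epsilon> * U * V * G"
      using solution_frame_estimate[OF u v(1) w g, of N t L] N N0 t \<epsilon>
      unfolding U_def V_def G_def by (simp add: L_def norm_mult)
    also have "2 * \<epsilon> * U * V * G = 2 * (\<epsilon> * (U * V)) * G" by simp
    also have "G + cmod (wronskian a g v 1) * U + 2 * (\<epsilon> * (U * V)) * G \<le> 3 * G + A\<^sub>0 * U"
      unfolding bal' using mult_right_mono[OF A, of U] UV by simp
    finally have "cmod (wronskian a u g 1) \<le> 3 * (G / V) + A\<^sub>0 * (U / V)"
      using UV by (simp add: field_simps)
    also have "G / V \<le> sqrt (C * (U / V))"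
      using GC UV by (intro real_le_rsqrt) (simp add: power_divide power2_eq_square field_simps)
    finally have "cmod (wronskian a u g 1) \<le> 3 * sqrt (C * (U / V)) + A\<^sub>0 * (U / V)" by simp
    also have "\<dots> < \<eta>" using \<delta>(2)[of "U / V"] rL UV by simp
    finally show ?thesis by simp
  qed
  have "0 < \<epsilon>\<^sub>0" using p0 by (simp add: \<epsilon>\<^sub>0_def)
  then show ?thesis using small by blast
qed

section \<open>Energies with a subordinate solution form a null set\<close>

text \<open>The reflection that exchanges the half-lines \<open>{1..}\<close> and \<open>{..0}\<close>, as in \<open>norm_left\<close>. It moves the
  bond weights by \<open>n \<mapsto> - n\<close> and the diagonal by \<open>n \<mapsto> 1 - n\<close>.\<close>

definition reflect :: "(int \<Rightarrow> complex) \<Rightarrow> int \<Rightarrow> complex" where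
  "reflect f n = f (1 - n)"

lemma reflect_reflect [simp]: "reflect (reflect f) = f"
  by (simp add: reflect_def fun_eq_iff)

lemma jacobi_reflect:
  "jacobi (\<lambda>n. a (- n)) (\<lambda>n. b (1 - n)) (reflect f) n = jacobi a b f (1 - n)"
proof -
  have e: "1 - (n - 1) = 1 - n + 1" "1 - (n + 1) = 1 - n - 1" "- (n - 1) = 1 - n" "- n = 1 - n - 1" by auto
  show ?thesis unfolding jacobi_def reflect_def e(1,2,3) by (subst e(4)) (simp only: add_ac)
qed

lemma is_solution_reflect:
  assumes "is_solution a b E f"
  shows "is_solution (\<lambda>n. a (- n)) (\<lambda>n. b (1 - n)) E (reflect f)"
  using assms unfolding is_solution_def jacobi_reflect by (simp add: reflect_def)

lemma subordinate_reflect: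
  assumes "subordinate a b E u"
  shows "subordinate (\<lambda>n. a (- n)) (\<lambda>n. b (1 - n)) E (reflect u)"
  unfolding subordinate_def
proof (intro conjI allI impI)
  show "is_solution (\<lambda>n. a (- n)) (\<lambda>n. b (1 - n)) E (reflect u)"
    using assms is_solution_reflect by (simp add: subordinate_def)
  obtain n where "u n \<noteq> 0" using assms by (auto simp: subordinate_def)
  then show "\<exists>n. reflect u n \<noteq> 0" by (intro exI[of _ "1 - n"]) (simp add: reflect_def)
  fix v assume v: "is_solution (\<lambda>n. a (- n)) (\<lambda>n. b (1 - n)) E v \<and> lin_indep (reflect u) v"
  have sol: "is_solution a b E (reflect v)"
    using is_solution_reflect[of "\<lambda>n. a (- n)" "\<lambda>n. b (1 - n)" E v] v by simp
  have "lin_indep u (reflect v)"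
    unfolding lin_indep_def
  proof (intro allI impI)
    fix c d assume cd: "\<forall>n. c * u n + d * reflect v n = 0"
    have "c * reflect u n + d * v n = 0" for n
      using cd[rule_format, of "1 - n"] by (simp add: reflect_def)
    then show "c = 0 \<and> d = 0" using v unfolding lin_indep_def by blast
  qed
  with sol assms have lim: "((\<lambda>L. norm_right L u / norm_right L (reflect v)) \<longlongrightarrow> 0) at_top"
    "((\<lambda>L. norm_left L u / norm_left L (reflect v)) \<longlongrightarrow> 0) at_top"
    unfolding subordinate_def by blast+
  have nl: "norm_left L f = norm_right L (reflect f)" for L f
    unfolding norm_left_def reflect_def ..
  show "((\<lambda>L. norm_right L (reflect u) / norm_right L v) \<longlongrightarrow> 0) at_top"
    "((\<lambda>L. norm_left L (reflect u) / norm_left L v) \<longlongrightarrow> 0) at_top"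
    using lim unfolding nl by simp_all
qed

lemma wronskian_reflect:
  "wronskian (\<lambda>n. a (- n)) (reflect f) (reflect g) n = - wronskian a f g (- n)"
  unfolding wronskian_def reflect_def by (simp add: algebra_simps)

lemma ell2_reflect:
  assumes "f \<in> ell2"
  shows "reflect f \<in> ell2" "norm2 (reflect f) = norm2 f"
proof -
  have "bij (\<lambda>n::int. 1 - n)" by (rule o_bij[of "\<lambda>n. 1 - n"]) auto
  note b = this
  show "reflect f \<in> ell2"
    using assms summable_on_reindex_bij_betw[OF b, of "\<lambda>n. (cmod (f n))\<^sup>2"]
    unfolding ell2_def reflect_def by simp
  show "norm2 (reflect f) = norm2 f"
    unfolding norm2_def reflect_def using infsum_reindex_bij_betw[OF b, of "\<lambda>n. (cmod (f n))\<^sup>2"] by simp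
qed

context jacobi_op
begin

text \<open>The resolvent column \<open>g\<close> with source \<open>\<delta>\<^sub>k\<close> solves the eigenvalue equation on both
  sides of the sites \<open>0\<close> and \<open>1\<close>, so along a sequence \<open>\<epsilon> \<rightarrow> 0\<close> for which its entries there stay
  bounded, both outer Wronskians with \<open>u\<close> tend to \<open>0\<close>. Their difference is \<open>u k + O(\<epsilon>)\<close>.\<close>

lemma subordinate_vanishes_if_green_bounded:
  assumes sub: "subordinate a b E u" and k: "k \<in> {0, 1}"
    and bd: "\<exists>\<^sub>F m in sequentially. \<forall>k\<in>{0,1}. \<forall>j\<in>{0,1}.
      cmod (green (of_real E + \<i> * of_real (1 / real (Suc m))) (delta k) j) \<le> c"
  shows "u k = 0"
proof -
  \<comment> \<open>Besides the entries of \<open>g\<close> at \<open>0\<close> and \<open>1\<close>, \<open>C\<close> bounds those at \<open>2\<close> and \<open>- 1\<close>, which the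
    resolvent equation at the sites \<open>1\<close> and \<open>0\<close> expresses through the former.\<close>
  define C where "C = \<bar>c\<bar> + (1 + (\<bar>E\<bar> + 1) * \<bar>c\<bar> + 2 * K * \<bar>c\<bar>) * (1 / a 1 + 1 / a (- 1))"
  have C: "\<bar>c\<bar> \<le> C" "(1 + (\<bar>E\<bar> + 1) * \<bar>c\<bar> + 2 * K * \<bar>c\<bar>) / a 1 \<le> C"
    "(1 + (\<bar>E\<bar> + 1) * \<bar>c\<bar> + 2 * K * \<bar>c\<bar>) / a (- 1) \<le> C"
  proof -
    have x: "0 \<le> 1 + (\<bar>E\<bar> + 1) * \<bar>c\<bar> + 2 * K * \<bar>c\<bar>" using K_nonneg by simp
    have y: "0 < 1 / a 1" "0 < 1 / a (- 1)" using a_pos by simp_all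
    show "\<bar>c\<bar> \<le> C" "(1 + (\<bar>E\<bar> + 1) * \<bar>c\<bar> + 2 * K * \<bar>c\<bar>) / a 1 \<le> C"
      "(1 + (\<bar>E\<bar> + 1) * \<bar>c\<bar> + 2 * K * \<bar>c\<bar>) / a (- 1) \<le> C"
      unfolding C_def using mult_nonneg_nonneg[OF x less_imp_le[OF y(1)]] mult_nonneg_nonneg[OF x less_imp_le[OF y(2)]]
      by (simp_all add: distrib_left)
  qed
  have C0: "0 \<le> C" using C(1) by linarith
  have le: "cmod (u k) \<le> \<eta>" if \<eta>: "0 < \<eta>" for \<eta>
  proof -
    define M where "M = \<bar>c\<bar> * (cmod (u 0) + cmod (u 1)) + 1"
    have M: "0 < M" unfolding M_def by (simp add: add_nonneg_pos)
    have \<eta>3: "0 < \<eta> / 3" using \<eta> by simp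
    obtain e1 where e1: "0 < e1" and right: "\<And>\<epsilon> g. 0 < \<epsilon> \<Longrightarrow> \<epsilon> < e1 \<Longrightarrow>
      (\<forall>n\<ge>2. J g n = (of_real E + \<i> * of_real \<epsilon>) * g n) \<Longrightarrow> g \<in> ell2 \<Longrightarrow> \<epsilon> * (norm2 g)\<^sup>2 \<le> C \<Longrightarrow>
      cmod (g 1) \<le> C \<Longrightarrow> cmod (g 2) \<le> C \<Longrightarrow> cmod (wronskian a u g 1) \<le> \<eta> / 3"
      using subordinate_wronskian_small[OF a_pos sub \<eta>3 C0] by blast
    obtain e2 where e2: "0 < e2" and left: "\<And>\<epsilon> g. 0 < \<epsilon> \<Longrightarrow> \<epsilon> < e2 \<Longrightarrow>
      (\<forall>n\<ge>2. jacobi (\<lambda>n. a (- n)) (\<lambda>n. b (1 - n)) g n = (of_real E + \<i> * of_real \<epsilon>) * g n) \<Longrightarrow>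
      g \<in> ell2 \<Longrightarrow> \<epsilon> * (norm2 g)\<^sup>2 \<le> C \<Longrightarrow> cmod (g 1) \<le> C \<Longrightarrow> cmod (g 2) \<le> C \<Longrightarrow>
      cmod (wronskian (\<lambda>n. a (- n)) (reflect u) g 1) \<le> \<eta> / 3"
      using subordinate_wronskian_small[OF a_pos subordinate_reflect[OF sub] \<eta>3 C0] by blast
    define e where "e = min (min e1 e2) (min 1 (\<eta> / 3 / M))"
    have e: "0 < e" using e1 e2 \<eta> M by (simp add: e_def)
    have "(\<lambda>m. 1 / real (Suc m)) \<longlonglongrightarrow> 0" using LIMSEQ_inverse_real_of_nat by (simp add: inverse_eq_divide)
    then have "\<forall>\<^sub>F m in sequentially. 1 / real (Suc m) < e" using e by (intro order_tendstoD(2)) auto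
    then have "\<exists>\<^sub>F m in sequentially. (\<forall>k\<in>{0,1}. \<forall>j\<in>{0,1}.
      cmod (green (of_real E + \<i> * of_real (1 / real (Suc m))) (delta k) j) \<le> c) \<and> 1 / real (Suc m) < e"
      using frequently_eventually_frequently[OF bd] by (simp add: conj_commute)
    then obtain m where m: "\<forall>k\<in>{0,1}. \<forall>j\<in>{0,1}.
      cmod (green (of_real E + \<i> * of_real (1 / real (Suc m))) (delta k) j) \<le> c" "1 / real (Suc m) < e"
      using frequently_ex by blast
    define \<epsilon> where "\<epsilon> = 1 / real (Suc m)"
    have \<epsilon>: "0 < \<epsilon>" "\<epsilon> < e" using m(2) by (simp_all add: \<epsilon>_def)
    define z where "z = of_real E + \<i> * complex_of_real \<epsilon>"
    have z: "0 < Im z" "Im z = \<epsilon>" using \<epsilon> by (auto simp: z_def)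
    define g where "g = green z (delta k)"
    note gr = green[OF delta_ell2 z(1), of k, folded g_def]
    have g01: "cmod (g 0) \<le> \<bar>c\<bar>" "cmod (g 1) \<le> \<bar>c\<bar>"
      using m(1) k unfolding g_def z_def \<epsilon>_def by fastforce+
    have far: "J g n = z * g n" if "n \<noteq> 0" "n \<noteq> 1" for n
      using gr(2)[of n] that k by (auto simp: delta_def)
    have zE: "cmod z \<le> \<bar>E\<bar> + 1"
      using \<epsilon> unfolding z_def e_def by (intro order_trans[OF norm_triangle_ineq]) (auto simp: norm_mult)
    have dk: "cmod (delta k n) \<le> 1" for n by (simp add: delta_def)
    have zg: "cmod (z * g j) \<le> (\<bar>E\<bar> + 1) * \<bar>c\<bar>" if "j \<in> {0,1}" for j
      using that g01 zE unfolding norm_mult by (intro mult_mono) auto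
    have ag: "cmod (of_real (a n) * g j) \<le> K * \<bar>c\<bar>" "cmod (of_real (b n) * g j) \<le> K * \<bar>c\<bar>" if "j \<in> {0,1}" for j n
      using that g01 abs_a_le b_le K_nonneg unfolding norm_mult norm_of_real by (intro mult_mono; auto)+
    have g2: "cmod (g 2) \<le> C"
    proof -
      have "of_real (a 1) * g 2 = delta k 1 + z * g 1 - of_real (a 0) * g 0 - of_real (b 1) * g 1"
        using gr(2)[of 1] by (simp add: jacobi_def algebra_simps)
      then have "a 1 * cmod (g 2) = cmod (delta k 1 + z * g 1 - of_real (a 0) * g 0 - of_real (b 1) * g 1)"
        using a_pos[of 1] by (metis abs_of_pos norm_mult norm_of_real)
      also have "\<dots> \<le> 1 + (\<bar>E\<bar> + 1) * \<bar>c\<bar> + K * \<bar>c\<bar> + K * \<bar>c\<bar>"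
        by (intro order_trans[OF norm_triangle_ineq4] order_trans[OF norm_triangle_ineq] add_mono dk zg ag) auto
      finally show ?thesis using a_pos[of 1] by (intro order_trans[OF _ C(2)]) (simp add: field_simps)
    qed
    have gm1: "cmod (g (- 1)) \<le> C"
    proof -
      have "of_real (a (- 1)) * g (- 1) = delta k 0 + z * g 0 - of_real (a 0) * g 1 - of_real (b 0) * g 0"
        using gr(2)[of 0] by (simp add: jacobi_def algebra_simps)
      then have "a (- 1) * cmod (g (- 1)) = cmod (delta k 0 + z * g 0 - of_real (a 0) * g 1 - of_real (b 0) * g 0)"
        using a_pos[of "- 1"] by (metis abs_of_pos norm_mult norm_of_real)
      also have "\<dots> \<le> 1 + (\<bar>E\<bar> + 1) * \<bar>c\<bar> + K * \<bar>c\<bar> + K * \<bar>c\<bar>"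
        by (intro order_trans[OF norm_triangle_ineq4] order_trans[OF norm_triangle_ineq] add_mono dk zg ag) auto
      finally show ?thesis using a_pos[of "- 1"] by (intro order_trans[OF _ C(3)]) (simp add: field_simps)
    qed
    have energy: "\<epsilon> * (norm2 g)\<^sup>2 \<le> C"
    proof -
      have "\<epsilon> * (norm2 g)\<^sup>2 = Im (g k)"
        using green_pairing(1)[OF delta_ell2 z(1), of k] by (simp add: g_def z(2) inner2_delta_right)
      also have "\<dots> \<le> \<bar>c\<bar>" using abs_Im_le_cmod[of "g k"] g01 k by auto
      finally show ?thesis using C by simp
    qed
    have R: "cmod (wronskian a u g 1) \<le> \<eta> / 3"
    proof (rule right[of \<epsilon>])
      show "\<forall>n\<ge>2. J g n = (of_real E + \<i> * of_real \<epsilon>) * g n" using far by (simp add: z_def)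
    qed (use \<epsilon> gr energy g01 g2 C in \<open>auto simp: e_def\<close>)
    have L: "cmod (wronskian a u g (- 1)) \<le> \<eta> / 3"
    proof -
      have "cmod (wronskian (\<lambda>n. a (- n)) (reflect u) (reflect g) 1) \<le> \<eta> / 3"
      proof (rule left[of \<epsilon>])
        show "\<forall>n\<ge>2. jacobi (\<lambda>n. a (- n)) (\<lambda>n. b (1 - n)) (reflect g) n = (of_real E + \<i> * of_real \<epsilon>) * reflect g n"
          unfolding jacobi_reflect using far by (simp add: z_def reflect_def)
      qed (use \<epsilon> energy g01 gm1 C ell2_reflect[OF gr(1)] in \<open>auto simp: e_def reflect_def\<close>)
      then show ?thesis unfolding wronskian_reflect by simp
    qed
    have u: "J u n = of_real E * u n" for n using sub by (simp add: subordinate_def is_solution_def)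
    have dif: "u n * J g n - g n * J u n = u n * delta k n + \<i> * of_real \<epsilon> * (u n * g n)" for n
      unfolding u gr(2) z_def by (simp add: algebra_simps)
    have "wronskian a u g 1 = wronskian a u g (- 1)
        + (u 0 * delta k 0 + \<i> * of_real \<epsilon> * (u 0 * g 0)) + (u 1 * delta k 1 + \<i> * of_real \<epsilon> * (u 1 * g 1))"
      using wronskian_step[of a u g 0 b] wronskian_step[of a u g 1 b] by (simp add: dif)
    moreover have "u 0 * delta k 0 + u 1 * delta k 1 = u k" using k by (auto simp: delta_def)
    ultimately have "u k = wronskian a u g 1 - wronskian a u g (- 1) - \<i> * of_real \<epsilon> * (u 0 * g 0 + u 1 * g 1)"
      by (simp add: algebra_simps)
    also have "cmod \<dots> \<le> \<eta> / 3 + \<eta> / 3 + \<epsilon> * M"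
    proof -
      have "cmod (u 0 * g 0 + u 1 * g 1) \<le> cmod (u 0) * \<bar>c\<bar> + cmod (u 1) * \<bar>c\<bar>"
        by (intro order_trans[OF norm_triangle_ineq] add_mono) (auto simp: norm_mult intro!: mult_left_mono g01)
      also have "\<dots> \<le> M" by (simp add: M_def algebra_simps)
      finally have "cmod (\<i> * of_real \<epsilon> * (u 0 * g 0 + u 1 * g 1)) \<le> \<epsilon> * M"
        using \<epsilon> by (simp add: norm_mult)
      then show ?thesis by (intro order_trans[OF norm_triangle_ineq4] add_mono L R)
    qed
    also have "\<epsilon> * M \<le> \<eta> / 3"
      using \<epsilon> M unfolding e_def by (simp add: field_simps)
    finally show ?thesis by simp
  qed
  have "cmod (u k) \<le> 0" by (rule field_le_epsilon, subst add_0, rule le)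
  then show ?thesis by simp
qed

theorem AE_not_subordinate: "AE E in lborel. E \<notin> S_set a b"
  using green_bounded_frequently
proof eventually_elim
  case (elim E)
  then obtain c where c: "\<exists>\<^sub>F m in sequentially. \<forall>k\<in>{0,1}. \<forall>j\<in>{0,1}.
      cmod (green (of_real E + \<i> * of_real (1 / real (Suc m))) (delta k) j) \<le> c" by blast
  show ?case
  proof
    assume "E \<in> S_set a b"
    then obtain u where u: "subordinate a b E u" by (auto simp: S_set_def)
    have "u 0 = 0" "u 1 = 0" using subordinate_vanishes_if_green_bounded[OF u _ c] by auto
    then show False using subordinate_nonzero_data[OF _ u] a_pos by (metis less_irrefl)
  qed
qed

end

section \<open>Projection-valued measures\<close>

locale pvm =
  fixes P :: "real set \<Rightarrow> operator"
  assumes pvm: "proj_valued_measure P"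
begin

lemma P_proj:
  assumes "B \<in> sets borel"
  shows P_ell2: "\<psi> \<in> ell2 \<Longrightarrow> P B \<psi> \<in> ell2"
    and P_idem: "\<psi> \<in> ell2 \<Longrightarrow> P B (P B \<psi>) = P B \<psi>"
    and P_lin: "\<phi> \<in> ell2 \<Longrightarrow> \<psi> \<in> ell2 \<Longrightarrow> P B (\<lambda>n. c * \<phi> n + \<psi> n) = (\<lambda>n. c * P B \<phi> n + P B \<psi> n)"
    and P_sym: "\<phi> \<in> ell2 \<Longrightarrow> \<psi> \<in> ell2 \<Longrightarrow> inner2 (P B \<phi>) \<psi> = inner2 \<phi> (P B \<psi>)"
proof -
  have op: "orthogonal_projection (P B)"
    using conjunct1[OF pvm[unfolded proj_valued_measure_def]] assms by (rule bspec)
  show "\<psi> \<in> ell2 \<Longrightarrow> P B \<psi> \<in> ell2" "\<psi> \<in> ell2 \<Longrightarrow> P B (P B \<psi>) = P B \<psi>"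
    using op unfolding orthogonal_projection_def by simp_all
  show "\<phi> \<in> ell2 \<Longrightarrow> \<psi> \<in> ell2 \<Longrightarrow> P B (\<lambda>n. c * \<phi> n + \<psi> n) = (\<lambda>n. c * P B \<phi> n + P B \<psi> n)"
    using op unfolding orthogonal_projection_def by simp
  show "\<phi> \<in> ell2 \<Longrightarrow> \<psi> \<in> ell2 \<Longrightarrow> inner2 (P B \<phi>) \<psi> = inner2 \<phi> (P B \<psi>)"
    using conjunct2[OF conjunct2[OF op[unfolded orthogonal_projection_def]]] by blast
qed
lemma P_Int:
  "A \<in> sets borel \<Longrightarrow> B \<in> sets borel \<Longrightarrow> \<psi> \<in> ell2 \<Longrightarrow> P A (P B \<psi>) = P (A \<inter> B) \<psi>"
  using conjunct1[OF conjunct2[OF conjunct2[OF pvm[unfolded proj_valued_measure_def]]]] by simp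

lemma P_bounded_support: "\<exists>R. \<forall>\<psi>\<in>ell2. P {-R..R} \<psi> = \<psi>"
  using conjunct1[OF conjunct2[OF pvm[unfolded proj_valued_measure_def]]] .

lemma P_additive:
  "range A \<subseteq> sets borel \<Longrightarrow> disjoint_family A \<Longrightarrow> \<psi> \<in> ell2 \<Longrightarrow>
    (\<lambda>N. norm2 (\<lambda>n. (\<Sum>i<N. P (A i) \<psi> n) - P (\<Union>i. A i) \<psi> n)) \<longlonglongrightarrow> 0"
  using conjunct2[OF conjunct2[OF conjunct2[OF pvm[unfolded proj_valued_measure_def]]]] by blast

text \<open>Additivity for the constant family \<open>{}\<close> says that \<open>N - 1\<close> copies of \<open>P {} \<psi>\<close> tend to \<open>0\<close> in norm.\<close>

lemma P_empty:
  assumes \<psi>: "\<psi> \<in> ell2"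
  shows "P {} \<psi> = (\<lambda>n. 0)"
proof -
  have "(\<lambda>N. norm2 (\<lambda>n. (\<Sum>i<N. P {} \<psi> n) - P (\<Union>i::nat. {}) \<psi> n)) \<longlonglongrightarrow> 0"
    using P_additive[of "\<lambda>i. {}" \<psi>] \<psi> by (simp add: disjoint_family_on_def)
  moreover have "norm2 (P {} \<psi>) \<le> norm2 (\<lambda>n. (\<Sum>i<N. P {} \<psi> n) - P (\<Union>i::nat. {}) \<psi> n)" if "2 \<le> N" for N :: nat
  proof -
    have "norm2 (\<lambda>n. (\<Sum>i<N. P {} \<psi> n) - P (\<Union>i::nat. {}) \<psi> n) = norm2 (\<lambda>n. (of_nat N - 1) * P {} \<psi> n)"
      by (simp add: algebra_simps)
    also have "\<dots> = real (N - 1) * norm2 (P {} \<psi>)"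
      using that unfolding norm2_scale by (metis (no_types, lifting) norm_of_nat of_nat_1 of_nat_diff one_le_numeral order_trans)
    also have "\<dots> \<ge> 1 * norm2 (P {} \<psi>)" using that by (intro mult_right_mono) auto
    finally show ?thesis by simp
  qed
  ultimately have "norm2 (P {} \<psi>) \<le> 0" by (intro LIMSEQ_le_const) auto
  then have "norm2 (P {} \<psi>) = 0" using norm2_nonneg[of "P {} \<psi>"] by linarith
  then show ?thesis using norm2_eq_0_iff[OF P_ell2[OF _ \<psi>, of "{}"]] by simp
qed

lemma P_UNIV:
  assumes \<psi>: "\<psi> \<in> ell2"
  shows "P UNIV \<psi> = \<psi>"
proof -
  obtain R where "\<forall>\<psi>\<in>ell2. P {-R..R} \<psi> = \<psi>"
    using P_bounded_support by blast
  then show ?thesis using P_Int[of UNIV "{-R..R}" \<psi>] \<psi> by simp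
qed

lemma P_Compl:
  assumes B: "B \<in> sets borel" and \<psi>: "\<psi> \<in> ell2"
  shows "P B \<psi> n + P (- B) \<psi> n = \<psi> n"
proof -
  \<comment> \<open>Additivity is given for sequences of sets: the two sets are followed by empty ones.\<close>
  define A where "A = (\<lambda>i::nat. if i = 0 then B else if i = 1 then - B else {})"
  have "(\<Union>i. A i) = UNIV" unfolding A_def by (auto split: if_splits)
  moreover have "(\<lambda>N. norm2 (\<lambda>n. (\<Sum>i<N. P (A i) \<psi> n) - P (\<Union>i. A i) \<psi> n)) \<longlonglongrightarrow> 0"
    using B \<psi> by (intro P_additive) (auto simp: A_def disjoint_family_on_def)
  ultimately have lim: "(\<lambda>N. norm2 (\<lambda>n. (\<Sum>i<N. P (A i) \<psi> n) - \<psi> n)) \<longlonglongrightarrow> 0"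
    by (simp add: P_UNIV \<psi>)
  have "(\<Sum>i<N + 2. P (A i) \<psi> n) = P B \<psi> n + P (- B) \<psi> n" for N n
    by (induction N) (auto simp: A_def P_empty \<psi> numeral_2_eq_2)
  then have "(\<lambda>N::nat. norm2 (\<lambda>n. P B \<psi> n + P (- B) \<psi> n - \<psi> n)) \<longlonglongrightarrow> 0"
    using LIMSEQ_ignore_initial_segment[OF lim, of 2] by simp
  then have "norm2 (\<lambda>n. P B \<psi> n + P (- B) \<psi> n - \<psi> n) = 0"
    by (simp add: LIMSEQ_const_iff)
  moreover have "(\<lambda>n. P B \<psi> n + P (- B) \<psi> n - \<psi> n) \<in> ell2"
    by (intro ell2_diff ell2_add P_ell2 \<psi>) (use B in auto)
  ultimately have "(\<lambda>n. P B \<psi> n + P (- B) \<psi> n - \<psi> n) = (\<lambda>n. 0)"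
    using norm2_eq_0_iff by blast
  then show ?thesis by (auto dest: fun_cong[of _ _ n])
qed

definition weight :: "(int \<Rightarrow> complex) \<Rightarrow> real set \<Rightarrow> real" where
  "weight \<psi> B = Re (inner2 (P B \<psi>) \<psi>)"

lemma weight_eq_norm:
  assumes "B \<in> sets borel" "\<psi> \<in> ell2"
  shows "inner2 (P B \<psi>) \<psi> = of_real ((norm2 (P B \<psi>))\<^sup>2)" "weight \<psi> B = (norm2 (P B \<psi>))\<^sup>2"
proof -
  have "inner2 (P B \<psi>) \<psi> = inner2 (P B \<psi>) (P B \<psi>)"
    using P_sym[OF assms(1) P_ell2[OF assms] assms(2)] P_idem[OF assms] by simp
  then show "inner2 (P B \<psi>) \<psi> = of_real ((norm2 (P B \<psi>))\<^sup>2)"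
    using inner2_self[OF P_ell2[OF assms]] by simp
  then show "weight \<psi> B = (norm2 (P B \<psi>))\<^sup>2" by (simp add: weight_def)
qed

lemma weight_nonneg: "B \<in> sets borel \<Longrightarrow> \<psi> \<in> ell2 \<Longrightarrow> 0 \<le> weight \<psi> B"
  by (simp add: weight_eq_norm)

lemma weight_UNIV: "\<psi> \<in> ell2 \<Longrightarrow> weight \<psi> UNIV = (norm2 \<psi>)\<^sup>2"
  by (simp add: weight_eq_norm P_UNIV)

lemma P_sum_ell2:
  fixes N :: nat
  assumes "range A \<subseteq> sets borel" "\<psi> \<in> ell2"
  shows "(\<lambda>n. \<Sum>i<N. P (A i) \<psi> n) \<in> ell2
    \<and> inner2 (\<lambda>n. \<Sum>i<N. P (A i) \<psi> n) \<psi> = (\<Sum>i<N. inner2 (P (A i) \<psi>) \<psi>)"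
proof (induction N)
  case (Suc N)
  have *: "P (A N) \<psi> \<in> ell2" using assms by (intro P_ell2) auto
  show ?case
    using Suc ell2_add[OF _ *] inner2_lincomb_left[OF _ * assms(2), of _ 1 1] by simp
qed simp

lemma weight_sums:
  assumes A: "range A \<subseteq> sets borel" "disjoint_family A" and \<psi>: "\<psi> \<in> ell2"
  shows "(\<lambda>i. weight \<psi> (A i)) sums weight \<psi> (\<Union>i. A i)"
proof -
  have U: "(\<Union>i. A i) \<in> sets borel" using A by auto
  have bd: "\<bar>(\<Sum>i<N. weight \<psi> (A i)) - weight \<psi> (\<Union>i. A i)\<bar>
      \<le> norm2 (\<lambda>n. (\<Sum>i<N. P (A i) \<psi> n) - P (\<Union>i. A i) \<psi> n) * norm2 \<psi>" for N
  proof -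
    define S where "S = (\<lambda>n. \<Sum>i<N. P (A i) \<psi> n)"
    have S: "S \<in> ell2" "inner2 S \<psi> = (\<Sum>i<N. inner2 (P (A i) \<psi>) \<psi>)"
      using P_sum_ell2[OF A(1) \<psi>] by (auto simp: S_def)
    have "(\<Sum>i<N. weight \<psi> (A i)) - weight \<psi> (\<Union>i. A i) = Re (inner2 (\<lambda>n. S n - P (\<Union>i. A i) \<psi> n) \<psi>)"
      using inner2_diff_left[OF S(1) P_ell2[OF U \<psi>] \<psi>] by (simp add: weight_def S(2))
    also have "\<bar>\<dots>\<bar> \<le> norm2 (\<lambda>n. S n - P (\<Union>i. A i) \<psi> n) * norm2 \<psi>"
      by (rule order_trans[OF abs_Re_le_cmod inner2_Cauchy_Schwarz[OF ell2_diff[OF S(1) P_ell2[OF U \<psi>]] \<psi>]])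
    finally show ?thesis by (simp add: S_def)
  qed
  have lim: "(\<lambda>N. norm2 (\<lambda>n. (\<Sum>i<N. P (A i) \<psi> n) - P (\<Union>i. A i) \<psi> n) * norm2 \<psi>) \<longlonglongrightarrow> 0"
    using tendsto_mult_left_zero[OF P_additive[OF A \<psi>]] .
  have "(\<lambda>N. (\<Sum>i<N. weight \<psi> (A i)) - weight \<psi> (\<Union>i. A i)) \<longlonglongrightarrow> 0"
    by (rule Lim_null_comparison[OF always_eventually lim], intro allI, unfold real_norm_def, rule bd)
  then show ?thesis unfolding sums_def by (rule LIM_zero_cancel)
qed

lemma sets_vec_measure [simp, measurable_cong]: "sets (vec_measure P \<psi>) = sets borel"
  and space_vec_measure [simp]: "space (vec_measure P \<psi>) = UNIV"
  unfolding vec_measure_def using sets.sigma_sets_eq[of "borel :: real measure"]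
  by (simp_all add: sets_measure_of space_measure_of_conv)

lemma emeasure_vec_measure:
  assumes B: "B \<in> sets borel" and \<psi>: "\<psi> \<in> ell2"
  shows "emeasure (vec_measure P \<psi>) B = ennreal (weight \<psi> B)"
proof -
  have "emeasure (vec_measure P \<psi>) B = (\<lambda>B. ennreal (weight \<psi> B)) B"
  proof (rule emeasure_measure_of)
    show "vec_measure P \<psi> = measure_of UNIV (sets borel) (\<lambda>B. ennreal (weight \<psi> B))"
      by (simp add: vec_measure_def weight_def)
    show "positive (sets (vec_measure P \<psi>)) (\<lambda>B. ennreal (weight \<psi> B))"
      by (simp add: positive_def weight_def P_empty \<psi>)
    show "countably_additive (sets (vec_measure P \<psi>)) (\<lambda>B. ennreal (weight \<psi> B))"
      unfolding countably_additive_def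
    proof (intro allI impI)
      fix A :: "nat \<Rightarrow> real set"
      assume A: "range A \<subseteq> sets (vec_measure P \<psi>)" "disjoint_family A"
      then show "(\<Sum>i. ennreal (weight \<psi> (A i))) = ennreal (weight \<psi> (\<Union>i. A i))"
        by (intro suminf_ennreal_eq weight_sums weight_nonneg \<psi>) auto
    qed
  qed (use B in auto)
  then show ?thesis .
qed

lemma finite_measure_vec_measure: "\<psi> \<in> ell2 \<Longrightarrow> finite_measure (vec_measure P \<psi>)"
  by (rule finite_measureI) (simp add: emeasure_vec_measure)

lemma measure_vec_measure:
  "B \<in> sets borel \<Longrightarrow> \<psi> \<in> ell2 \<Longrightarrow> measure (vec_measure P \<psi>) B = weight \<psi> B"
  by (simp add: measure_def emeasure_vec_measure weight_nonneg)

lemma sets_mu [simp, measurable_cong]: "sets (mu P) = sets borel"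
  and space_mu [simp]: "space (mu P) = UNIV"
  unfolding mu_def using sets.sigma_sets_eq[of "borel :: real measure"]
  by (simp_all add: sets_measure_of space_measure_of_conv)

lemma emeasure_mu:
  assumes B: "B \<in> sets borel"
  shows "emeasure (mu P) B = ennreal (weight (delta 0) B + weight (delta 1) B)"
proof -
  have "emeasure (mu P) B = emeasure (vec_measure P (delta 0)) B + emeasure (vec_measure P (delta 1)) B"
  proof (rule emeasure_measure_of[OF mu_def])
    show "countably_additive (sets (mu P)) (\<lambda>B. emeasure (vec_measure P (delta 0)) B + emeasure (vec_measure P (delta 1)) B)"
      unfolding countably_additive_def
    proof (intro allI impI)
      fix A :: "nat \<Rightarrow> real set"
      assume "range A \<subseteq> sets (mu P)" "disjoint_family A"
      then show "(\<Sum>i. emeasure (vec_measure P (delta 0)) (A i) + emeasure (vec_measure P (delta 1)) (A i))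
        = emeasure (vec_measure P (delta 0)) (\<Union>i. A i) + emeasure (vec_measure P (delta 1)) (\<Union>i. A i)"
        by (subst suminf_add[symmetric]) (auto intro!: arg_cong2[where f = "(+)"] suminf_emeasure)
    qed
  qed (use B in \<open>auto simp: positive_def\<close>)
  then show ?thesis using B by (simp add: emeasure_vec_measure ennreal_plus[symmetric] weight_nonneg del: ennreal_plus)
qed

lemma measure_mu: "B \<in> sets borel \<Longrightarrow> measure (mu P) B = weight (delta 0) B + weight (delta 1) B"
  by (simp add: measure_def emeasure_mu weight_nonneg del: ennreal_plus)

lemma finite_measure_mu: "finite_measure (mu P)"
  by (rule finite_measureI) (simp add: emeasure_mu)

lemma measure_mu_UNIV: "measure (mu P) UNIV = 2"
  by (simp add: measure_mu weight_UNIV)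

lemma P_inner_disjoint:
  assumes "A \<in> sets borel" "B \<in> sets borel" "A \<inter> B = {}" "\<phi> \<in> ell2" "\<psi> \<in> ell2"
  shows "inner2 (P A \<phi>) (P B \<psi>) = 0"
proof -
  have "inner2 (P A \<phi>) (P B \<psi>) = inner2 \<phi> (P A (P B \<psi>))"
    using assms by (intro P_sym P_ell2)
  also have "P A (P B \<psi>) = (\<lambda>n. 0)" using P_Int[OF assms(1,2,5)] assms(3) P_empty[OF assms(5)] by simp
  finally show ?thesis by simp
qed

lemma range_null_set_in_H_s:
  assumes A: "A \<in> null_sets lborel" "A \<in> sets borel" and \<psi>: "\<psi> \<in> ell2"
  shows "P A \<psi> \<in> H_s P"
proof -
  have c: "UNIV - A \<in> sets borel" using A(2) by auto
  have "P (UNIV - A) (P A \<psi>) = (\<lambda>n. 0)"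
    using P_Int[OF c A(2) \<psi>] P_empty[OF \<psi>] by (simp add: Int_commute Int_Diff)
  then have "emeasure (vec_measure P (P A \<psi>)) (UNIV - A) = 0"
    using emeasure_vec_measure[OF c P_ell2[OF A(2) \<psi>]] by (simp add: weight_def)
  then show ?thesis
    unfolding H_s_def lebesgue_singular_def using A P_ell2[OF A(2) \<psi>] by auto
qed

end

text \<open>A competitor differs from \<open>\<phi>\<close> by a vector orthogonal to both of them, hence to itself.\<close>

lemma proj_onto_member:
  assumes "H \<subseteq> ell2" "\<phi> \<in> H"
  shows "proj_onto H \<phi> = \<phi>"
  unfolding proj_onto_def
proof (rule the_equality)
  show "\<phi> \<in> H \<and> (\<forall>h\<in>H. inner2 (\<lambda>n. \<phi> n - \<phi> n) h = 0)" using assms by simp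
next
  fix \<phi>' assume p: "\<phi>' \<in> H \<and> (\<forall>h\<in>H. inner2 (\<lambda>n. \<phi> n - \<phi>' n) h = 0)"
  then have e: "\<phi> \<in> ell2" "\<phi>' \<in> ell2" using assms by auto
  have d: "(\<lambda>n. \<phi> n - \<phi>' n) \<in> ell2" using e by (rule ell2_diff)
  have "inner2 (\<lambda>n. \<phi> n - \<phi>' n) (\<lambda>n. \<phi> n - \<phi>' n) = 0"
    using inner2_diff_right[OF e d] p assms by simp
  then have "norm2 (\<lambda>n. \<phi> n - \<phi>' n) = 0" using inner2_self[OF d] by simp
  then show "\<phi>' = \<phi>" using norm2_eq_0_iff[OF d] by (metis (no_types, lifting) eq_iff_diff_eq_0 ext)
qed

section \<open>Spectral projections commute with the operator\<close>

locale jacobi_spectral = jacobi_op + 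
  fixes P :: "real set \<Rightarrow> operator"
  assumes spec: "is_spectral_measure (jacobi a b) P"

sublocale jacobi_spectral \<subseteq> pvm P
  using spec by unfold_locales (simp add: is_spectral_measure_def)

context jacobi_spectral
begin

lemma quadratic_form: "\<psi> \<in> ell2 \<Longrightarrow> inner2 (J \<psi>) \<psi> = of_real (\<integral>E. E \<partial>vec_measure P \<psi>)"
  using spec unfolding is_spectral_measure_def by blast

lemma integrable_id_vec_measure:
  assumes "\<psi> \<in> ell2"
  shows "integrable (vec_measure P \<psi>) (\<lambda>E. E)"
proof -
  interpret finite_measure "vec_measure P \<psi>" by (rule finite_measure_vec_measure[OF assms])
  obtain R where R: "P {-R..R} \<psi> = \<psi>"
    using P_bounded_support assms by blast
  have "P (- {-R..R}) \<psi> = (\<lambda>n. 0)"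
    using P_Compl[of "{-R..R}" \<psi>] assms R by (simp add: fun_eq_iff)
  then have "emeasure (vec_measure P \<psi>) (- {-R..R}) = 0"
    using emeasure_vec_measure[of "- {-R..R}" \<psi>] assms by (simp add: weight_def)
  then have "AE E in vec_measure P \<psi>. \<bar>E\<bar> \<le> R"
    by (intro AE_I[where N = "- {-R..R}"]) auto
  then show ?thesis by (intro integrable_const_bound[where B = R]) auto
qed

text \<open>For \<open>\<phi>\<close> in the range of \<open>P B\<close> and \<open>\<xi>\<close> in the range of its complement, the measures of
  \<open>\<phi> + c \<xi>\<close> split, hence so does the quadratic form of \<open>J\<close>, for every phase \<open>c\<close>.\<close>

lemma quadratic_form_orthogonal:
  assumes B: "B \<in> sets borel" and \<phi>: "\<phi> \<in> ell2" "P B \<phi> = \<phi>" and \<xi>: "\<xi> \<in> ell2" "P (- B) \<xi> = \<xi>"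
    and c: "cmod c = 1"
  shows "inner2 (J (\<lambda>n. c * \<xi> n + \<phi> n)) (\<lambda>n. c * \<xi> n + \<phi> n) = inner2 (J \<phi>) \<phi> + inner2 (J \<xi>) \<xi>"
proof -
  define f where "f = (\<lambda>n. c * \<xi> n + \<phi> n)"
  have f: "f \<in> ell2" unfolding f_def using ell2_lincomb[OF \<xi>(1) \<phi>(1), of c 1] by simp
  have B': "- B \<in> sets borel" using B by auto
  have w: "weight f A = weight \<phi> A + weight \<xi> A" if A: "A \<in> sets borel" for A
  proof -
    have x: "inner2 (P A \<phi>) \<xi> = 0"
      using P_inner_disjoint[of "A \<inter> B" "- B" \<phi> \<xi>] P_Int[OF A B \<phi>(1)] \<phi> \<xi> A B by auto
    have y: "inner2 (P A \<xi>) \<phi> = 0"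
      using P_inner_disjoint[of "A \<inter> - B" B \<xi> \<phi>] P_Int[OF A B' \<xi>(1)] \<phi> \<xi> A B by auto
    have "inner2 (P A f) f = inner2 (\<lambda>n. c * P A \<xi> n + P A \<phi> n) f"
      unfolding f_def P_lin[OF A \<xi>(1) \<phi>(1)] ..
    also have "\<dots> = c * inner2 (P A \<xi>) f + inner2 (P A \<phi>) f"
      using inner2_lincomb_left[OF P_ell2[OF A \<xi>(1)] P_ell2[OF A \<phi>(1)] f, of c 1] by simp
    also have "\<dots> = c * (cnj c * inner2 (P A \<xi>) \<xi>) + inner2 (P A \<phi>) \<phi>"
      using inner2_lincomb_right[OF \<xi>(1) \<phi>(1) P_ell2[OF A \<xi>(1)], of c 1]
        inner2_lincomb_right[OF \<xi>(1) \<phi>(1) P_ell2[OF A \<phi>(1)], of c 1] x y by (simp add: f_def)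
    also have "c * (cnj c * inner2 (P A \<xi>) \<xi>) = inner2 (P A \<xi>) \<xi>"
      using c complex_norm_square[of c] by (simp add: mult.assoc[symmetric])
    finally show ?thesis by (simp add: weight_def)
  qed
  let ?m = "vec_measure P f"
  have restrict: "(\<integral>E. E \<partial>vec_measure P \<zeta>) = (\<integral>E. indicator D E *\<^sub>R E \<partial>?m)"
    if D: "D \<in> sets borel" and \<zeta>: "\<zeta> \<in> ell2" and eq: "\<And>A. A \<in> sets borel \<Longrightarrow> weight f (A \<inter> D) = weight \<zeta> A" for D \<zeta>
  proof -
    have "vec_measure P \<zeta> = density ?m (indicator D)"
    proof (rule measure_eqI)
      fix A assume "A \<in> sets (vec_measure P \<zeta>)"
      then have A: "A \<in> sets borel" by simp
      have "emeasure (density ?m (indicator D)) A = emeasure ?m (D \<inter> A)"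
        using A D by (intro emeasure_restricted) auto
      then show "emeasure (vec_measure P \<zeta>) A = emeasure (density ?m (indicator D)) A"
        using A D eq[OF A] f \<zeta> by (simp add: emeasure_vec_measure Int_commute)
    qed simp
    also have "(\<integral>E. E \<partial>\<dots>) = (\<integral>E. E \<partial>density ?m (\<lambda>E. ennreal (indicator D E)))"
      by (simp add: ennreal_indicator)
    also have "\<dots> = (\<integral>E. indicator D E *\<^sub>R E \<partial>?m)"
      using D by (intro integral_density) auto
    finally show ?thesis .
  qed
  have i\<phi>: "(\<integral>E. E \<partial>vec_measure P \<phi>) = (\<integral>E. indicator B E *\<^sub>R E \<partial>?m)"
  proof (rule restrict[OF B \<phi>(1)])
    fix A :: "real set" assume A: "A \<in> sets borel"
    have "P (A \<inter> B) \<xi> = P (A \<inter> B) (P (- B) \<xi>)" using \<xi> by simp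
    also have "\<dots> = (\<lambda>n. 0)" using P_Int[of "A \<inter> B" "- B" \<xi>] A B \<xi> P_empty by (simp add: Int_assoc)
    finally have "weight \<xi> (A \<inter> B) = 0" by (simp add: weight_def)
    moreover have "weight \<phi> (A \<inter> B) = weight \<phi> A"
      using P_Int[OF A B \<phi>(1)] \<phi> by (simp add: weight_def)
    ultimately show "weight f (A \<inter> B) = weight \<phi> A" using w[of "A \<inter> B"] A B by simp
  qed
  have i\<xi>: "(\<integral>E. E \<partial>vec_measure P \<xi>) = (\<integral>E. indicator (- B) E *\<^sub>R E \<partial>?m)"
  proof (rule restrict[OF B' \<xi>(1)])
    fix A :: "real set" assume A: "A \<in> sets borel"
    have "P (A \<inter> - B) \<phi> = P (A \<inter> - B) (P B \<phi>)" using \<phi> by simp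
    also have "\<dots> = (\<lambda>n. 0)" using P_Int[of "A \<inter> - B" B \<phi>] A B \<phi> P_empty by (simp add: Int_assoc)
    finally have "weight \<phi> (A \<inter> - B) = 0" by (simp add: weight_def)
    moreover have "weight \<xi> (A \<inter> - B) = weight \<xi> A"
      using P_Int[OF A B' \<xi>(1)] \<xi> by (simp add: weight_def)
    ultimately show "weight f (A \<inter> - B) = weight \<xi> A" using w[of "A \<inter> - B"] A B' by simp
  qed
  have int: "integrable ?m (\<lambda>E. E)" by (rule integrable_id_vec_measure[OF f])
  have "(\<integral>E. E \<partial>?m) = (\<integral>E. indicator B E *\<^sub>R E + indicator (- B) E *\<^sub>R E \<partial>?m)"
    by (intro Bochner_Integration.integral_cong) (auto simp: indicator_def)
  also have "\<dots> = (\<integral>E. indicator B E *\<^sub>R E \<partial>?m) + (\<integral>E. indicator (- B) E *\<^sub>R E \<partial>?m)"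
    using int B by (intro Bochner_Integration.integral_add integrable_mult_indicator) auto
  finally have "(\<integral>E. E \<partial>?m) = (\<integral>E. E \<partial>vec_measure P \<phi>) + (\<integral>E. E \<partial>vec_measure P \<xi>)"
    unfolding i\<phi> i\<xi> .
  then show ?thesis
    unfolding f_def[symmetric] quadratic_form[OF f] quadratic_form[OF \<phi>(1)] quadratic_form[OF \<xi>(1)] by simp
qed

text \<open>Comparing the phases \<open>1\<close> and \<open>\<i>\<close> separates the two cross terms.\<close>

lemma J_off_diagonal:
  assumes B: "B \<in> sets borel" and \<phi>: "\<phi> \<in> ell2" "P B \<phi> = \<phi>" and \<xi>: "\<xi> \<in> ell2" "P (- B) \<xi> = \<xi>"
  shows "inner2 (J \<phi>) \<xi> = 0"
proof -
  have cross: "c * inner2 (J \<xi>) \<phi> + cnj c * inner2 (J \<phi>) \<xi> = 0" if c: "cmod c = 1" for c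
  proof -
    have f: "(\<lambda>n. c * \<xi> n + \<phi> n) \<in> ell2" using ell2_lincomb[OF \<xi>(1) \<phi>(1), of c 1] by simp
    have Jf: "J (\<lambda>n. c * \<xi> n + \<phi> n) = (\<lambda>n. c * J \<xi> n + 1 * J \<phi> n)"
      using jacobi_lincomb[of a b c \<xi> 1 \<phi>] by simp
    have "inner2 (J (\<lambda>n. c * \<xi> n + \<phi> n)) (\<lambda>n. c * \<xi> n + \<phi> n)
        = c * inner2 (J \<xi>) (\<lambda>n. c * \<xi> n + 1 * \<phi> n) + inner2 (J \<phi>) (\<lambda>n. c * \<xi> n + 1 * \<phi> n)"
      unfolding Jf using inner2_lincomb_left[OF J_ell2[OF \<xi>(1)] J_ell2[OF \<phi>(1)] f, of c 1] by simp
    also have "\<dots> = c * (cnj c * inner2 (J \<xi>) \<xi> + inner2 (J \<xi>) \<phi>) + (cnj c * inner2 (J \<phi>) \<xi> + inner2 (J \<phi>) \<phi>)"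
      using inner2_lincomb_right[OF \<xi>(1) \<phi>(1) J_ell2[OF \<xi>(1)], of c 1]
        inner2_lincomb_right[OF \<xi>(1) \<phi>(1) J_ell2[OF \<phi>(1)], of c 1] by simp
    finally have "inner2 (J \<phi>) \<phi> + inner2 (J \<xi>) \<xi>
      = (c * cnj c) * inner2 (J \<xi>) \<xi> + c * inner2 (J \<xi>) \<phi> + cnj c * inner2 (J \<phi>) \<xi> + inner2 (J \<phi>) \<phi>"
      unfolding quadratic_form_orthogonal[OF B \<phi> \<xi> c] by (simp add: algebra_simps)
    moreover have "c * cnj c = 1" using c complex_norm_square[of c] by simp
    ultimately show ?thesis by simp
  qed
  from cross[of 1] cross[of \<i>] show ?thesis by (simp add: add_eq_0_iff)
qed

lemma P_commutes_J:
  assumes B: "B \<in> sets borel" and \<psi>: "\<psi> \<in> ell2"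
  shows "P B (J \<psi>) = J (P B \<psi>)"
proof -
  have vanish: "P (- D) (J (P D \<psi>)) = (\<lambda>n. 0)" if D: "D \<in> sets borel" for D
  proof -
    have D': "- D \<in> sets borel" using D by auto
    have e: "J (P D \<psi>) \<in> ell2" "P (- D) (J (P D \<psi>)) \<in> ell2"
      using D D' \<psi> by (auto intro!: J_ell2 P_ell2)
    have "inner2 (J (P D \<psi>)) (P (- D) (J (P D \<psi>))) = 0"
      by (rule J_off_diagonal[OF D]) (use D D' \<psi> e P_ell2 P_idem in auto)
    then have "inner2 (P (- D) (J (P D \<psi>))) (J (P D \<psi>)) = 0"
      using inner2_commute[of "P (- D) (J (P D \<psi>))"] by simp
    then have "norm2 (P (- D) (J (P D \<psi>))) = 0" using weight_eq_norm(1)[OF D' e(1)] by simp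
    then show ?thesis using norm2_eq_0_iff[OF e(2)] by simp
  qed
  have B': "- B \<in> sets borel" using B by auto
  have e: "P B \<psi> \<in> ell2" "P (- B) \<psi> \<in> ell2" using B B' \<psi> P_ell2 by auto
  have "\<psi> = (\<lambda>n. 1 * P B \<psi> n + P (- B) \<psi> n)" using P_Compl[OF B \<psi>] by (simp add: fun_eq_iff)
  then have "P B (J \<psi>) = P B (\<lambda>n. 1 * J (P B \<psi>) n + J (P (- B) \<psi>) n)"
    using jacobi_add[of a b "P B \<psi>" "P (- B) \<psi>"] by simp
  also have "\<dots> = (\<lambda>n. P B (J (P B \<psi>)) n)"
    unfolding P_lin[OF B J_ell2[OF e(1)] J_ell2[OF e(2)]] using vanish[OF B'] by simp
  also have "\<dots> = J (P B \<psi>)"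
    using P_Compl[OF B J_ell2[OF e(1)]] vanish[OF B] by (simp add: fun_eq_iff)
  finally show ?thesis .
qed

end

section \<open>Comparing measures on the line\<close>

text \<open>In a cover of minimal cardinality no point lies in three intervals: of three intervals with a
  common point, the one reaching farthest left and the one reaching farthest right cover the third.\<close>

lemma finite_interval_subcover_multiplicity:
  fixes l r :: "'i \<Rightarrow> real"
  assumes F: "finite F" "K \<subseteq> (\<Union>i\<in>F. {l i<..<r i})"
  obtains F' where "F' \<subseteq> F" "K \<subseteq> (\<Union>i\<in>F'. {l i<..<r i})"
    "\<And>x. card {i \<in> F'. x \<in> {l i<..<r i}} \<le> 2"
proof -
  define good where "good = (\<lambda>G. G \<subseteq> F \<and> K \<subseteq> (\<Union>i\<in>G. {l i<..<r i}))"
  obtain G where G: "good G" and min: "\<And>H. good H \<Longrightarrow> card G \<le> card H"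
    using ex_has_least_nat[of good F card] F by (auto simp: good_def)
  have finG: "finite G" using G F finite_subset by (auto simp: good_def)
  have "card {i \<in> G. x \<in> {l i<..<r i}} \<le> 2" for x
  proof (rule ccontr)
    define X where "X = {i \<in> G. x \<in> {l i<..<r i}}"
    assume "\<not> ?thesis"
    then have big: "2 < card X" by (simp add: X_def)
    then have X: "finite X" "X \<noteq> {}" using card_gt_0_iff[of X] by auto
    have "Min (l ` X) \<in> l ` X" "Max (r ` X) \<in> r ` X" using X by simp_all
    then obtain p q where pq: "p \<in> X" "l p = Min (l ` X)" "q \<in> X" "r q = Max (r ` X)" by auto
    have p: "p \<in> X" "\<And>i. i \<in> X \<Longrightarrow> l p \<le> l i" and q: "q \<in> X" "\<And>i. i \<in> X \<Longrightarrow> r i \<le> r q"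
      using X by (simp_all add: pq)
    have "card {p, q} \<le> 2" by (simp add: card_insert_if)
    then have "\<not> X \<subseteq> {p, q}" using big card_mono[of "{p, q}" X] by auto
    then obtain s where s: "s \<in> X" "s \<noteq> p" "s \<noteq> q" by blast
    have cov: "{l s<..<r s} \<subseteq> {l p<..<r p} \<union> {l q<..<r q}"
    proof
      fix y assume y: "y \<in> {l s<..<r s}"
      have "x < r p" "l q < x" using p(1) q(1) by (auto simp: X_def)
      then show "y \<in> {l p<..<r p} \<union> {l q<..<r q}"
        using y p(2)[OF s(1)] q(2)[OF s(1)] by (cases "y \<le> x") auto
    qed
    have pqG: "p \<in> G - {s}" "q \<in> G - {s}" using p q s by (auto simp: X_def)
    have "K \<subseteq> (\<Union>i\<in>G - {s}. {l i<..<r i})"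
    proof
      fix y assume "y \<in> K"
      then obtain i where i: "i \<in> G" "y \<in> {l i<..<r i}" using G by (auto simp: good_def)
      show "y \<in> (\<Union>i\<in>G - {s}. {l i<..<r i})"
      proof (cases "i = s")
        case True
        then have "y \<in> {l p<..<r p} \<or> y \<in> {l q<..<r q}" using i cov by blast
        then show ?thesis using pqG by blast
      next
        case False
        then show ?thesis using i by blast
      qed
    qed
    then have "good (G - {s})" using G unfolding good_def by blast
    then have "card G \<le> card (G - {s})" by (rule min)
    moreover have "s \<in> G" using s by (simp add: X_def)
    ultimately show False using finG by (metis card_Diff1_less not_less)
  qed
  with that[of G] G show ?thesis by (auto simp: good_def)
qed

text \<open>The measures need not be doubling, so the Vitali covering theorem does not apply; the
  factor two is the multiplicity of a minimal cover.\<close>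

lemma measure_le_of_centred_intervals:
  fixes M N :: "real measure"
  assumes M: "finite_measure M" "sets M = sets borel" and N: "finite_measure N" "sets N = sets borel"
    and A: "A \<in> sets borel" and t: "0 \<le> t"
    and le: "\<And>E. E \<in> A \<Longrightarrow> \<exists>\<epsilon>>0. measure N {E-\<epsilon><..<E+\<epsilon>} \<le> t * measure M {E-\<epsilon><..<E+\<epsilon>}"
  shows "measure N A \<le> 2 * t * measure M UNIV"
proof -
  interpret M: finite_measure M by fact
  interpret N: finite_measure N by fact
  note [measurable_cong] = M(2) N(2)
  have spM: "space M = UNIV" using M(2) by (metis sets_eq_imp_space_eq space_borel)
  obtain \<rho> where \<rho>: "\<And>E. E \<in> A \<Longrightarrow> 0 < \<rho> E"
    "\<And>E. E \<in> A \<Longrightarrow> measure N {E-\<rho> E<..<E+\<rho> E} \<le> t * measure M {E-\<rho> E<..<E+\<rho> E}"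
    using le by metis
  define I where "I = (\<lambda>E. {E-\<rho> E<..<E+\<rho> E})"
  have IM: "I E \<in> sets M" "I E \<in> sets N" for E by (auto simp: I_def M(2) N(2))
  have K: "measure N K \<le> 2 * t * measure M UNIV" if K: "K \<subseteq> A" "compact K" for K
  proof -
    have "K \<subseteq> (\<Union>E\<in>A. I E)" using K \<rho>(1) by (force simp: I_def)
    then obtain F where F: "F \<subseteq> A" "finite F" "K \<subseteq> (\<Union>E\<in>F. I E)"
      using compactE_image[OF K(2), of A I] by (auto simp: I_def)
    then obtain G where G: "G \<subseteq> F" "K \<subseteq> (\<Union>E\<in>G. I E)" "\<And>x. card {E \<in> G. x \<in> I E} \<le> 2"
      using finite_interval_subcover_multiplicity[of F K "\<lambda>E. E - \<rho> E" "\<lambda>E. E + \<rho> E"] unfolding I_def by blast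
    have finG: "finite G" using G F finite_subset by blast
    have "measure N K \<le> measure N (\<Union>E\<in>G. I E)"
      using G(2) finG IM by (intro N.finite_measure_mono) auto
    also have "\<dots> \<le> (\<Sum>E\<in>G. measure N (I E))" by (intro measure_UNION_le finG IM)
    also have "\<dots> \<le> (\<Sum>E\<in>G. t * measure M (I E))"
      using \<rho>(2) G F unfolding I_def by (intro sum_mono) auto
    also have "\<dots> = t * (\<Sum>E\<in>G. measure M (I E))" by (simp add: sum_distrib_left)
    also have "(\<Sum>E\<in>G. measure M (I E)) = (\<Sum>E\<in>G. \<integral>x. indicator (I E) x \<partial>M)"
      using IM by (intro sum.cong) (auto simp: spM)
    also have "\<dots> = (\<integral>x. (\<Sum>E\<in>G. indicator (I E) x) \<partial>M)"
      using IM by (intro Bochner_Integration.integral_sum[symmetric] integrable_real_indicator) (auto simp: M.emeasure_eq_measure)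
    also have "t * \<dots> \<le> t * (\<integral>x. 2 \<partial>M)"
    proof (intro mult_left_mono integral_mono)
      show "integrable M (\<lambda>x. \<Sum>E\<in>G. indicator (I E) x :: real)"
        using IM by (intro Bochner_Integration.integrable_sum integrable_real_indicator) (auto simp: M.emeasure_eq_measure)
      fix x
      have "(\<Sum>E\<in>G. indicator (I E) x) = real (card {E \<in> G. x \<in> I E})"
        using finG by (simp add: indicator_def sum.If_cases Int_def)
      then show "(\<Sum>E\<in>G. indicator (I E) x) \<le> (2::real)" using G(3)[of x] by simp
    qed (use t in auto)
    also have "\<dots> = 2 * t * measure M UNIV" by (simp add: spM)
    finally show ?thesis .
  qed
  have "emeasure N A = (SUP K \<in> {K. K \<subseteq> A \<and> compact K}. emeasure N K)"
    by (rule inner_regular) (use N A N.emeasure_finite in auto)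
  also have "\<dots> \<le> ennreal (2 * t * measure M UNIV)"
    using K by (intro SUP_least) (auto simp: N.emeasure_eq_measure ennreal_leI)
  finally show ?thesis
    using t by (simp add: N.emeasure_eq_measure)
qed

lemma borel_measurable_measure_centred_interval:
  fixes N :: "real measure"
  assumes N: "finite_measure N" "sets N = sets borel"
  shows "(\<lambda>E. measure N {E-\<epsilon><..<E+\<epsilon>}) \<in> borel_measurable borel"
proof -
  interpret N: finite_measure N by fact
  define Q where "Q = {p :: real \<times> real. \<bar>snd p - fst p\<bar> < \<epsilon>}"
  have "open Q" unfolding Q_def by (intro open_Collect_less continuous_intros)
  then have "Q \<in> sets (borel \<Otimes>\<^sub>M borel)" unfolding borel_prod by (rule borel_open)
  also have "sets (borel \<Otimes>\<^sub>M borel) = sets (borel \<Otimes>\<^sub>M N)" using N(2) by (intro sets_pair_measure_cong) auto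
  finally have "(\<lambda>E. emeasure N (Pair E -` Q)) \<in> borel_measurable borel"
    by (rule N.measurable_emeasure_Pair)
  moreover have "Pair E -` Q = {E-\<epsilon><..<E+\<epsilon>}" for E by (auto simp: Q_def)
  ultimately show ?thesis unfolding measure_def by simp
qed

section \<open>The angle of the subordinate solution\<close>

lemma solution_nonzero_right:
  assumes a: "\<And>n. a n \<noteq> 0" and u: "is_solution a b E u" and nz: "u 0 \<noteq> 0 \<or> u 1 \<noteq> 0"
  shows "u 1 \<noteq> 0 \<or> u 2 \<noteq> 0"
proof (rule ccontr)
  assume "\<not> ?thesis"
  then have 0: "u 1 = 0" "u 2 = 0" by auto
  have "of_real (a 0) * u 0 = 0"
    using u 0 unfolding is_solution_def jacobi_def by (metis (no_types) add.right_neutral add_diff_cancel_right' diff_self mult_zero_right one_add_one)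
  then show False using a[of 0] nz 0 by simp
qed

text \<open>Two independent subordinate solutions would each be small relative to the other.\<close>

lemma subordinate_unique:
  assumes a: "\<And>n. a n \<noteq> 0" and u: "subordinate a b E u" and v: "subordinate a b E v"
  obtains c where "c \<noteq> 0" "\<And>n. v n = c * u n"
proof -
  have su: "is_solution a b E u" and sv: "is_solution a b E v" using u v by (auto simp: subordinate_def)
  have dep: "\<not> lin_indep u v"
  proof
    assume i: "lin_indep u v"
    then have i': "lin_indep v u" unfolding lin_indep_def by (metis add.commute)
    have "((\<lambda>L. norm_right L u / norm_right L v) \<longlongrightarrow> 0) at_top"
      "((\<lambda>L. norm_right L v / norm_right L u) \<longlongrightarrow> 0) at_top"
      using u v su sv i i' unfolding subordinate_def by blast+
    then have "((\<lambda>L. norm_right L u / norm_right L v * (norm_right L v / norm_right L u)) \<longlongrightarrow> 0 * 0) at_top"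
      by (rule tendsto_mult)
    then have "(\<lambda>n. norm_right (real n) u / norm_right (real n) v * (norm_right (real n) v / norm_right (real n) u))
        \<longlonglongrightarrow> 0 * 0"
      by (rule filterlim_compose[OF _ filterlim_real_sequentially])
    moreover have "norm_right (real n) u / norm_right (real n) v * (norm_right (real n) v / norm_right (real n) u) = 1"
      if "2 \<le> n" for n
      using norm_right_int_pos[of u "int n"] norm_right_int_pos[of v "int n"] that
        solution_nonzero_right[OF a su subordinate_nonzero_data[OF a u]]
        solution_nonzero_right[OF a sv subordinate_nonzero_data[OF a v]] by simp
    then have "\<forall>\<^sub>F n in sequentially. norm_right (real n) u / norm_right (real n) v * (norm_right (real n) v / norm_right (real n) u) = 1"
      unfolding eventually_sequentially by blast
    ultimately have "(\<lambda>n::nat. 1::real) \<longlonglongrightarrow> 0 * 0"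
      by (rule Lim_transform_eventually)
    then show False by (simp add: LIMSEQ_const_iff)
  qed
  then obtain c d where cd: "\<And>n. c * u n + d * v n = 0" "c \<noteq> 0 \<or> d \<noteq> 0"
    unfolding lin_indep_def by blast
  obtain n where n: "u n \<noteq> 0" using u by (auto simp: subordinate_def)
  obtain m where m: "v m \<noteq> 0" using v by (auto simp: subordinate_def)
  have d: "d \<noteq> 0" using cd(1)[of n] cd(2) n by auto
  have e: "v n = (- c / d) * u n" for n
    using cd(1)[of n] d by (simp add: field_simps add_eq_0_iff)
  show ?thesis using that[of "- c / d"] e m by (metis mult_zero_left)
qed

text \<open>The angle \<open>\<theta>\<close> in \<open>[0, \<pi>)\<close> with \<open>x * cos \<theta> + y * sin \<theta> = 0\<close> for a unit vector \<open>(x, y)\<close>, as a function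
  of \<open>p = x * y\<close> and \<open>q = x\<^sup>2\<close>, which do not depend on the sign of the vector. For \<open>q \<noteq> 0\<close> it is the
  inverse cotangent of \<open>- y / x\<close>.\<close>

definition boundary_angle :: "real \<Rightarrow> real \<Rightarrow> real" where
  "boundary_angle p q = (if q = 0 then 0 else pi / 2 + arctan (p / q))"

lemma boundary_angle_unique:
  assumes unit: "x\<^sup>2 + y\<^sup>2 = 1" and \<theta>: "0 \<le> \<theta>" "\<theta> < pi"
  shows "x * cos \<theta> + y * sin \<theta> = 0 \<longleftrightarrow> \<theta> = boundary_angle (x * y) (x\<^sup>2)"
proof (cases "x = 0")
  case True
  then have "y \<noteq> 0" using unit by auto
  moreover have "sin \<theta> = 0 \<longleftrightarrow> \<theta> = 0" using \<theta> sin_gt_zero[of \<theta>] by (cases "\<theta> = 0") auto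
  ultimately show ?thesis using True by (simp add: boundary_angle_def)
next
  case False
  then have ang: "boundary_angle (x * y) (x\<^sup>2) = pi / 2 + arctan (y / x)"
    by (simp add: boundary_angle_def power2_eq_square)
  show ?thesis
  proof
    assume eq: "x * cos \<theta> + y * sin \<theta> = 0"
    have "\<theta> \<noteq> 0" using eq False by auto
    then have s: "0 < sin \<theta>" using \<theta> by (intro sin_gt_zero) auto
    have "tan (\<theta> - pi / 2) = y / x"
    proof -
      have "tan (\<theta> - pi / 2) = - (cos \<theta> / sin \<theta>)"
        by (simp add: tan_def sin_diff cos_diff)
      also have "\<dots> = y / x" using eq s False by (simp add: field_simps)
      finally show ?thesis .
    qed
    moreover have "- (pi / 2) < \<theta> - pi / 2" "\<theta> - pi / 2 < pi / 2" using \<theta> \<open>\<theta> \<noteq> 0\<close> by auto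
    ultimately have "arctan (y / x) = \<theta> - pi / 2" by (metis arctan_tan)
    then show "\<theta> = boundary_angle (x * y) (x\<^sup>2)" unfolding ang by simp
  next
    assume "\<theta> = boundary_angle (x * y) (x\<^sup>2)"
    then have th: "\<theta> = arctan (y / x) + pi / 2" unfolding ang by simp
    have "cos \<theta> = - sin (arctan (y / x))" "sin \<theta> = cos (arctan (y / x))"
      unfolding th by (simp_all add: sin_add cos_add)
    moreover have "sin (arctan (y / x)) = y / x * cos (arctan (y / x))"
      using tan_arctan[of "y / x"] cos_arctan_not_zero[of "y / x"] by (simp add: tan_def field_simps)
    ultimately show "x * cos \<theta> + y * sin \<theta> = 0" using False by (simp add: field_simps)
  qed
qed

text \<open>The unit vector is \<open>\<plusminus> (sin \<theta>, - cos \<theta>)\<close>.\<close>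

lemma boundary_form_eq_sin_sq:
  assumes unit: "x\<^sup>2 + y\<^sup>2 = (1::real)" and eq: "x * cos \<theta> + y * sin \<theta> = 0"
  shows "(cos \<phi> * x + sin \<phi> * y)\<^sup>2 = (sin (\<theta> - \<phi>))\<^sup>2"
proof -
  define \<sigma> where "\<sigma> = x * sin \<theta> - y * cos \<theta>"
  have x: "x = \<sigma> * sin \<theta>"
  proof -
    have "\<sigma> * sin \<theta> = x * ((sin \<theta>)\<^sup>2 + (cos \<theta>)\<^sup>2) - cos \<theta> * (x * cos \<theta> + y * sin \<theta>)"
      unfolding \<sigma>_def by algebra
    then show ?thesis using eq by simp
  qed
  have y: "y = - \<sigma> * cos \<theta>"
  proof -
    have "- \<sigma> * cos \<theta> = y * ((sin \<theta>)\<^sup>2 + (cos \<theta>)\<^sup>2) - sin \<theta> * (x * cos \<theta> + y * sin \<theta>)"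
      unfolding \<sigma>_def by algebra
    then show ?thesis using eq by simp
  qed
  have "x\<^sup>2 + y\<^sup>2 = \<sigma>\<^sup>2 * ((sin \<theta>)\<^sup>2 + (cos \<theta>)\<^sup>2)" by (subst x, subst y) algebra
  then have "\<sigma>\<^sup>2 = 1" using unit by simp
  moreover have "cos \<phi> * x + sin \<phi> * y = \<sigma> * sin (\<theta> - \<phi>)"
    by (subst x, subst y) (simp add: sin_diff algebra_simps)
  ultimately show ?thesis by (simp add: power_mult_distrib)
qed

locale jacobi_subordinate = jacobi_spectral +
  fixes St :: "real set"
  assumes St: "is_S_tilde a b P St"
begin

lemma a_nonzero: "a n \<noteq> 0"
  using a_pos[of n] by simp

lemma St_borel: "St \<in> sets borel" and St_S: "St \<subseteq> S_set a b"
  using St unfolding is_S_tilde_def by blast+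

text \<open>Vectors supported on the two central sites; \<open>pair_vec (cos \<theta>) (sin \<theta>)\<close> tests the boundary
  condition at angle \<open>\<theta>\<close>.\<close>

definition pair_vec :: "real \<Rightarrow> real \<Rightarrow> int \<Rightarrow> complex" where
  "pair_vec c s = (\<lambda>n. of_real c * delta 0 n + of_real s * delta 1 n)"

lemma pair_vec_ell2 [simp]: "pair_vec c s \<in> ell2"
  unfolding pair_vec_def by (intro ell2_lincomb) auto

lemma inner2_pair_vec: "f \<in> ell2 \<Longrightarrow> inner2 f (pair_vec c s) = of_real c * f 0 + of_real s * f 1"
  unfolding pair_vec_def by (subst inner2_lincomb_right) (auto simp: inner2_delta_right)

lemma weight_pair_vec:
  assumes B: "B \<in> sets borel"
  shows "weight (pair_vec c s) B = c\<^sup>2 * Re (mu_cross P 0 0 B) + c * s * Re (mu_cross P 0 1 B)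
    + c * s * Re (mu_cross P 1 0 B) + s\<^sup>2 * Re (mu_cross P 1 1 B)"
proof -
  have z: "P B (\<lambda>n. 0) = (\<lambda>n. 0)"
    using P_lin[OF B ell2_zero ell2_zero, of 1] by (simp add: fun_eq_iff)
  have "P B (\<lambda>n. of_real s * delta 1 n + 0) = (\<lambda>n. of_real s * P B (delta 1) n + P B (\<lambda>n. 0) n)"
    by (rule P_lin[OF B delta_ell2 ell2_zero])
  then have "P B (pair_vec c s) = (\<lambda>n. of_real c * P B (delta 0) n + of_real s * P B (delta 1) n)"
    unfolding pair_vec_def using P_lin[OF B delta_ell2 ell2_scale[OF delta_ell2], of c 0 "of_real s" 1]
    by (simp add: z)
  then show ?thesis
    unfolding weight_def inner2_pair_vec[OF P_ell2[OF B pair_vec_ell2]] mu_cross_def inner2_delta_right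
    by (simp add: power2_eq_square algebra_simps)
qed

definition density_ratio :: "real \<Rightarrow> real \<Rightarrow> real \<Rightarrow> real \<Rightarrow> real" where
  "density_ratio c s E \<epsilon> = weight (pair_vec c s) {E-\<epsilon><..<E+\<epsilon>} / measure (mu P) {E-\<epsilon><..<E+\<epsilon>}"

lemma density_ratio_tendsto:
  assumes E: "E \<in> St"
  obtains u where "normalised_subordinate a b E u"
    "\<And>c s. (density_ratio c s E \<longlongrightarrow> (c * u 0 + s * u 1)\<^sup>2) (at_right 0)"
proof -
  obtain u where u: "normalised_subordinate a b E u"
    and lim: "\<And>k j. ((\<lambda>\<epsilon>. mu_cross P k j {E - \<epsilon><..<E + \<epsilon>} / of_real (measure (mu P) {E - \<epsilon><..<E + \<epsilon>}))
            \<longlongrightarrow> of_real (u k * u j)) (at_right 0)"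
    using St E unfolding is_S_tilde_def by meson
  have re: "((\<lambda>\<epsilon>. Re (mu_cross P k j {E - \<epsilon><..<E + \<epsilon>}) / measure (mu P) {E - \<epsilon><..<E + \<epsilon>})
            \<longlongrightarrow> u k * u j) (at_right 0)" for k j
    using tendsto_Re[OF lim[of k j]] by simp
  have "(density_ratio c s E \<longlongrightarrow> (c * u 0 + s * u 1)\<^sup>2) (at_right 0)" for c s
  proof -
    have "((\<lambda>\<epsilon>. c\<^sup>2 * (Re (mu_cross P 0 0 {E - \<epsilon><..<E + \<epsilon>}) / measure (mu P) {E - \<epsilon><..<E + \<epsilon>})
      + c * s * (Re (mu_cross P 0 1 {E - \<epsilon><..<E + \<epsilon>}) / measure (mu P) {E - \<epsilon><..<E + \<epsilon>})
      + c * s * (Re (mu_cross P 1 0 {E - \<epsilon><..<E + \<epsilon>}) / measure (mu P) {E - \<epsilon><..<E + \<epsilon>})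
      + s\<^sup>2 * (Re (mu_cross P 1 1 {E - \<epsilon><..<E + \<epsilon>}) / measure (mu P) {E - \<epsilon><..<E + \<epsilon>}))
      \<longlongrightarrow> c\<^sup>2 * (u 0 * u 0) + c * s * (u 0 * u 1) + c * s * (u 1 * u 0) + s\<^sup>2 * (u 1 * u 1)) (at_right 0)"
      by (intro tendsto_intros re)
    then show ?thesis
      unfolding density_ratio_def[abs_def]
      by (simp add: weight_pair_vec add_divide_distrib power2_eq_square algebra_simps)
  qed
  with u that show ?thesis by blast
qed

text \<open>The limit is taken along a sequence so that it is measurable in \<open>E\<close>.\<close>

definition limit_density :: "real \<Rightarrow> real \<Rightarrow> real \<Rightarrow> real" where
  "limit_density c s E = lim (\<lambda>n. density_ratio c s E (1 / real (Suc n)))"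

lemma limit_density_measurable [measurable]: "limit_density c s \<in> borel_measurable borel"
proof -
  have "(\<lambda>E. density_ratio c s E \<epsilon>) \<in> borel_measurable borel" for \<epsilon>
    using borel_measurable_measure_centred_interval[OF finite_measure_vec_measure[OF pair_vec_ell2], of c s \<epsilon>]
      borel_measurable_measure_centred_interval[OF finite_measure_mu, of \<epsilon>]
    unfolding density_ratio_def by (simp add: measure_vec_measure)
  then show ?thesis unfolding limit_density_def[abs_def] by (intro borel_measurable_lim_metric)
qed

lemma limit_density_eq:
  assumes "(density_ratio c s E \<longlongrightarrow> x) (at_right 0)"
  shows "limit_density c s E = x"
proof -
  have "filterlim (\<lambda>n. 1 / real (Suc n)) (at_right 0) sequentially"
    unfolding filterlim_at using LIMSEQ_inverse_real_of_nat by (auto simp: inverse_eq_divide)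
  from filterlim_compose[OF assms this] show ?thesis
    unfolding limit_density_def by (rule limI)
qed

text \<open>The limiting densities of the vectors \<open>(1, 1)\<close>, \<open>(1, 0)\<close> and \<open>(0, 1)\<close> are \<open>(u 0 + u 1)\<^sup>2\<close>, \<open>(u 0)\<^sup>2\<close> and
  \<open>(u 1)\<^sup>2\<close>, so the first argument is \<open>u 0 * u 1\<close>.\<close>

definition angle :: "real \<Rightarrow> real" where
  "angle E = boundary_angle ((limit_density 1 1 E - limit_density 1 0 E - limit_density 0 1 E) / 2) (limit_density 1 0 E)"

lemma angle_measurable [measurable]: "angle \<in> borel_measurable borel"
  unfolding angle_def[abs_def] boundary_angle_def by measurable

lemma S_theta_iff_normalised:
  assumes "normalised_subordinate a b E u"
  shows "E \<in> S_theta a b \<theta> \<longleftrightarrow> u 0 * cos \<theta> + u 1 * sin \<theta> = 0"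
proof -
  have su: "subordinate a b E (\<lambda>n. of_real (u n))"
    using assms by (simp add: normalised_subordinate_def)
  have bc: "complex_of_real (u 0) * of_real (cos \<theta>) + of_real (u 1) * of_real (sin \<theta>) = 0
      \<longleftrightarrow> u 0 * cos \<theta> + u 1 * sin \<theta> = 0"
    by (metis (no_types) of_real_0 of_real_add of_real_eq_iff of_real_mult)
  show ?thesis
  proof
    assume "E \<in> S_theta a b \<theta>"
    then obtain v where v: "subordinate a b E v" "v 0 * of_real (cos \<theta>) + v 1 * of_real (sin \<theta>) = 0"
      by (auto simp: S_theta_def)
    obtain c where c: "c \<noteq> 0" "\<And>n. v n = c * of_real (u n)"
      using subordinate_unique[OF a_nonzero su v(1)] by blast
    have "c * (of_real (u 0) * of_real (cos \<theta>) + of_real (u 1) * of_real (sin \<theta>)) = 0"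
      using v(2) unfolding c(2) by (simp add: algebra_simps)
    then show "u 0 * cos \<theta> + u 1 * sin \<theta> = 0" using c(1) bc by simp
  next
    assume "u 0 * cos \<theta> + u 1 * sin \<theta> = 0"
    then show "E \<in> S_theta a b \<theta>" using su bc unfolding S_theta_def by blast
  qed
qed

lemma S_theta_iff_angle:
  assumes E: "E \<in> St" and \<theta>: "0 \<le> \<theta>" "\<theta> < pi"
  shows "E \<in> S_theta a b \<theta> \<longleftrightarrow> \<theta> = angle E"
proof -
  obtain u where u: "normalised_subordinate a b E u"
    and d: "\<And>c s. (density_ratio c s E \<longlongrightarrow> (c * u 0 + s * u 1)\<^sup>2) (at_right 0)"
    using density_ratio_tendsto[OF E] by blast
  have unit: "(u 0)\<^sup>2 + (u 1)\<^sup>2 = 1" using u by (simp add: normalised_subordinate_def)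
  have "limit_density c s E = (c * u 0 + s * u 1)\<^sup>2" for c s by (rule limit_density_eq[OF d])
  then have "angle E = boundary_angle (u 0 * u 1) ((u 0)\<^sup>2)"
    by (simp add: angle_def power2_sum)
  then show ?thesis
    using S_theta_iff_normalised[OF u] boundary_angle_unique[OF unit \<theta>] by simp
qed

lemma S_angles_eq:
  assumes "B \<subseteq> {0..<pi}"
  shows "S_angles a b St B = angle -` B \<inter> St"
proof (intro set_eqI iffI)
  fix E assume "E \<in> S_angles a b St B"
  then obtain \<theta> where \<theta>: "\<theta> \<in> B" "E \<in> S_theta a b \<theta>" and E: "E \<in> St" by (auto simp: S_angles_def)
  have "0 \<le> \<theta>" "\<theta> < pi" using \<theta>(1) assms by auto
  with E \<theta> show "E \<in> angle -` B \<inter> St" using S_theta_iff_angle[OF E, of \<theta>] by simp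
next
  fix E assume E: "E \<in> angle -` B \<inter> St"
  then have "0 \<le> angle E" "angle E < pi" using assms by auto
  with E show "E \<in> S_angles a b St B"
    using S_theta_iff_angle[of E "angle E"] by (auto simp: S_angles_def)
qed

lemma S_angles_borel:
  assumes "B \<in> sets borel" "B \<subseteq> {0..<pi}"
  shows "S_angles a b St B \<in> sets borel"
  unfolding S_angles_eq[OF assms(2)]
  using measurable_sets[OF angle_measurable assms(1)] St_borel by simp

lemma S_angles_null:
  assumes "S_angles a b St B \<in> sets borel"
  shows "S_angles a b St B \<in> null_sets lborel"
proof -
  have "AE E in lborel. E \<notin> S_angles a b St B"
    using AE_not_subordinate by eventually_elim (use St_S in \<open>auto simp: S_angles_def\<close>)
  moreover have "S_angles a b St B \<in> sets lborel" using assms by simp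
  ultimately show ?thesis using AE_iff_null_sets by blast
qed

section \<open>The boundary form on the range of a spectral projection\<close>

text \<open>Where the subordinate angle is within \<open>\<delta>\<close> of \<open>\<theta>\<close>, the boundary form at \<open>\<theta>\<close> has
  density at most \<open>\<delta>\<^sup>2\<close> with respect to \<open>\<mu>\<close>. In the constant \<open>8\<close>, one factor two is room for strict
  inequalities on small intervals, one comes from the covering, and one is the total mass of \<open>\<mu>\<close>.\<close>

lemma weight_boundary_form_le:
  assumes A: "A \<in> sets borel" "A \<subseteq> St" and \<delta>: "0 < \<delta>"
    and near: "\<And>E. E \<in> A \<Longrightarrow> \<exists>\<theta>'. E \<in> S_theta a b \<theta>' \<and> \<bar>\<theta>' - \<theta>\<bar> \<le> \<delta>"
  shows "weight (pair_vec (cos \<theta>) (sin \<theta>)) A \<le> 8 * \<delta>\<^sup>2"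
proof -
  have "measure (vec_measure P (pair_vec (cos \<theta>) (sin \<theta>))) A \<le> 2 * (2 * \<delta>\<^sup>2) * measure (mu P) UNIV"
  proof (rule measure_le_of_centred_intervals)
    fix E assume E: "E \<in> A"
    then have ES: "E \<in> St" using A by blast
    obtain u where u: "normalised_subordinate a b E u"
      and d: "\<And>c s. (density_ratio c s E \<longlongrightarrow> (c * u 0 + s * u 1)\<^sup>2) (at_right 0)"
      using density_ratio_tendsto[OF ES] by blast
    have unit: "(u 0)\<^sup>2 + (u 1)\<^sup>2 = 1" using u by (auto simp: normalised_subordinate_def)
    obtain \<theta>' where \<theta>': "E \<in> S_theta a b \<theta>'" "\<bar>\<theta>' - \<theta>\<bar> \<le> \<delta>" using near[OF E] by blast
    have "u 0 * cos \<theta>' + u 1 * sin \<theta>' = 0" using S_theta_iff_normalised[OF u] \<theta>'(1) by simp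
    then have "(cos \<theta> * u 0 + sin \<theta> * u 1)\<^sup>2 = (sin (\<theta>' - \<theta>))\<^sup>2"
      by (rule boundary_form_eq_sin_sq[OF unit])
    also have "\<dots> \<le> \<delta>\<^sup>2"
    proof -
      have "\<bar>sin (\<theta>' - \<theta>)\<bar> \<le> \<bar>\<delta>\<bar>" using abs_sin_x_le_abs_x[of "\<theta>' - \<theta>"] \<theta>'(2) \<delta> by linarith
      then show ?thesis by (simp only: abs_le_square_iff)
    qed
    also have "\<dots> < 2 * \<delta>\<^sup>2" using \<delta> by simp
    finally have "\<forall>\<^sub>F \<epsilon> in at_right 0. density_ratio (cos \<theta>) (sin \<theta>) E \<epsilon> < 2 * \<delta>\<^sup>2"
      by (rule order_tendstoD(2)[OF d])
    \<comment> \<open>The total density \<open>u 0 ^ 2 + u 1 ^ 2 = 1\<close> excludes the default value of the quotient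
      at intervals of measure zero.\<close>
    moreover have "((\<lambda>\<epsilon>. density_ratio 1 0 E \<epsilon> + density_ratio 0 1 E \<epsilon>) \<longlongrightarrow>
        (1 * u 0 + 0 * u 1)\<^sup>2 + (0 * u 0 + 1 * u 1)\<^sup>2) (at_right 0)"
      by (intro tendsto_add d)
    then have "\<forall>\<^sub>F \<epsilon> in at_right 0. 0 < density_ratio 1 0 E \<epsilon> + density_ratio 0 1 E \<epsilon>"
      by (rule order_tendstoD(1)) (simp add: unit)
    moreover have "\<forall>\<^sub>F \<epsilon> in at_right (0::real). 0 < \<epsilon>" by (rule eventually_at_right_less)
    ultimately have "\<forall>\<^sub>F \<epsilon> in at_right 0. 0 < \<epsilon> \<and> density_ratio (cos \<theta>) (sin \<theta>) E \<epsilon> < 2 * \<delta>\<^sup>2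
        \<and> 0 < density_ratio 1 0 E \<epsilon> + density_ratio 0 1 E \<epsilon>"
      by eventually_elim auto
    then obtain \<epsilon> where \<epsilon>: "0 < \<epsilon>" "density_ratio (cos \<theta>) (sin \<theta>) E \<epsilon> < 2 * \<delta>\<^sup>2"
        "0 < density_ratio 1 0 E \<epsilon> + density_ratio 0 1 E \<epsilon>"
      using eventually_happens'[OF trivial_limit_at_right_real] by blast
    have "measure (mu P) {E-\<epsilon><..<E+\<epsilon>} \<noteq> 0" using \<epsilon>(3) by (auto simp: density_ratio_def)
    then have "0 < measure (mu P) {E-\<epsilon><..<E+\<epsilon>}" using measure_nonneg[of "mu P" "{E-\<epsilon><..<E+\<epsilon>}"] by linarith
    then have "weight (pair_vec (cos \<theta>) (sin \<theta>)) {E-\<epsilon><..<E+\<epsilon>} \<le> 2 * \<delta>\<^sup>2 * measure (mu P) {E-\<epsilon><..<E+\<epsilon>}"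
      using \<epsilon>(2) by (simp add: density_ratio_def pos_divide_less_eq)
    then show "\<exists>\<epsilon>>0. measure (vec_measure P (pair_vec (cos \<theta>) (sin \<theta>))) {E-\<epsilon><..<E+\<epsilon>}
        \<le> 2 * \<delta>\<^sup>2 * measure (mu P) {E-\<epsilon><..<E+\<epsilon>}"
      using \<epsilon>(1) by (auto simp: measure_vec_measure)
  qed (use A in \<open>auto simp: finite_measure_vec_measure finite_measure_mu\<close>)
  then show ?thesis using A by (simp add: measure_vec_measure measure_mu_UNIV)
qed

lemma boundary_form_le:
  assumes A: "A \<in> sets borel" "A \<subseteq> St" and \<delta>: "0 < \<delta>"
    and near: "\<And>E. E \<in> A \<Longrightarrow> \<exists>\<theta>'. E \<in> S_theta a b \<theta>' \<and> \<bar>\<theta>' - \<theta>\<bar> \<le> \<delta>"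
    and \<psi>: "\<psi> \<in> ell2"
  shows "cmod (P A \<psi> 0 * of_real (cos \<theta>) + P A \<psi> 1 * of_real (sin \<theta>)) \<le> 3 * \<delta> * norm2 (P A \<psi>)"
proof -
  define \<xi> where "\<xi> = pair_vec (cos \<theta>) (sin \<theta>)"
  have \<xi>: "\<xi> \<in> ell2" by (simp add: \<xi>_def)
  have \<phi>: "P A \<psi> \<in> ell2" by (rule P_ell2[OF A(1) \<psi>])
  have "(norm2 (P A \<xi>))\<^sup>2 \<le> 8 * \<delta>\<^sup>2"
    using weight_boundary_form_le[OF A \<delta> near] weight_eq_norm(2)[OF A(1) \<xi>] by (simp add: \<xi>_def)
  also have "\<dots> \<le> (3 * \<delta>)\<^sup>2" by (simp add: power_mult_distrib)
  finally have n: "norm2 (P A \<xi>) \<le> 3 * \<delta>" by (rule power2_le_imp_le) (use \<delta> in simp)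
  have "P A \<psi> 0 * of_real (cos \<theta>) + P A \<psi> 1 * of_real (sin \<theta>) = inner2 (P A \<psi>) \<xi>"
    unfolding \<xi>_def inner2_pair_vec[OF \<phi>] by (simp add: mult.commute)
  also have "\<dots> = inner2 (P A (P A \<psi>)) \<xi>" by (simp add: P_idem[OF A(1) \<psi>])
  also have "\<dots> = inner2 (P A \<psi>) (P A \<xi>)" by (rule P_sym[OF A(1) \<phi> \<xi>])
  also have "cmod \<dots> \<le> norm2 (P A \<psi>) * norm2 (P A \<xi>)"
    by (rule inner2_Cauchy_Schwarz[OF \<phi> P_ell2[OF A(1) \<xi>]])
  also have "\<dots> \<le> norm2 (P A \<psi>) * (3 * \<delta>)" using n by (intro mult_left_mono) auto
  finally show ?thesis by (simp add: mult.commute)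
qed

end

text \<open>The two operators differ only on the bond between \<open>0\<close> and \<open>1\<close>, through the
  boundary form at angle \<open>\<theta>\<close>.\<close>

lemma norm2_jacobi_minus_J_theta:
  assumes a: "0 < a 0" and \<theta>: "0 < sin \<theta>" "0 < cos \<theta>"
  shows "norm2 (\<lambda>n. jacobi a b \<phi> n - J_theta a b \<theta> \<phi> n)
    \<le> a 0 * (1 / sin \<theta> + 1 / cos \<theta>) * cmod (\<phi> 0 * of_real (cos \<theta>) + \<phi> 1 * of_real (sin \<theta>))"
proof -
  define X where "X = \<phi> 0 * of_real (cos \<theta>) + \<phi> 1 * of_real (sin \<theta>)"
  define D where "D = (\<lambda>n. jacobi a b \<phi> n - J_theta a b \<theta> \<phi> n)"
  have D: "D = (\<lambda>n. of_real (a 0 / sin \<theta>) * X * delta 0 n + of_real (a 0 / cos \<theta>) * X * delta 1 n)"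
  proof
    fix n :: int
    consider "n < 0" | "n = 0" | "n = 1" | "1 < n" by linarith
    then show "D n = of_real (a 0 / sin \<theta>) * X * delta 0 n + of_real (a 0 / cos \<theta>) * X * delta 1 n"
    proof cases
      case 2
      have "D n = of_real (a 0) * \<phi> 1 + of_real (a 0 * cot \<theta>) * \<phi> 0"
        by (simp add: 2 D_def J_theta_def compression_def restrict_vec_def jacobi_def delta_def)
      also have "\<dots> = of_real (a 0 / sin \<theta>) * X"
        using \<theta> by (simp add: X_def cot_def field_simps)
      finally show ?thesis by (simp add: 2 delta_def)
    next
      case 3
      have "D n = of_real (a 0) * \<phi> 0 + of_real (a 0 * tan \<theta>) * \<phi> 1"
        by (simp add: 3 D_def J_theta_def compression_def restrict_vec_def jacobi_def delta_def)
      also have "\<dots> = of_real (a 0 / cos \<theta>) * X"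
        using \<theta> by (simp add: X_def tan_def field_simps)
      finally show ?thesis by (simp add: 3 delta_def)
    qed (auto simp: D_def J_theta_def compression_def restrict_vec_def jacobi_def delta_def)
  qed
  have "norm2 D \<le> norm2 (\<lambda>n. of_real (a 0 / sin \<theta>) * X * delta 0 n) + norm2 (\<lambda>n. of_real (a 0 / cos \<theta>) * X * delta 1 n)"
    unfolding D by (intro norm2_triangle ell2_scale delta_ell2)
  also have "\<dots> = a 0 * (1 / sin \<theta> + 1 / cos \<theta>) * cmod X"
    using a \<theta> unfolding norm2_scale by (simp add: norm_mult norm_divide field_simps)
  finally show ?thesis unfolding D_def X_def .
qed

theorem theorem1p5:
  fixes a b :: "int \<Rightarrow> real"
    and P :: "real set \<Rightarrow> operator"
    and St :: "real set"
  assumes "bounded_jacobi a b"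
    and "is_spectral_measure (jacobi a b) P"
    and "is_S_tilde a b P St"
  shows "(\<forall>B\<in>sets borel. B \<subseteq> {0..<pi} \<longrightarrow> (\<forall>\<psi>\<in>ell2.
             Q_measure a b P St B (jacobi a b \<psi>) = jacobi a b (Q_measure a b P St B \<psi>))) \<and>
         (\<forall>x\<in>{0<..<pi/2}. \<forall>y\<in>{0<..<pi/2}. \<exists>\<gamma>>0.
            \<forall>\<alpha>\<in>{x<..<y}. \<forall>\<beta>\<in>{x<..<y}. \<alpha> < \<beta> \<longrightarrow>
              (\<forall>\<theta>\<in>{\<alpha>..<\<beta>}. \<forall>\<psi>\<in>ell2_weighted.
                 let \<phi> = Q_measure a b P St {\<alpha>..<\<beta>} \<psi>;
                     d = norm2 (\<lambda>n. J_s a b P \<phi> n - J_theta a b \<theta> \<phi> n);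
                     r = \<gamma> * \<bar>\<beta> - \<alpha>\<bar> * norm2 \<phi>
                 in d \<le> r \<and> (\<phi> \<noteq> (\<lambda>n. 0) \<longrightarrow> d < r)))"
proof -
  obtain Ka Kb where K: "\<And>n. norm (a n) \<le> Ka" "\<And>n. norm (b n) \<le> Kb"
    using assms(1) unfolding bounded_jacobi_def bounded_iff by auto
  have "a n \<le> max Ka Kb" "\<bar>b n\<bar> \<le> max Ka Kb" for n
    using K(1)[of n] K(2)[of n] by (auto simp: le_max_iff_disj abs_le_iff)
  then interpret jacobi_subordinate a b "max Ka Kb" P St
    using assms by unfold_locales (auto simp: bounded_jacobi_def)
  show ?thesis
  proof (intro conjI ballI impI)
    fix B :: "real set" and \<psi>
    assume "B \<in> sets borel" "B \<subseteq> {0..<pi}" "\<psi> \<in> ell2"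
    then show "Q_measure a b P St B (jacobi a b \<psi>) = jacobi a b (Q_measure a b P St B \<psi>)"
      unfolding Q_measure_def by (intro P_commutes_J S_angles_borel)
  next
    fix x y :: real
    assume x: "x \<in> {0<..<pi/2}" and y: "y \<in> {0<..<pi/2}"
    have sx: "0 < sin x" using x by (intro sin_gt_zero) auto
    have cy: "0 < cos y" using y by (intro cos_gt_zero) auto
    define C where "C = 3 * a 0 * (1 / sin x + 1 / cos y)"
    have C: "0 < C" using a_pos[of 0] sx cy by (simp add: C_def add_pos_pos)
    show "\<exists>\<gamma>>0. \<forall>\<alpha>\<in>{x<..<y}. \<forall>\<beta>\<in>{x<..<y}. \<alpha> < \<beta> \<longrightarrow>
              (\<forall>\<theta>\<in>{\<alpha>..<\<beta>}. \<forall>\<psi>\<in>ell2_weighted.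
                 let \<phi> = Q_measure a b P St {\<alpha>..<\<beta>} \<psi>;
                     d = norm2 (\<lambda>n. J_s a b P \<phi> n - J_theta a b \<theta> \<phi> n);
                     r = \<gamma> * \<bar>\<beta> - \<alpha>\<bar> * norm2 \<phi>
                 in d \<le> r \<and> (\<phi> \<noteq> (\<lambda>n. 0) \<longrightarrow> d < r))"
      \<comment> \<open>The summand \<open>1\<close> makes the inequality strict for nonzero \<open>\<phi>\<close>.\<close>
    proof (intro exI[of _ "C + 1"] conjI ballI impI)
      fix \<alpha> \<beta> \<theta> :: real and \<psi>
      assume \<alpha>: "\<alpha> \<in> {x<..<y}" and \<beta>: "\<beta> \<in> {x<..<y}" and \<alpha>\<beta>: "\<alpha> < \<beta>" and \<theta>: "\<theta> \<in> {\<alpha>..<\<beta>}"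
        and "\<psi> \<in> ell2_weighted"
      then have \<psi>: "\<psi> \<in> ell2" by (simp add: ell2_weighted_def)
      define A where "A = S_angles a b St {\<alpha>..<\<beta>}"
      define \<phi> where "\<phi> = P A \<psi>"
      define d where "d = norm2 (\<lambda>n. J_s a b P \<phi> n - J_theta a b \<theta> \<phi> n)"
      have sub: "{\<alpha>..<\<beta>} \<subseteq> {0..<pi}" using \<alpha> \<beta> x y by auto
      have A: "A \<in> sets borel" unfolding A_def by (rule S_angles_borel[OF _ sub]) simp
      have ASt: "A \<subseteq> St" by (auto simp: A_def S_angles_def)
      have Hs: "\<phi> \<in> H_s P" unfolding \<phi>_def
        using A S_angles_null[of "{\<alpha>..<\<beta>}"] by (intro range_null_set_in_H_s \<psi>) (auto simp: A_def)
      then have Js: "J_s a b P \<phi> = jacobi a b \<phi>"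
        unfolding J_s_def by (subst proj_onto_member) (auto simp: H_s_def)
      have near: "\<exists>\<theta>'. E \<in> S_theta a b \<theta>' \<and> \<bar>\<theta>' - \<theta>\<bar> \<le> \<beta> - \<alpha>" if E: "E \<in> A" for E
      proof -
        obtain \<theta>' where "\<theta>' \<in> {\<alpha>..<\<beta>}" "E \<in> S_theta a b \<theta>'" using E by (auto simp: A_def S_angles_def)
        then show ?thesis using \<theta> by (intro exI[of _ \<theta>']) auto
      qed
      have bf: "cmod (\<phi> 0 * of_real (cos \<theta>) + \<phi> 1 * of_real (sin \<theta>)) \<le> 3 * (\<beta> - \<alpha>) * norm2 \<phi>"
        unfolding \<phi>_def by (rule boundary_form_le[OF A ASt _ near \<psi>]) (use \<alpha>\<beta> in auto)
      have s: "sin x \<le> sin \<theta>" using \<theta> \<alpha> \<beta> x y by (intro sin_monotone_2pi_le) auto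
      have c: "cos y \<le> cos \<theta>" using \<theta> \<alpha> \<beta> x y by (intro cos_monotone_0_pi_le) auto
      have "d \<le> a 0 * (1 / sin \<theta> + 1 / cos \<theta>) * cmod (\<phi> 0 * of_real (cos \<theta>) + \<phi> 1 * of_real (sin \<theta>))"
        unfolding d_def Js by (rule norm2_jacobi_minus_J_theta) (use a_pos s c sx cy in auto)
      also have "\<dots> \<le> a 0 * (1 / sin x + 1 / cos y) * (3 * (\<beta> - \<alpha>) * norm2 \<phi>)"
        using a_pos[of 0] s c sx cy bf
        by (intro mult_mono mult_left_mono add_mono divide_left_mono mult_nonneg_nonneg add_nonneg_nonneg) auto
      also have "\<dots> = C * \<bar>\<beta> - \<alpha>\<bar> * norm2 \<phi>" using \<alpha>\<beta> by (simp add: C_def)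
      finally have dC: "d \<le> C * \<bar>\<beta> - \<alpha>\<bar> * norm2 \<phi>" .
      have e: "(C + 1) * \<bar>\<beta> - \<alpha>\<bar> * norm2 \<phi> = C * \<bar>\<beta> - \<alpha>\<bar> * norm2 \<phi> + \<bar>\<beta> - \<alpha>\<bar> * norm2 \<phi>"
        by (simp add: algebra_simps)
      have pos: "0 < \<bar>\<beta> - \<alpha>\<bar> * norm2 \<phi>" if "\<phi> \<noteq> (\<lambda>n. 0)"
        using that \<alpha>\<beta> norm2_eq_0_iff[OF P_ell2[OF A \<psi>], folded \<phi>_def] norm2_nonneg[of \<phi>]
        by (simp add: less_le)
      have nn: "0 \<le> \<bar>\<beta> - \<alpha>\<bar> * norm2 \<phi>" by simp
      have "d \<le> (C + 1) * \<bar>\<beta> - \<alpha>\<bar> * norm2 \<phi> \<and> (\<phi> \<noteq> (\<lambda>n. 0) \<longrightarrow> d < (C + 1) * \<bar>\<beta> - \<alpha>\<bar> * norm2 \<phi>)"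
        unfolding e using dC nn pos by (intro conjI impI; linarith)
      then show "let \<phi> = Q_measure a b P St {\<alpha>..<\<beta>} \<psi>;
                     d = norm2 (\<lambda>n. J_s a b P \<phi> n - J_theta a b \<theta> \<phi> n);
                     r = (C + 1) * \<bar>\<beta> - \<alpha>\<bar> * norm2 \<phi>
                 in d \<le> r \<and> (\<phi> \<noteq> (\<lambda>n. 0) \<longrightarrow> d < r)"
        unfolding Let_def Q_measure_def A_def[symmetric] \<phi>_def[symmetric] d_def .
    qed (use C in simp)
  qed
qed

end
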